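(* Let $\mathrm{Der}^-(\mathfrak{N},\mathcal{W})=\bigoplus_{k\le -1}\mathrm{Der}_{[k]}(\mathfrak{N},\mathcal{W})$. If $n$ is even, then $$\mathrm{Der}^-(\mathfrak{N},\mathcal{W})=\mathrm{ad}\,\mathcal{W}_{[-1]}+\sum_{1\le r\le 2m}\ \sum_{\substack{1\le s_r\le t_r-1\\ n-p^{s_r}<0}}\big(\mathbb{F}\,\Phi_r^{(s_r)}+\mathbb{F}\,\Theta_r^{(s_r)}\big)+\sum_{r\in Y_0}\ \sum_{1\le s_r\le t_r-1}\mathbb{F}\,(\mathrm{ad}\,\partial_r)^{p^{s_r}}.$$ If $n$ is odd, then $$\mathrm{Der}^-(\mathfrak{N},\mathcal{W})=\mathrm{ad}\,\mathcal{W}_{[-1]}+\sum_{r\in Y_0}\ \sum_{1\le s_r\le t_r-1}\mathbb{F}\,(\mathrm{ad}\,\partial_r)^{p^{s_r}}.$$ (All maps on the right-hand sides are restricted to $\mathfrak{N}$.)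
   Context: Let $\mathbb{F}$ be a field of characteristic $p>3$, and let $m>1$, $n>3$ be integers. Put $Y_0=\{1,\dots,2m\}$, $Y_1=\{2m+1,\dots,2m+n\}$, $Y=Y_0\cup Y_1$. Fix $\underline t=(t_1,\dots,t_{2m})$ with positive integer entries, $\pi_i=p^{t_i}-1$, $\pi=(\pi_1,\dots,\pi_{2m})$, $\mathbb{A}=\{\alpha\in\mathbb{N}_0^{2m}:\alpha_i\le\pi_i\}$, $|\alpha|=\sum\alpha_i$; $\varepsilon_i$ is the $i$-th unit vector. $\mathbb{B}_k$ is the set of strictly increasing $k$-tuples $u=\langle i_1,\dots,i_k\rangle$ in $Y_1$ (also viewed as subsets), $|u|=k$, $\mathbb{B}=\bigcup_{k=0}^n\mathbb{B}_k$, $\mathbb{B}^0=\{u\in\mathbb{B}: |u|\text{ even}\}$, $x^u=x_{i_1}\cdots x_{i_k}$, $x^{\emptyset}=1$, $\omega=\langle 2m+1,\dots,2m+n\rangle$ (so $|\omega|=n$). $\mathcal{O}=\mathcal{O}(2m,n;\underline t)$ is the associative superalgebra with basis $\{x^{(\alpha)}x^u:\alpha\in\mathbb{A},u\in\mathbb{B}\}$ and products $x^{(\alpha)}x^{(\beta)}=\prod_i\binom{\alpha_i+\beta_i}{\alpha_i}x^{(\alpha+\beta)}$ (zero if $\alpha+\beta\notin\mathbb{A}$), $x_kx_l=-x_lx_k$, $x_k^2=0$ for $k,l\in Y_1$, $x^{(\alpha)}x_k=x_kx^{(\alpha)}$; write $x_i=x^{(\varepsilon_i)}$ for $i\in Y_0$.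 The parity of $x^{(\alpha)}x^u$ is $|u|$ mod 2 and its $\mathbb{Z}$-degree is $|\alpha|+|u|$. The superderivations $\partial_i$ ($i\in Y$) are $\partial_i(x^{(\alpha)}x^u)=x^{(\alpha-\varepsilon_i)}x^u$ for $i\in Y_0$ (zero if $\alpha_i=0$), and $\partial_i(x^{(\alpha)}x^u)=x^{(\alpha)}\,\partial x^u/\partial x_i$ (left derivative) for $i\in Y_1$; $\mu(i)=\overline 0$ for $i\in Y_0$, $\mu(i)=\overline 1$ for $i\in Y_1$ is the parity of $\partial_i$. $W=\{\sum_{i\in Y}a_i\partial_i: a_i\in\mathcal{O}\}$ is the generalized Witt Lie superalgebra (an $\mathcal{O}$-module), with bracket $[a\partial_i,b\partial_j]=a\partial_i(b)\partial_j-(-1)^{\mathrm p(a\partial_i)\mathrm p(b\partial_j)}b\partial_j(a)\partial_i$, where $\mathrm p(a\partial_i)=\mathrm p(a)+\mu(i)$; $(\mathrm{ad}\,D)(x)=[D,x]$. It is $\mathbb{Z}$-graded: $W_{[k]}$ is spanned by $f\partial_s$ with $f$ homogeneous of degree $k+1$. $\mathcal{W}$ is the even part of $W$, with the induced $\mathbb{Z}$-grading. For $i\in Y_0$: $i'=i+m$, $\tau(i)=1$ if $i\le m$; $i'=i-m$, $\tau(i)=-1$ if $m<i\le 2m$; for $i\in Y_1$: $i'=i$, $\tau(i)=1$. Define the linear map $\mathrm{D_H}:\mathcal{O}\to W$ by $\mathrm{D_H}(a)=\sum_{i\in Y}\tau(i)(-1)^{\mu(i)\mathrm p(a)}\partial_i(a)\partial_{i'}$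 for homogeneous $a$; its kernel is $\mathbb{F}1$. Let $$\mathfrak{N}=\mathrm{span}_{\mathbb{F}}\{\mathrm{D_H}(x^{(\alpha)}x^u):\alpha\in\mathbb{A},u\in\mathbb{B}^0,(\alpha,u)\ne(\pi,\omega),(\alpha,u)\ne(\pi,\emptyset)\},$$ a $\mathbb{Z}$-graded Lie subalgebra of $\mathcal{W}$ ($\mathrm{D_H}(x^{(\alpha)}x^u)$ has degree $|\alpha|+|u|-2$; $[k]$ denotes the degree-$k$ component). $\mathrm{Der}(\mathfrak{N},\mathcal{W})$ is the space of linear maps $D:\mathfrak{N}\to\mathcal{W}$ with $D([x,y])=[x,D(y)]-[y,D(x)]$, and $\mathrm{Der}_{[k]}(\mathfrak{N},\mathcal{W})$ is the subspace of those $D$ with $D(\mathfrak{N}_{[i]})\subset\mathcal{W}_{[i+k]}$ for all $i$. For $n$ even, $r\in Y_0$ and a positive integer $q$: $\Phi_r^{(q)}(\mathrm{D_H}(f))=\partial_r^{p^q}(f)\,\mathrm{D_H}(x^{\omega})$ and $\Theta_r^{(q)}(\mathrm{D_H}(f))=x^{\omega}(\mathrm{ad}\,\partial_r)^{p^q}(\mathrm{D_H}(f))$, linear maps into $\mathcal{W}$. *)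

theory Defs
  imports
    Complex_Main
    "HOL-Library.Function_Algebras"
    "HOL-Library.Set_Algebras"
    "HOL-Computational_Algebra.Computational_Algebra"
begin

text \<open>
  The parameters are the characteristic \<open>p\<close>, the numbers \<open>m\<close> and \<open>n\<close> (there are \<open>2m\<close> even and \<open>n\<close> odd
  variables) and the tuple \<open>t\<close>, of which only the entries \<open>t 1, \<dots>, t (2 * m)\<close> are used.

  An element of \<open>\<O>(2m,n;t)\<close> is given by its coordinates in the basis \<open>x\<^sup>(\<^sup>\<alpha>\<^sup>) x\<^sup>u\<close>, that is by a function
  on pairs \<open>(\<alpha>,u)\<close> vanishing off the basis.  The strictly increasing tuple \<open>u\<close> is represented by the
  set of its entries.  Since \<open>W\<close> is a free \<open>\<O>\<close>-module on the \<open>\<partial>\<^sub>i\<close>, an element \<open>\<Sum>i. a\<^sub>i \<partial>\<^sub>i\<close> of \<open>W\<close> is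
  given by the family of its coefficients \<open>a\<^sub>i\<close>, which vanishes off \<open>Y\<close>.
  Addition of elements of \<open>\<O>\<close> and \<open>W\<close>, and of maps \<open>W \<rightarrow> W\<close>, is the pointwise addition of functions.
\<close>

type_synonym 'a super_poly = "(nat \<Rightarrow> nat) \<times> nat set \<Rightarrow> 'a"
type_synonym 'a super_vf = "nat \<Rightarrow> 'a super_poly"
type_synonym 'a vf_map = "'a super_vf \<Rightarrow> 'a super_vf"

definition scaleO :: "'a::field \<Rightarrow> 'a super_poly \<Rightarrow> 'a super_poly" where
  "scaleO c f = (\<lambda>z. c * f z)"

definition scaleW :: "'a::field \<Rightarrow> 'a super_vf \<Rightarrow> 'a super_vf" where
  "scaleW c D = (\<lambda>i. scaleO c (D i))"

definition scaleL :: "'a::field \<Rightarrow> 'a vf_map \<Rightarrow> 'a vf_map" where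
  "scaleL c \<phi> = (\<lambda>x. scaleW c (\<phi> x))"

lemma vector_space_scaleO: "vector_space (scaleO :: 'a::field \<Rightarrow> _)"
  by unfold_locales (auto simp: scaleO_def fun_eq_iff algebra_simps)

lemma vector_space_scaleW: "vector_space (scaleW :: 'a::field \<Rightarrow> _)"
  by unfold_locales (auto simp: scaleW_def scaleO_def fun_eq_iff algebra_simps)

lemma vector_space_scaleL: "vector_space (scaleL :: 'a::field \<Rightarrow> _)"
  by unfold_locales (auto simp: scaleL_def scaleW_def scaleO_def fun_eq_iff algebra_simps)


subsection \<open>The superalgebra \<open>\<O>(2m,n;t)\<close>\<close>

definition Y0 :: "nat \<Rightarrow> nat set" where
  "Y0 m = {1..2*m}"

definition Y1 :: "nat \<Rightarrow> nat \<Rightarrow> nat set" where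
  "Y1 m n = {2*m+1..2*m+n}"

definition Y :: "nat \<Rightarrow> nat \<Rightarrow> nat set" where
  "Y m n = Y0 m \<union> Y1 m n"

definition pi_max :: "nat \<Rightarrow> nat \<Rightarrow> (nat \<Rightarrow> nat) \<Rightarrow> nat \<Rightarrow> nat" where
  "pi_max p m t = (\<lambda>i. if i \<in> Y0 m then p ^ t i - 1 else 0)"

definition multi_idx :: "nat \<Rightarrow> nat \<Rightarrow> (nat \<Rightarrow> nat) \<Rightarrow> (nat \<Rightarrow> nat) set" where
  "multi_idx p m t = {\<alpha>. (\<forall>i\<in>Y0 m. \<alpha> i \<le> pi_max p m t i) \<and> (\<forall>i. i \<notin> Y0 m \<longrightarrow> \<alpha> i = 0)}"

definition basis_idx :: "nat \<Rightarrow> nat \<Rightarrow> nat \<Rightarrow> (nat \<Rightarrow> nat) \<Rightarrow> ((nat \<Rightarrow> nat) \<times> nat set) set" where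
  "basis_idx p m n t = multi_idx p m t \<times> Pow (Y1 m n)"

definition O_alg :: "nat \<Rightarrow> nat \<Rightarrow> nat \<Rightarrow> (nat \<Rightarrow> nat) \<Rightarrow> 'a::field super_poly set" where
  "O_alg p m n t = {f. \<forall>z. f z \<noteq> 0 \<longrightarrow> z \<in> basis_idx p m n t}"

text \<open>The basis element \<open>x\<^sup>(\<^sup>\<alpha>\<^sup>) x\<^sup>u\<close>.\<close>

definition xmono :: "(nat \<Rightarrow> nat) \<Rightarrow> nat set \<Rightarrow> 'a::field super_poly" where
  "xmono \<alpha> u = (\<lambda>z. if z = (\<alpha>, u) then 1 else 0)"

definition mono_degree :: "nat \<Rightarrow> (nat \<Rightarrow> nat) \<Rightarrow> nat set \<Rightarrow> nat" where
  "mono_degree m \<alpha> u = (\<Sum>i\<in>Y0 m. \<alpha> i) + card u"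

text \<open>\<open>x\<^sup>u x\<^sup>v = wedge_sign u v \<cdot> x\<^bsup>u \<union> v\<^esup>\<close> for disjoint \<open>u\<close> and \<open>v\<close>: the sign counts the transpositions that
  sort the concatenation of the two increasing tuples.\<close>

definition wedge_sign :: "nat set \<Rightarrow> nat set \<Rightarrow> 'a::field" where
  "wedge_sign u v = (- 1) ^ card {(i, j). i \<in> u \<and> j \<in> v \<and> j < i}"

definition mono_mult ::
  "nat \<Rightarrow> nat \<Rightarrow> (nat \<Rightarrow> nat) \<Rightarrow> (nat \<Rightarrow> nat) \<times> nat set \<Rightarrow> (nat \<Rightarrow> nat) \<times> nat set \<Rightarrow> 'a::field super_poly" where
  "mono_mult p m t = (\<lambda>(\<alpha>, u) (\<beta>, v).
     if \<alpha> + \<beta> \<in> multi_idx p m t \<and> u \<inter> v = {}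
     then scaleO ((\<Prod>i\<in>Y0 m. of_nat ((\<alpha> i + \<beta> i) choose (\<alpha> i))) * wedge_sign u v) (xmono (\<alpha> + \<beta>) (u \<union> v))
     else 0)"

definition O_mult ::
  "nat \<Rightarrow> nat \<Rightarrow> nat \<Rightarrow> (nat \<Rightarrow> nat) \<Rightarrow> 'a::field super_poly \<Rightarrow> 'a super_poly \<Rightarrow> 'a super_poly" where
  "O_mult p m n t f g =
     (\<Sum>z\<in>basis_idx p m n t. \<Sum>w\<in>basis_idx p m n t. scaleO (f z * g w) (mono_mult p m t z w))"

text \<open>On odd variables the left derivative moves \<open>x\<^sub>i\<close> to the front before removing it.\<close>

definition mono_partial :: "nat \<Rightarrow> nat \<Rightarrow> (nat \<Rightarrow> nat) \<times> nat set \<Rightarrow> 'a::field super_poly" where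
  "mono_partial m i = (\<lambda>(\<alpha>, u).
     if i \<in> Y0 m then (if \<alpha> i = 0 then 0 else xmono (\<alpha>(i := \<alpha> i - 1)) u)
     else (if i \<in> u then scaleO ((- 1) ^ card {j \<in> u. j < i}) (xmono \<alpha> (u - {i})) else 0))"

definition partial ::
  "nat \<Rightarrow> nat \<Rightarrow> nat \<Rightarrow> (nat \<Rightarrow> nat) \<Rightarrow> nat \<Rightarrow> 'a::field super_poly \<Rightarrow> 'a super_poly" where
  "partial p m n t i f = (\<Sum>z\<in>basis_idx p m n t. scaleO (f z) (mono_partial m i z))"

text \<open>Parities are the numbers 0 and 1; \<open>parity_part \<theta> f\<close> is the component of \<open>f\<close> of parity \<open>\<theta>\<close>.\<close>

definition par :: "nat \<Rightarrow> nat \<Rightarrow> nat" where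
  "par m i = (if i \<in> Y0 m then 0 else 1)"

definition parity_part :: "nat \<Rightarrow> 'a::field super_poly \<Rightarrow> 'a super_poly" where
  "parity_part \<theta> f = (\<lambda>(\<alpha>, u). if card u mod 2 = \<theta> then f (\<alpha>, u) else 0)"


subsection \<open>The generalized Witt superalgebra\<close>

definition W_alg :: "nat \<Rightarrow> nat \<Rightarrow> nat \<Rightarrow> (nat \<Rightarrow> nat) \<Rightarrow> 'a::field super_vf set" where
  "W_alg p m n t = {D. (\<forall>i\<in>Y m n. D i \<in> O_alg p m n t) \<and> (\<forall>i. i \<notin> Y m n \<longrightarrow> D i = 0)}"

text \<open>The element \<open>a \<partial>\<^sub>i\<close>.\<close>

definition vf :: "'a::field super_poly \<Rightarrow> nat \<Rightarrow> 'a super_vf" where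
  "vf a i = (\<lambda>j. if j = i then a else 0)"

definition ddx :: "nat \<Rightarrow> 'a::field super_vf" where
  "ddx i = vf (xmono 0 {}) i"

definition O_act ::
  "nat \<Rightarrow> nat \<Rightarrow> nat \<Rightarrow> (nat \<Rightarrow> nat) \<Rightarrow> 'a::field super_poly \<Rightarrow> 'a super_vf \<Rightarrow> 'a super_vf" where
  "O_act p m n t f D = (\<lambda>i. O_mult p m n t f (D i))"

text \<open>\<open>hom_bracket \<theta> \<eta> a i b j\<close> is \<open>[a \<partial>\<^sub>i, b \<partial>\<^sub>j]\<close> for homogeneous \<open>a\<close>, \<open>b\<close> of parities \<open>\<theta>\<close>, \<open>\<eta>\<close>.\<close>

definition hom_bracket ::
  "nat \<Rightarrow> nat \<Rightarrow> nat \<Rightarrow> (nat \<Rightarrow> nat) \<Rightarrow> nat \<Rightarrow> nat \<Rightarrow>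
   'a::field super_poly \<Rightarrow> nat \<Rightarrow> 'a super_poly \<Rightarrow> nat \<Rightarrow> 'a super_vf" where
  "hom_bracket p m n t \<theta> \<eta> a i b j =
     vf (O_mult p m n t a (partial p m n t i b)) j
     - scaleW ((- 1) ^ ((\<theta> + par m i) * (\<eta> + par m j))) (vf (O_mult p m n t b (partial p m n t j a)) i)"

definition bracket ::
  "nat \<Rightarrow> nat \<Rightarrow> nat \<Rightarrow> (nat \<Rightarrow> nat) \<Rightarrow> 'a::field super_vf \<Rightarrow> 'a super_vf \<Rightarrow> 'a super_vf" where
  "bracket p m n t D E =
     (\<Sum>i\<in>Y m n. \<Sum>j\<in>Y m n. \<Sum>\<theta>\<in>{0,1}. \<Sum>\<eta>\<in>{0,1}.
        hom_bracket p m n t \<theta> \<eta> (parity_part \<theta> (D i)) i (parity_part \<eta> (E j)) j)"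

abbreviation ad ::
  "nat \<Rightarrow> nat \<Rightarrow> nat \<Rightarrow> (nat \<Rightarrow> nat) \<Rightarrow> 'a::field super_vf \<Rightarrow> 'a vf_map" where
  "ad p m n t D \<equiv> bracket p m n t D"

definition O_deg :: "nat \<Rightarrow> nat \<Rightarrow> nat \<Rightarrow> (nat \<Rightarrow> nat) \<Rightarrow> int \<Rightarrow> 'a::field super_poly set" where
  "O_deg p m n t d =
     {f \<in> O_alg p m n t. \<forall>\<alpha> u. f (\<alpha>, u) \<noteq> 0 \<longrightarrow> int (mono_degree m \<alpha> u) = d}"

definition W_deg :: "nat \<Rightarrow> nat \<Rightarrow> nat \<Rightarrow> (nat \<Rightarrow> nat) \<Rightarrow> int \<Rightarrow> 'a::field super_vf set" where
  "W_deg p m n t k =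
     module.span scaleW {vf f s | f s. f \<in> O_deg p m n t (k + 1) \<and> s \<in> Y m n}"

definition W_even :: "nat \<Rightarrow> nat \<Rightarrow> nat \<Rightarrow> (nat \<Rightarrow> nat) \<Rightarrow> 'a::field super_vf set" where
  "W_even p m n t =
     {D \<in> W_alg p m n t. \<forall>i\<in>Y m n. \<forall>\<alpha> u. D i (\<alpha>, u) \<noteq> 0 \<longrightarrow> even (card u + par m i)}"

definition W_even_deg :: "nat \<Rightarrow> nat \<Rightarrow> nat \<Rightarrow> (nat \<Rightarrow> nat) \<Rightarrow> int \<Rightarrow> 'a::field super_vf set" where
  "W_even_deg p m n t k = W_even p m n t \<inter> W_deg p m n t k"


subsection \<open>Hamiltonian vector fields and the algebra \<open>\<NN>\<close>\<close>

definition conj_idx :: "nat \<Rightarrow> nat \<Rightarrow> nat" where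
  "conj_idx m i = (if i \<in> Y0 m then (if i \<le> m then i + m else i - m) else i)"

definition tau :: "nat \<Rightarrow> nat \<Rightarrow> 'a::field" where
  "tau m i = (if m < i \<and> i \<le> 2 * m then - 1 else 1)"

definition DH :: "nat \<Rightarrow> nat \<Rightarrow> nat \<Rightarrow> (nat \<Rightarrow> nat) \<Rightarrow> 'a::field super_poly \<Rightarrow> 'a super_vf" where
  "DH p m n t a =
     (\<Sum>\<theta>\<in>{0,1}. \<Sum>i\<in>Y m n.
        scaleW (tau m i * (- 1) ^ (par m i * \<theta>))
          (vf (partial p m n t i (parity_part \<theta> a)) (conj_idx m i)))"

definition N_alg :: "nat \<Rightarrow> nat \<Rightarrow> nat \<Rightarrow> (nat \<Rightarrow> nat) \<Rightarrow> 'a::field super_vf set" where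
  "N_alg p m n t = module.span scaleW
     {DH p m n t (xmono \<alpha> u) | \<alpha> u.
        \<alpha> \<in> multi_idx p m t \<and> u \<subseteq> Y1 m n \<and> even (card u)
        \<and> (\<alpha>, u) \<noteq> (pi_max p m t, Y1 m n) \<and> (\<alpha>, u) \<noteq> (pi_max p m t, {})}"

definition N_deg :: "nat \<Rightarrow> nat \<Rightarrow> nat \<Rightarrow> (nat \<Rightarrow> nat) \<Rightarrow> int \<Rightarrow> 'a::field super_vf set" where
  "N_deg p m n t k = N_alg p m n t \<inter> W_deg p m n t k"


subsection \<open>Derivations from \<open>\<NN>\<close> into the even part of \<open>W\<close>\<close>

text \<open>A map with domain \<open>\<NN>\<close> is represented by its extension by zero.  With this convention equality of
  maps on \<open>\<NN>\<close> is equality of functions, and spaces of such maps are subspaces with respect to \<open>scaleL\<close>.\<close>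

definition restr :: "nat \<Rightarrow> nat \<Rightarrow> nat \<Rightarrow> (nat \<Rightarrow> nat) \<Rightarrow> 'a::field vf_map \<Rightarrow> 'a vf_map" where
  "restr p m n t \<phi> = (\<lambda>x. if x \<in> N_alg p m n t then \<phi> x else 0)"

definition Der :: "nat \<Rightarrow> nat \<Rightarrow> nat \<Rightarrow> (nat \<Rightarrow> nat) \<Rightarrow> 'a::field vf_map set" where
  "Der p m n t = {D.
     (\<forall>x. x \<notin> N_alg p m n t \<longrightarrow> D x = 0) \<and>
     (\<forall>x\<in>N_alg p m n t. D x \<in> W_even p m n t) \<and>
     (\<forall>x\<in>N_alg p m n t. \<forall>y\<in>N_alg p m n t. D (x + y) = D x + D y) \<and>
     (\<forall>c. \<forall>x\<in>N_alg p m n t. D (scaleW c x) = scaleW c (D x)) \<and>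
     (\<forall>x\<in>N_alg p m n t. \<forall>y\<in>N_alg p m n t.
        D (bracket p m n t x y) = bracket p m n t x (D y) - bracket p m n t y (D x))}"

definition Der_deg :: "nat \<Rightarrow> nat \<Rightarrow> nat \<Rightarrow> (nat \<Rightarrow> nat) \<Rightarrow> int \<Rightarrow> 'a::field vf_map set" where
  "Der_deg p m n t k =
     {D \<in> Der p m n t. \<forall>i. \<forall>x\<in>N_deg p m n t i. D x \<in> W_even_deg p m n t (i + k)}"

text \<open>The sum of the spaces \<open>Der_deg k\<close>, \<open>k \<le> -1\<close>; it is automatically direct, because the spaces
  \<open>W_even_deg k\<close> are independent and \<open>\<NN>\<close> is spanned by homogeneous elements.\<close>

definition Der_neg :: "nat \<Rightarrow> nat \<Rightarrow> nat \<Rightarrow> (nat \<Rightarrow> nat) \<Rightarrow> 'a::field vf_map set" where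
  "Der_neg p m n t = module.span scaleL (\<Union>k\<in>{..- 1}. Der_deg p m n t k)"

text \<open>\<open>Phi\<close> picks some \<open>f\<close> with \<open>DH f = x\<close>; the value does not depend on it, since the kernel of \<open>DH\<close> on
  \<open>\<O>\<close> consists of the constants, which \<open>\<partial>\<^sub>r\<close> annihilates.\<close>

definition Phi :: "nat \<Rightarrow> nat \<Rightarrow> nat \<Rightarrow> (nat \<Rightarrow> nat) \<Rightarrow> nat \<Rightarrow> nat \<Rightarrow> 'a::field vf_map" where
  "Phi p m n t r q = restr p m n t (\<lambda>x.
     O_act p m n t
       ((partial p m n t r ^^ (p ^ q)) (inv_into (O_alg p m n t) (DH p m n t) x))
       (DH p m n t (xmono 0 (Y1 m n))))"

definition Theta :: "nat \<Rightarrow> nat \<Rightarrow> nat \<Rightarrow> (nat \<Rightarrow> nat) \<Rightarrow> nat \<Rightarrow> nat \<Rightarrow> 'a::field vf_map" where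
  "Theta p m n t r q = restr p m n t (\<lambda>x.
     O_act p m n t (xmono 0 (Y1 m n)) ((ad p m n t (ddx r) ^^ (p ^ q)) x))"

definition line :: "'a::field vf_map \<Rightarrow> 'a vf_map set" where
  "line \<phi> = {scaleL c \<phi> | c. True}"

end

theory Submission
  imports Defs
begin

text \<open>
  Even elements of \<open>W\<close> act on \<open>\<O>\<close> as derivations, and \<open>D\<^sub>H\<close> turns the Lie algebra into the Poisson
  algebra of even functions. A derivation of negative degree, after subtraction of some \<open>ad E\<close> with
  \<open>E\<close> of degree \<open>-1\<close>, kills the lowest degrees, so it commutes with \<open>ad \<partial>\<^sub>i\<close> for all even \<open>i\<close>. Its value on
  a monomial of minimal degree among those not killed therefore has coefficients in the exterior
  algebra, and it is equivariant under the degree-0 part, which is \<open>sp \<oplus> so\<close>. An even monomial of degree at least four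
  is a combination of brackets of even monomials of smaller degree, unless it is \<open>x\<^sub>r\<^sup>(\<^sup>q\<^sup>)\<close> or \<open>x\<^sub>r\<^sup>(\<^sup>q\<^sup>) x\<^sub>j\<close> with
  \<open>q = p ^ s\<close>. Equivariance forces the values on these exceptional monomials to be those of \<open>\<Phi>\<close>,
  \<open>\<Theta>\<close> and \<open>(ad \<partial>\<^sub>r)\<^sup>q\<close>, which can be subtracted one degree at a time.
\<close>

text \<open>The obstacle is arithmetic: a bracket of smaller monomials yields x_j^(a) with
  coefficient \<open>a choose b\<close>, and for a = p^s every inner binomial vanishes mod p. The
  same monomials look trivial to the Cartan elements x_i x_i' of sp: mod p the weight of x_r^(q) is
  that of 1, and the weight of x_r^(q+1) is that of x_r. Weights therefore cannot force their values
  to be zero. What survives is D_H(x^\<omega>) on x_r^(q), and \<partial>_r' and x^\<omega>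
  \<partial>_r' on x_r^(q+1); parity allows x^\<omega> here only for even n. Generation is
  transferred to derivations through kernels: the kernel is closed under brackets, so vanishing up
  to degree D passes to degree D+1. This works only from D = 3 on; in degrees 2 and 3 weights are
  compared directly, and p > 3 keeps the small integers that occur nonzero. The monomials with
  exponent \<pi> and odd part 1 or x^\<omega> are missing from the algebra, so no bracket used may
  pass through them; this and the truncation cause most case distinctions on full exponents.\<close>

lemma sum_fun_app: "(\<Sum>a\<in>A. F a) x = (\<Sum>a\<in>A. F a x)"
  by (induction A rule: infinite_finite_induct) (auto simp: zero_fun_apply plus_fun_apply)

interpretation VO: vector_space "scaleO :: 'a::field \<Rightarrow> _"
  by (rule vector_space_scaleO)

interpretation VW: vector_space "scaleW :: 'a::field \<Rightarrow> _"
  by (rule vector_space_scaleW)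

interpretation VL: vector_space "scaleL :: 'a::field \<Rightarrow> _"
  by (rule vector_space_scaleL)

lemma scaleO_app: "scaleO c f z = c * f z"
  by (simp add: scaleO_def)

lemma scaleW_app: "scaleW c D i = scaleO c (D i)"
  by (simp add: scaleW_def)

lemma scaleL_app: "scaleL c \<phi> x = scaleW c (\<phi> x)"
  by (simp add: scaleL_def)

text \<open>The induction methods produce eta-expanded goals, on which these rules would fire prematurely.\<close>

lemmas fun_app = plus_fun_apply zero_fun_apply minus_apply uminus_apply scaleO_app scaleW_app scaleL_app
declare plus_fun_apply [simp del] zero_fun_apply [simp del] minus_apply [simp del] uminus_apply [simp del]

lemma idx_app [simp]: "(0 :: nat \<Rightarrow> nat) i = 0" "(\<alpha> + \<beta> :: nat \<Rightarrow> nat) i = \<alpha> i + \<beta> i"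
  by (simp_all add: fun_app)

text \<open>The parameter \<open>ty\<close> carries the coefficient field, which the hypotheses
  mention only through \<open>CHAR\<close>; an interpretation fixes the field by it.\<close>

locale ham =
  fixes p m n :: nat and t :: "nat \<Rightarrow> nat" and ty :: "'a::field itself"
  assumes char_p: "CHAR('a) = p" and p_gt_3: "p > 3" and m_gt_1: "m > 1" and n_gt_3: "n > 3"
    and t_pos: "\<And>i. i \<in> Y0 m \<Longrightarrow> t i > 0"
begin

abbreviation OA :: "'a super_poly set" where "OA \<equiv> O_alg p m n t"
abbreviation MI :: "(nat \<Rightarrow> nat) set" where "MI \<equiv> multi_idx p m t"
abbreviation Bas :: "((nat \<Rightarrow> nat) \<times> nat set) set" where "Bas \<equiv> basis_idx p m n t"
abbreviation mul :: "'a super_poly \<Rightarrow> 'a super_poly \<Rightarrow> 'a super_poly" (infixl "\<odot>" 75)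
  where "f \<odot> g \<equiv> O_mult p m n t f g"
abbreviation pd :: "nat \<Rightarrow> 'a super_poly \<Rightarrow> 'a super_poly" where "pd \<equiv> partial p m n t"
abbreviation xm :: "(nat \<Rightarrow> nat) \<Rightarrow> nat set \<Rightarrow> 'a super_poly" where "xm \<equiv> xmono"
abbreviation Ev :: "nat set" where "Ev \<equiv> Y0 m"
abbreviation Od :: "nat set" where "Od \<equiv> Y1 m n"
abbreviation pimax :: "nat \<Rightarrow> nat" where "pimax \<equiv> pi_max p m t"

lemma prime_p: "prime p"
proof -
  have "CHAR('a) > 0" using char_p p_gt_3 by simp
  then show ?thesis using prime_CHAR_semidom[where ?'a = 'a] char_p by auto
qed

lemma of_nat_0_iff: "(of_nat k :: 'a) = 0 \<longleftrightarrow> p dvd k"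
  using of_nat_eq_0_iff_char_dvd[where ?'a = 'a] char_p by simp

lemma finite_Ev [simp]: "finite Ev" and finite_Od [simp]: "finite Od"
  by (simp_all add: Y0_def Y1_def)

lemma Od_not_Ev [simp]: "i \<in> Od \<Longrightarrow> i \<notin> Ev"
  by (simp add: Y0_def Y1_def)

lemma card_Od [simp]: "card Od = n"
  by (simp add: Y1_def)

lemma finite_Y [simp]: "finite (Y m n)"
  by (simp add: Y_def)

lemma Y_iff: "i \<in> Y m n \<longleftrightarrow> i \<in> Ev \<or> i \<in> Od"
  by (simp add: Y_def)

lemma sum_Y: "(\<Sum>i\<in>Y m n. F i) = (\<Sum>i\<in>Ev. F i) + (\<Sum>i\<in>Od. F i)"
  unfolding Y_def by (rule sum.union_disjoint) (auto simp: Y0_def Y1_def)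

lemma finite_MI [simp]: "finite MI"
proof (rule finite_subset)
  show "MI \<subseteq> {f. \<forall>x. (x \<in> Ev \<longrightarrow> f x \<in> {..Max (pimax ` Ev)}) \<and> (x \<notin> Ev \<longrightarrow> f x = 0)}"
  proof (clarsimp simp: multi_idx_def)
    fix f x assume "\<forall>i\<in>Ev. f i \<le> pimax i" "x \<in> Ev"
    moreover have "pimax x \<le> Max (pimax ` Ev)" using \<open>x \<in> Ev\<close> by (intro Max_ge) auto
    ultimately show "f x \<le> Max (pimax ` Ev)" using le_trans by blast
  qed
  show "finite {f. \<forall>x. (x \<in> Ev \<longrightarrow> f x \<in> {..Max (pimax ` Ev)}) \<and> (x \<notin> Ev \<longrightarrow> f x = (0::nat))}"
    by (rule finite_set_of_finite_funs) auto
qed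

lemma finite_Bas [simp]: "finite Bas"
  by (simp add: basis_idx_def)

lemma Bas_iff [simp]: "(\<alpha>, u) \<in> Bas \<longleftrightarrow> \<alpha> \<in> MI \<and> u \<subseteq> Od"
  by (auto simp: basis_idx_def)

lemma finite_sub_Od: "u \<subseteq> Od \<Longrightarrow> finite u"
  by (rule finite_subset[OF _ finite_Od])

lemma zero_MI [simp]: "0 \<in> MI" "(\<lambda>i. 0) \<in> MI"
  by (auto simp: multi_idx_def)

lemma MI_mono: "\<alpha> \<in> MI \<Longrightarrow> (\<And>i. \<beta> i \<le> \<alpha> i) \<Longrightarrow> \<beta> \<in> MI"
  unfolding multi_idx_def mem_Collect_eq
  by (metis le_trans le_zero_eq)

lemma MI_out: "\<alpha> \<in> MI \<Longrightarrow> i \<notin> Ev \<Longrightarrow> \<alpha> i = 0"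
  by (auto simp: multi_idx_def)

lemma MI_le: "\<alpha> \<in> MI \<Longrightarrow> \<alpha> i \<le> pimax i"
  by (cases "i \<in> Ev") (auto simp: multi_idx_def)

lemma MI_iff: "\<alpha> \<in> MI \<longleftrightarrow> (\<forall>i. \<alpha> i \<le> pimax i)"
  by (auto simp: multi_idx_def pi_max_def)

lemma pimax_MI [simp]: "pimax \<in> MI"
  by (simp add: MI_iff)

section \<open>Elements of the superalgebra as combinations of monomials\<close>

lemma OA_iff: "f \<in> OA \<longleftrightarrow> (\<forall>z. f z \<noteq> 0 \<longrightarrow> z \<in> Bas)"
  by (simp add: O_alg_def)

lemma OA_0 [simp]: "0 \<in> OA"
  and OA_add [simp]: "f \<in> OA \<Longrightarrow> g \<in> OA \<Longrightarrow> f + g \<in> OA"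
  and OA_diff [simp]: "f \<in> OA \<Longrightarrow> g \<in> OA \<Longrightarrow> f - g \<in> OA"
  and OA_minus [simp]: "f \<in> OA \<Longrightarrow> - f \<in> OA"
  and OA_scale [simp]: "f \<in> OA \<Longrightarrow> scaleO c f \<in> OA"
  unfolding OA_iff
  by (auto simp: fun_app simp del: Bas_iff) (metis add.right_neutral add_0 diff_zero)+

lemma OA_xm [simp]: "\<alpha> \<in> MI \<Longrightarrow> u \<subseteq> Od \<Longrightarrow> xm \<alpha> u \<in> OA"
  by (auto simp: OA_iff xmono_def split: if_splits)

lemma OA_sum [simp]: "(\<And>i. i \<in> A \<Longrightarrow> F i \<in> OA) \<Longrightarrow> sum F A \<in> OA"
  by (induction A rule: infinite_finite_induct) auto

lemma OA_expand:
  assumes "f \<in> OA"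
  shows "f = (\<Sum>z\<in>Bas. scaleO (f z) (xm (fst z) (snd z)))"
proof
  fix y
  have "(\<Sum>z\<in>Bas. scaleO (f z) (xm (fst z) (snd z))) y = (\<Sum>z\<in>Bas. if z = y then f z else 0)"
    unfolding sum_fun_app by (rule sum.cong) (auto simp: xmono_def fun_app)
  also have "\<dots> = f y"
    using assms by (auto simp: OA_iff simp del: Bas_iff split_paired_All)
  finally show "f y = (\<Sum>z\<in>Bas. scaleO (f z) (xm (fst z) (snd z))) y" by simp
qed

lemma OA_induct [consumes 1, case_names add scale mono]:
  assumes f: "f \<in> OA"
    and add: "\<And>f g. f \<in> OA \<Longrightarrow> g \<in> OA \<Longrightarrow> P f \<Longrightarrow> P g \<Longrightarrow> P (f + g)"
    and scale: "\<And>c f. f \<in> OA \<Longrightarrow> P f \<Longrightarrow> P (scaleO c f)"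
    and mono: "\<And>\<alpha> u. \<alpha> \<in> MI \<Longrightarrow> u \<subseteq> Od \<Longrightarrow> P (xm \<alpha> u)"
  shows "P f"
proof -
  have "scaleO 0 (xm 0 {}) = 0" by simp
  with scale[of "xm 0 {}" 0] mono[of 0 "{}"] have 0: "P 0" by simp
  have "finite A \<Longrightarrow> A \<subseteq> Bas \<Longrightarrow> P (\<Sum>z\<in>A. scaleO (f z) (xm (fst z) (snd z)))" for A
  proof (induction A rule: finite_induct)
    case empty
    show ?case using 0 by simp
  next
    case (insert z A)
    then have z: "fst z \<in> MI" "snd z \<subseteq> Od" and A: "A \<subseteq> Bas"
      by (cases z, auto)+
    have "(\<Sum>z\<in>A. scaleO (f z) (xm (fst z) (snd z))) \<in> OA"
      using A by (intro OA_sum OA_scale OA_xm) (force simp: basis_idx_def)+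
    then show ?case using insert z A
      by (auto intro!: add scale mono)
  qed
  from this[of Bas] show ?thesis
    using OA_expand[OF f] by simp
qed

text \<open>\<open>O_mult\<close> and \<open>partial\<close> read only coordinates in
  \<open>Bas\<close>. Replacing an arbitrary function by its truncation thus turns identities proved
  on \<open>OA\<close> into identities without membership hypotheses.\<close>

definition trunc :: "'a super_poly \<Rightarrow> 'a super_poly" where
  "trunc f = (\<lambda>z. if z \<in> Bas then f z else 0)"

lemma trunc_OA [simp]: "trunc f \<in> OA"
  by (auto simp: OA_iff trunc_def simp del: Bas_iff split: if_splits)

lemma mul_trunc [simp]: "trunc f \<odot> g = f \<odot> g" "f \<odot> trunc g = f \<odot> g"
  by (simp_all add: O_mult_def trunc_def)

lemma pd_trunc [simp]: "pd i (trunc f) = pd i f"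
  by (simp add: partial_def trunc_def)

section \<open>Linearity and structure constants of product and derivatives\<close>

lemma mul_add_left: "(f + g) \<odot> h = f \<odot> h + g \<odot> h"
  and mul_add_right: "h \<odot> (f + g) = h \<odot> f + h \<odot> g"
  and mul_scale_left: "scaleO c f \<odot> h = scaleO c (f \<odot> h)"
  and mul_scale_right: "h \<odot> scaleO c f = scaleO c (h \<odot> f)"
  by (simp_all add: O_mult_def fun_app distrib_left distrib_right VO.scale_left_distrib sum.distrib
      VO.scale_sum_right mult_ac)

lemma mul_0_left [simp]: "0 \<odot> h = 0" and mul_0_right [simp]: "h \<odot> 0 = 0"
  by (simp_all add: O_mult_def fun_app)

lemma mul_minus_left: "(- f) \<odot> h = - (f \<odot> h)" and mul_minus_right: "h \<odot> (- f) = - (h \<odot> f)"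
  using mul_add_left[of "- f" f h] mul_add_right[of h "- f" f] by (simp_all add: eq_neg_iff_add_eq_0)

lemma mul_diff_left: "(f - g) \<odot> h = f \<odot> h - g \<odot> h"
  and mul_diff_right: "h \<odot> (f - g) = h \<odot> f - h \<odot> g"
  using mul_add_left[of f "- g" h] mul_add_right[of h f "- g"]
  by (simp_all add: mul_minus_left mul_minus_right)

lemma mul_sum_left: "sum F A \<odot> h = (\<Sum>i\<in>A. F i \<odot> h)"
  and mul_sum_right: "h \<odot> sum F A = (\<Sum>i\<in>A. h \<odot> F i)"
  by (induction A rule: infinite_finite_induct) (simp_all add: mul_add_left mul_add_right)

lemma pd_add: "pd i (f + g) = pd i f + pd i g"
  and pd_scale: "pd i (scaleO c f) = scaleO c (pd i f)"
  by (simp_all add: partial_def fun_app VO.scale_left_distrib sum.distrib VO.scale_sum_right)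

lemma pd_0 [simp]: "pd i 0 = 0"
  by (simp add: partial_def fun_app)

lemma pd_minus: "pd i (- f) = - pd i f"
  using pd_add[of i "- f" f] by (simp add: eq_neg_iff_add_eq_0)

lemma pd_diff: "pd i (f - g) = pd i f - pd i g"
  using pd_add[of i f "- g"] by (simp add: pd_minus)

lemma pd_sum: "pd i (sum F A) = (\<Sum>a\<in>A. pd i (F a))"
  by (induction A rule: infinite_finite_induct) (simp_all add: pd_add)

text \<open>The structure constant of a product of monomials splits into this even factor (binomials
  and truncation) and the odd factor \<open>oc\<close> (sign and overlap), so that associativity and
  commutation can be checked for each separately.\<close>

definition ec :: "(nat \<Rightarrow> nat) \<Rightarrow> (nat \<Rightarrow> nat) \<Rightarrow> 'a" where
  "ec \<alpha> \<beta> = (if \<alpha> + \<beta> \<in> MI then \<Prod>i\<in>Ev. of_nat ((\<alpha> i + \<beta> i) choose (\<alpha> i)) else 0)"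

definition oc :: "nat set \<Rightarrow> nat set \<Rightarrow> 'a" where
  "oc u v = (if u \<inter> v = {} then wedge_sign u v else 0)"

lemma sum_xm_left:
  assumes "(\<alpha>, u) \<in> Bas" shows "(\<Sum>z\<in>Bas. scaleO (xm \<alpha> u z * c z) (F z)) = scaleO (c (\<alpha>, u)) (F (\<alpha>, u))"
proof -
  have "(\<Sum>z\<in>Bas. scaleO (xm \<alpha> u z * c z) (F z))
      = (\<Sum>z\<in>Bas. if z = (\<alpha>, u) then scaleO (c z) (F z) else 0)"
    by (rule sum.cong) (auto simp: xmono_def)
  also have "\<dots> = scaleO (c (\<alpha>, u)) (F (\<alpha>, u))" using assms by simp
  finally show ?thesis .
qed

lemma mul_mono:
  assumes "(\<alpha>, u) \<in> Bas" "(\<beta>, v) \<in> Bas"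
  shows "xm \<alpha> u \<odot> xm \<beta> v = scaleO (ec \<alpha> \<beta> * oc u v) (xm (\<alpha> + \<beta>) (u \<union> v))"
proof -
  have "xm \<alpha> u \<odot> xm \<beta> v = (\<Sum>z\<in>Bas. scaleO (xm \<alpha> u z * 1) (\<Sum>w\<in>Bas. scaleO (xm \<beta> v w * 1) (mono_mult p m t z w)))"
    by (simp add: O_mult_def VO.scale_sum_right)
  also have "\<dots> = mono_mult p m t (\<alpha>, u) (\<beta>, v)"
    by (simp only: sum_xm_left[OF assms(1)] sum_xm_left[OF assms(2)] VO.scale_one)
  also have "\<dots> = scaleO (ec \<alpha> \<beta> * oc u v) (xm (\<alpha> + \<beta>) (u \<union> v))"
    by (auto simp: mono_mult_def ec_def oc_def)
  finally show ?thesis .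
qed

lemma pd_mono:
  assumes "(\<alpha>, u) \<in> Bas"
  shows "pd i (xm \<alpha> u) = mono_partial m i (\<alpha>, u)"
  using sum_xm_left[OF assms, of "\<lambda>_. 1" "mono_partial m i"] by (simp add: partial_def)

lemma pd_even_mono:
  assumes "\<alpha> \<in> MI" "u \<subseteq> Od" "i \<in> Ev"
  shows "pd i (xm \<alpha> u) = (if \<alpha> i = 0 then 0 else xm (\<alpha>(i := \<alpha> i - 1)) u)"
  using assms by (simp add: pd_mono mono_partial_def)

lemma pd_odd_mono:
  assumes "\<alpha> \<in> MI" "u \<subseteq> Od" "i \<notin> Ev"
  shows "pd i (xm \<alpha> u) = (if i \<in> u then scaleO ((- 1) ^ card {j \<in> u. j < i}) (xm \<alpha> (u - {i})) else 0)"
  using assms by (simp add: pd_mono mono_partial_def)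

lemma upd_MI: "\<alpha> \<in> MI \<Longrightarrow> \<alpha>(i := \<alpha> i - 1) \<in> MI"
  by (rule MI_mono) auto

lemma pd_out [simp]:
  assumes "i \<notin> Y m n" shows "pd i f = 0"
proof -
  have "pd i f = 0" if "f \<in> OA" for f using that
  proof (induction f rule: OA_induct)
    case (mono \<alpha> u) then show ?case using assms by (auto simp: pd_odd_mono Y_def)
  qed (simp_all add: pd_add pd_scale)
  from this[OF trunc_OA[of f]] show ?thesis by simp
qed

lemma pd_OA [simp]: "pd i f \<in> OA"
proof -
  have "pd i f \<in> OA" if "f \<in> OA" for f using that
  proof (induction f rule: OA_induct)
    case (mono \<alpha> u)
    then show ?case
      by (cases "i \<in> Ev") (auto simp: pd_even_mono pd_odd_mono upd_MI[simplified] intro!: OA_scale OA_xm)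
  qed (simp_all add: pd_add pd_scale)
  from this[OF trunc_OA[of f]] show ?thesis by simp
qed

lemma mul_mono_OA: "\<alpha> \<in> MI \<Longrightarrow> u \<subseteq> Od \<Longrightarrow> \<beta> \<in> MI \<Longrightarrow> v \<subseteq> Od \<Longrightarrow> xm \<alpha> u \<odot> xm \<beta> v \<in> OA"
  by (cases "\<alpha> + \<beta> \<in> MI") (auto simp: mul_mono ec_def)

lemma mul_OA [simp]: "f \<odot> g \<in> OA"
proof -
  have "f \<odot> g \<in> OA" if "f \<in> OA" "g \<in> OA" for f g using that(1)
  proof (induction f rule: OA_induct)
    case (mono \<alpha> u)
    show ?case using that(2)
      by (induction g rule: OA_induct) (simp_all add: mono mul_mono_OA mul_add_right mul_scale_right)
  qed (simp_all add: mul_add_left mul_scale_left)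
  from this[OF trunc_OA[of f] trunc_OA[of g]] show ?thesis by simp
qed

lemma mul_one: "f \<in> OA \<Longrightarrow> xm 0 {} \<odot> f = f"
proof (induction f rule: OA_induct)
  case (mono \<alpha> u)
  then have "xm 0 {} \<odot> xm \<alpha> u = xm \<alpha> u"
    by (simp add: mul_mono ec_def oc_def wedge_sign_def)
  then show ?case .
qed (simp_all add: mul_add_right mul_scale_right)

text \<open>Both sides are multinomial coefficients. Truncation is harmless because
  \<open>MI\<close> is closed downwards: if the full sum lies in \<open>MI\<close>, so do the
  partial sums, and otherwise each side has a zero factor.\<close>

lemma ec_assoc: "ec \<alpha> \<beta> * ec (\<alpha> + \<beta>) \<gamma> = ec \<beta> \<gamma> * ec \<alpha> (\<beta> + \<gamma>)"
proof (cases "\<alpha> + \<beta> + \<gamma> \<in> MI")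
  case True
  have "\<alpha> + \<beta> \<in> MI" "\<beta> + \<gamma> \<in> MI"
    by (rule MI_mono[OF True], simp)+
  moreover have "of_nat ((\<alpha> i + \<beta> i) choose \<alpha> i) * of_nat ((\<alpha> i + \<beta> i + \<gamma> i) choose (\<alpha> i + \<beta> i)) =
      (of_nat ((\<beta> i + \<gamma> i) choose \<beta> i) * of_nat ((\<alpha> i + (\<beta> i + \<gamma> i)) choose \<alpha> i) :: 'a)" for i
    using choose_mult[of "\<alpha> i" "\<alpha> i + \<beta> i" "\<alpha> i + \<beta> i + \<gamma> i"]
    by (simp flip: of_nat_mult add: mult.commute add.assoc)
  ultimately show ?thesis using True
    by (simp add: ec_def add.assoc flip: prod.distrib)
next
  case False
  then show ?thesis by (simp add: ec_def add.assoc)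
qed

lemma ec_commute: "ec \<alpha> \<beta> = ec \<beta> \<alpha>"
proof -
  have "((\<alpha> i + \<beta> i) choose \<alpha> i) = ((\<beta> i + \<alpha> i) choose \<beta> i)" for i
    using binomial_symmetric[of "\<alpha> i" "\<alpha> i + \<beta> i"] by (simp add: add.commute)
  then show ?thesis by (simp add: ec_def add.commute)
qed

text \<open>The exponent in \<open>wedge_sign\<close>, kept as a natural number because it is
  additive in both arguments over disjoint unions.\<close>

definition inv_num :: "nat set \<Rightarrow> nat set \<Rightarrow> nat" where
  "inv_num u v = card {(i, j). i \<in> u \<and> j \<in> v \<and> j < i}"

lemma wedge_sign_inv: "wedge_sign u v = (- 1) ^ inv_num u v"
  by (simp add: wedge_sign_def inv_num_def)

lemma finite_inv [simp]: "finite u \<Longrightarrow> finite v \<Longrightarrow> finite {(i, j). i \<in> u \<and> j \<in> v \<and> j < i}"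
  by (rule finite_subset[of _ "u \<times> v"]) auto

lemma inv_num_Un_left:
  assumes "finite u" "finite v" "finite w" "u \<inter> v = {}"
  shows "inv_num (u \<union> v) w = inv_num u w + inv_num v w"
proof -
  have "{(i, j). i \<in> u \<union> v \<and> j \<in> w \<and> j < i}
      = {(i, j). i \<in> u \<and> j \<in> w \<and> j < i} \<union> {(i, j). i \<in> v \<and> j \<in> w \<and> j < i}" by auto
  then show ?thesis unfolding inv_num_def
    using assms by (subst card_Un_disjoint[symmetric]) auto
qed

lemma inv_num_Un_right:
  assumes "finite u" "finite v" "finite w" "v \<inter> w = {}"
  shows "inv_num u (v \<union> w) = inv_num u v + inv_num u w"
proof -
  have "{(i, j). i \<in> u \<and> j \<in> v \<union> w \<and> j < i}
      = {(i, j). i \<in> u \<and> j \<in> v \<and> j < i} \<union> {(i, j). i \<in> u \<and> j \<in> w \<and> j < i}" by auto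
  then show ?thesis unfolding inv_num_def
    using assms by (subst card_Un_disjoint[symmetric]) auto
qed

lemma inv_num_empty [simp]: "inv_num {} v = 0" "inv_num u {} = 0"
  by (simp_all add: inv_num_def)

lemma inv_num_single_left: "inv_num {i} v = card {j \<in> v. j < i}"
proof -
  have "{(k, j). k \<in> {i} \<and> j \<in> v \<and> j < k} = Pair i ` {j \<in> v. j < i}" by auto
  then show ?thesis unfolding inv_num_def by (simp add: card_image inj_on_def)
qed

text \<open>Every pair in \<open>u \<times> v\<close> is an inversion in exactly one of the two
  orders; this is the source of supercommutativity.\<close>

lemma inv_num_add:
  assumes "finite u" "finite v" "u \<inter> v = {}"
  shows "inv_num u v + inv_num v u = card u * card v"
proof -
  let ?S = "{(i, j). i \<in> u \<and> j \<in> v \<and> j < i}" and ?T = "{(j, i). j \<in> v \<and> i \<in> u \<and> i < j}"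
  have "u \<times> v = ?S \<union> prod.swap ` ?T"
    using assms(3) by (auto simp: image_iff not_less prod.swap_def)
  moreover have "?S \<inter> prod.swap ` ?T = {}" by auto
  moreover have "finite ?S" "finite ?T" using assms by auto
  ultimately have "card (u \<times> v) = card ?S + card (prod.swap ` ?T)"
    by (simp add: card_Un_disjoint)
  also have "card (prod.swap ` ?T) = card ?T" by (rule card_image) auto
  finally show ?thesis by (simp add: inv_num_def card_cartesian_product)
qed

lemma oc_assoc:
  assumes "finite u" "finite v" "finite w"
  shows "oc u v * oc (u \<union> v) w = oc v w * oc u (v \<union> w)"
  using assms by (auto simp: oc_def wedge_sign_inv inv_num_Un_left inv_num_Un_right power_add Int_Un_distrib Int_Un_distrib2)

lemma minus_one_cancel: "(- 1) ^ k * ((- 1) ^ k * x) = (x :: 'a)"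
  by (simp flip: mult.assoc power_mult_distrib)

lemma oc_commute:
  assumes "finite u" "finite v"
  shows "oc v u = (- 1) ^ (card u * card v) * oc u v"
  by (cases "u \<inter> v = {}") (use assms in \<open>auto simp: oc_def wedge_sign_inv Int_commute power_add minus_one_cancel
      simp flip: inv_num_add\<close>)

lemma mul_assoc: "f \<odot> g \<odot> h = f \<odot> (g \<odot> h)"
proof -
  have mono: "xm \<alpha> u \<odot> xm \<beta> v \<odot> xm \<gamma> w = xm \<alpha> u \<odot> (xm \<beta> v \<odot> xm \<gamma> w)"
    if b: "\<alpha> \<in> MI" "u \<subseteq> Od" "\<beta> \<in> MI" "v \<subseteq> Od" "\<gamma> \<in> MI" "w \<subseteq> Od" for \<alpha> u \<beta> v \<gamma> w
  proof -
    have fin: "finite u" "finite v" "finite w" using b finite_sub_Od by auto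
    have "xm \<alpha> u \<odot> xm \<beta> v \<odot> xm \<gamma> w =
        scaleO ((ec \<alpha> \<beta> * ec (\<alpha> + \<beta>) \<gamma>) * (oc u v * oc (u \<union> v) w)) (xm (\<alpha> + \<beta> + \<gamma>) (u \<union> v \<union> w))"
    proof (cases "\<alpha> + \<beta> \<in> MI")
      case True
      then show ?thesis using b by (simp add: mul_mono mul_scale_left mult_ac)
    next
      case False
      then have "ec \<alpha> \<beta> = 0" by (simp add: ec_def)
      then show ?thesis using b by (simp add: mul_mono)
    qed
    moreover have "xm \<alpha> u \<odot> (xm \<beta> v \<odot> xm \<gamma> w) =
        scaleO ((ec \<beta> \<gamma> * ec \<alpha> (\<beta> + \<gamma>)) * (oc v w * oc u (v \<union> w))) (xm (\<alpha> + \<beta> + \<gamma>) (u \<union> v \<union> w))"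
    proof (cases "\<beta> + \<gamma> \<in> MI")
      case True
      then show ?thesis using b by (simp add: mul_mono mul_scale_right mult_ac add.assoc Un_assoc)
    next
      case False
      then have "ec \<beta> \<gamma> = 0" by (simp add: ec_def)
      then show ?thesis using b by (simp add: mul_mono)
    qed
    ultimately show ?thesis using ec_assoc oc_assoc[OF fin] by simp
  qed
  have "f \<odot> g \<odot> h = f \<odot> (g \<odot> h)" if "f \<in> OA" "g \<in> OA" "h \<in> OA" for f g h using that(1)
  proof (induction f rule: OA_induct)
    case fm: (mono \<alpha> u)
    show ?case using that(2)
    proof (induction g rule: OA_induct)
      case gm: (mono \<beta> v)
      show ?case using that(3)
        by (induction h rule: OA_induct) (simp_all add: mono fm gm mul_add_right mul_scale_right)
    qed (simp_all add: mul_add_left mul_add_right mul_scale_left mul_scale_right)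
  qed (simp_all add: mul_add_left mul_scale_left)
  from this[OF trunc_OA[of f] trunc_OA[of g] trunc_OA[of h]] show ?thesis by simp
qed

text \<open>Only the class of \<open>\<theta>\<close> mod 2 matters, so parities can be added
  without reduction, and 0 has every parity.\<close>

definition hasp :: "nat \<Rightarrow> 'a super_poly \<Rightarrow> bool" where
  "hasp \<theta> f \<longleftrightarrow> (\<forall>\<alpha> u. f (\<alpha>, u) \<noteq> 0 \<longrightarrow> even (card u + \<theta>))"

text \<open>Only monomials in the support have to be treated, so any property of the support, such
  as parity or degree, is available in the monomial case.\<close>

lemma OA_induct_supp [consumes 2, case_names zero add scale mono]:
  assumes f: "f \<in> OA" and Q: "\<And>\<alpha> u. f (\<alpha>, u) \<noteq> 0 \<Longrightarrow> Q \<alpha> u"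
    and zero: "P 0"
    and add: "\<And>f g. P f \<Longrightarrow> P g \<Longrightarrow> P (f + g)"
    and scale: "\<And>c f. P f \<Longrightarrow> P (scaleO c f)"
    and mono: "\<And>\<alpha> u. \<alpha> \<in> MI \<Longrightarrow> u \<subseteq> Od \<Longrightarrow> Q \<alpha> u \<Longrightarrow> P (xm \<alpha> u)"
  shows "P f"
proof -
  have "P (\<Sum>z\<in>A. scaleO (f z) (xm (fst z) (snd z)))" if "finite A" "A \<subseteq> Bas" for A
    using that
  proof (induction A rule: finite_induct)
    case empty
    show ?case using zero by simp
  next
    case (insert z A)
    obtain \<alpha> u where z: "z = (\<alpha>, u)" by (cases z)
    with insert.prems have zB: "\<alpha> \<in> MI" "u \<subseteq> Od" by auto
    have "P (scaleO (f z) (xm (fst z) (snd z)))"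
    proof (cases "f z = 0")
      case True then show ?thesis using zero by simp
    next
      case False then show ?thesis using mono[OF zB] Q[of \<alpha> u] scale z by simp
    qed
    then show ?case using insert by (auto intro: add)
  qed
  from this[OF finite_Bas] OA_expand[OF f] show ?thesis by simp
qed

lemma hasp_0 [simp]: "hasp \<theta> 0" by (simp add: hasp_def fun_app)

lemma hasp_add: "hasp \<theta> f \<Longrightarrow> hasp \<theta> g \<Longrightarrow> hasp \<theta> (f + g)"
  unfolding hasp_def fun_app by (metis add.right_neutral add_0)

lemma hasp_diff: "hasp \<theta> f \<Longrightarrow> hasp \<theta> g \<Longrightarrow> hasp \<theta> (f - g)"
  unfolding hasp_def fun_app by (metis diff_zero)

lemma hasp_scale: "hasp \<theta> f \<Longrightarrow> hasp \<theta> (scaleO c f)"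
  unfolding hasp_def fun_app by auto

lemma hasp_sum: "(\<And>i. i \<in> A \<Longrightarrow> hasp \<theta> (F i)) \<Longrightarrow> hasp \<theta> (sum F A)"
  by (induction A rule: infinite_finite_induct) (auto simp: hasp_add)

lemma hasp_xm: "even (card u + \<theta>) \<Longrightarrow> hasp \<theta> (xm \<alpha> u)"
  by (auto simp: hasp_def xmono_def)

lemma hasp_cong: "even \<theta> = even \<eta> \<Longrightarrow> hasp \<theta> f = hasp \<eta> f"
  by (auto simp: hasp_def)

lemma hasp_trunc: "hasp \<theta> f \<Longrightarrow> hasp \<theta> (trunc f)"
  by (auto simp: hasp_def trunc_def)

lemma hasp_induct [consumes 2, case_names zero add scale mono]:
  assumes "f \<in> OA" "hasp \<theta> f"
    and "P 0" "\<And>f g. P f \<Longrightarrow> P g \<Longrightarrow> P (f + g)" "\<And>c f. P f \<Longrightarrow> P (scaleO c f)"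
    and "\<And>\<alpha> u. \<alpha> \<in> MI \<Longrightarrow> u \<subseteq> Od \<Longrightarrow> even (card u + \<theta>) \<Longrightarrow> P (xm \<alpha> u)"
  shows "P f"
  using assms(1) by (rule OA_induct_supp[where Q = "\<lambda>\<alpha> u. even (card u + \<theta>)"])
    (use assms in \<open>auto simp: hasp_def\<close>)

lemma hasp_mul:
  assumes "hasp \<theta> f" "hasp \<eta> g" shows "hasp (\<theta> + \<eta>) (f \<odot> g)"
proof -
  have mono: "hasp (\<theta> + \<eta>) (xm \<alpha> u \<odot> xm \<beta> v)"
    if "\<alpha> \<in> MI" "u \<subseteq> Od" "even (card u + \<theta>)" "\<beta> \<in> MI" "v \<subseteq> Od" "even (card v + \<eta>)" for \<alpha> u \<beta> v
    using that by (auto simp: mul_mono oc_def card_Un_disjoint finite_sub_Od intro!: hasp_scale hasp_xm)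
  have "hasp (\<theta> + \<eta>) (f \<odot> g)" if "f \<in> OA" "hasp \<theta> f" "g \<in> OA" "hasp \<eta> g" for f g
    using that(1,2)
  proof (induction f rule: hasp_induct)
    case fm: (mono \<alpha> u)
    show ?case using that(3,4)
    proof (induction g rule: hasp_induct)
      case gm: (mono \<beta> v) show ?case by (rule mono) (use fm gm in auto)
    qed (auto simp: mul_add_right mul_scale_right hasp_add hasp_scale)
  qed (auto simp: mul_add_left mul_scale_left hasp_add hasp_scale)
  from this[OF trunc_OA[of f] hasp_trunc trunc_OA[of g] hasp_trunc] assms show ?thesis by simp
qed

lemma mul_commute:
  assumes "hasp \<theta> f" "hasp \<eta> g" shows "f \<odot> g = scaleO ((- 1) ^ (\<theta> * \<eta>)) (g \<odot> f)"
proof -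
  have mono: "xm \<alpha> u \<odot> xm \<beta> v = scaleO ((- 1) ^ (\<theta> * \<eta>)) (xm \<beta> v \<odot> xm \<alpha> u)"
    if b: "\<alpha> \<in> MI" "u \<subseteq> Od" "even (card u + \<theta>)" "\<beta> \<in> MI" "v \<subseteq> Od" "even (card v + \<eta>)" for \<alpha> u \<beta> v
  proof -
    have s: "(- 1 :: 'a) ^ (card u * card v) = (- 1) ^ (\<theta> * \<eta>)"
      using b by (intro minus_one_power_iff[THEN trans] minus_one_power_iff[THEN trans, THEN sym]) auto
    show ?thesis using b
      by (simp add: mul_mono ec_commute[of \<alpha> \<beta>] add.commute[of \<alpha> \<beta>] Un_commute[of u v]
          oc_commute[of u v] finite_sub_Od s minus_one_cancel mult.left_commute)
  qed
  have "f \<odot> g = scaleO ((- 1) ^ (\<theta> * \<eta>)) (g \<odot> f)"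
    if "f \<in> OA" "hasp \<theta> f" "g \<in> OA" "hasp \<eta> g" for f g
    using that(1,2)
  proof (induction f rule: hasp_induct)
    case fm: (mono \<alpha> u)
    show ?case using that(3,4)
    proof (induction g rule: hasp_induct)
      case gm: (mono \<beta> v) show ?case by (rule mono) (use fm gm in auto)
    qed (auto simp: mul_add_right mul_scale_right mul_add_left mul_scale_left VO.scale_right_distrib mult.commute)
  qed (auto simp: mul_add_left mul_scale_left mul_add_right mul_scale_right VO.scale_right_distrib mult.commute)
  from this[OF trunc_OA[of f] hasp_trunc trunc_OA[of g] hasp_trunc] assms show ?thesis by simp
qed

lemma mul_commute_even:
  assumes "hasp 0 f" "hasp \<theta> g" shows "f \<odot> g = g \<odot> f"
  using mul_commute[OF assms] by simp

lemma par_simps [simp]: "i \<in> Ev \<Longrightarrow> par m i = 0" "i \<notin> Ev \<Longrightarrow> par m i = 1"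
  by (simp_all add: par_def)

lemma hasp_pd:
  assumes "hasp \<theta> f" shows "hasp (\<theta> + par m i) (pd i f)"
proof -
  have "hasp (\<theta> + par m i) (pd i f)" if "f \<in> OA" "hasp \<theta> f" for f using that
  proof (induction f rule: hasp_induct)
    case (mono \<alpha> u)
    show ?case
    proof (cases "i \<in> Ev")
      case True
      then show ?thesis using mono by (auto simp: pd_even_mono intro!: hasp_xm)
    next
      case False
      have "even (card (u - {i}) + Suc \<theta>)" if "i \<in> u"
        using mono that card_Suc_Diff1[of u i] finite_sub_Od[of u] by (metis add_Suc_shift)
      then show ?thesis using mono False by (auto simp: pd_odd_mono intro!: hasp_xm hasp_scale)
    qed
  qed (auto simp: pd_add pd_scale hasp_add hasp_scale)
  from this[OF trunc_OA hasp_trunc] assms show ?thesis by simp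
qed

lemma hasp_pd_even: "hasp \<theta> f \<Longrightarrow> i \<in> Ev \<Longrightarrow> hasp \<theta> (pd i f)"
  using hasp_pd[of \<theta> f i] by simp

subsection \<open>Superderivations of \<open>\<O>\<close>\<close>

text \<open>From a * (q choose a) = q * ((q-1) choose (a-1)): if p did not divide the binomial, q
  would divide a < q.\<close>

lemma p_dvd_choose:
  assumes "0 < a" "a < p ^ k"
  shows "(of_nat (p ^ k choose a) :: 'a) = 0"
proof -
  have "a * (p ^ k choose a) = p ^ k * ((p ^ k - 1) choose (a - 1))"
    using assms times_binomial_minus1_eq[of a "p ^ k"] by simp
  then have "p ^ k dvd a * (p ^ k choose a)" by simp
  have "p dvd (p ^ k choose a)"
  proof (rule ccontr)
    assume "\<not> p dvd (p ^ k choose a)"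
    then have "coprime (p ^ k) (p ^ k choose a)"
      using prime_imp_coprime[OF prime_p] by (simp add: coprime_power_left_iff)
    then have "p ^ k dvd a" using \<open>p ^ k dvd a * (p ^ k choose a)\<close>
      by (simp add: coprime_dvd_mult_left_iff)
    then show False using assms by (auto dest: dvd_imp_le)
  qed
  then show ?thesis by (simp add: of_nat_0_iff)
qed

lemma pimax_Suc: "i \<in> Ev \<Longrightarrow> Suc (pimax i) = p ^ t i"
  using p_gt_3 by (simp add: pi_max_def)

text \<open>Pascal's rule; at the truncation boundary it uses that \<open>p\<close> divides \<open>p ^ k choose a\<close>.\<close>

lemma pd_even_mul_mono:
  assumes b: "\<alpha> \<in> MI" "u \<subseteq> Od" "\<beta> \<in> MI" "v \<subseteq> Od" and i: "i \<in> Ev"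
  shows "pd i (xm \<alpha> u \<odot> xm \<beta> v) = pd i (xm \<alpha> u) \<odot> xm \<beta> v + xm \<alpha> u \<odot> pd i (xm \<beta> v)"
proof -
  define R where "R = (\<Prod>j\<in>Ev - {i}. of_nat ((\<alpha> j + \<beta> j) choose (\<alpha> j)) :: 'a)"
  let ?a = "\<alpha> i" and ?b = "\<beta> i"
  let ?\<alpha> = "\<alpha>(i := ?a - 1)" and ?\<beta> = "\<beta>(i := ?b - 1)" and ?\<gamma> = "(\<alpha> + \<beta>)(i := ?a + ?b - 1)"
  have split: "prod F Ev = F i * prod F (Ev - {i})" for F :: "nat \<Rightarrow> 'a"
    using i by (simp add: prod.remove)
  have sa: "?\<alpha> + \<beta> = ?\<gamma>" if "?a > 0" using that by (auto simp: fun_eq_iff)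
  have sb: "\<alpha> + ?\<beta> = ?\<gamma>" if "?b > 0" using that by (auto simp: fun_eq_iff)
  have E: "ec \<alpha> \<beta> = (if \<alpha> + \<beta> \<in> MI then of_nat ((?a + ?b) choose ?a) * R else 0)"
    by (simp add: ec_def split R_def)
  have Ea: "ec ?\<alpha> \<beta> = (if ?\<gamma> \<in> MI then of_nat ((?a + ?b - 1) choose (?a - 1)) * R else 0)" if "?a > 0"
    unfolding ec_def sa[OF that] split R_def using that by simp
  have Eb: "ec \<alpha> ?\<beta> = (if ?\<gamma> \<in> MI then of_nat ((?a + ?b - 1) choose ?a) * R else 0)" if "?b > 0"
    unfolding ec_def sb[OF that] split R_def using that by simp
  have key: "(if ?a + ?b > 0 then ec \<alpha> \<beta> else 0) =
      (if ?a > 0 then ec ?\<alpha> \<beta> else 0) + (if ?b > 0 then ec \<alpha> ?\<beta> else 0)"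
  proof (cases "?a + ?b > 0")
    case True
    have pascal: "(?a + ?b) choose ?a =
        (if ?a > 0 then (?a + ?b - 1) choose (?a - 1) else 0) + (if ?b > 0 then (?a + ?b - 1) choose ?a else 0)"
      using True by (cases ?a; cases ?b) auto
    have MI: "\<alpha> + \<beta> \<in> MI \<longleftrightarrow> ?\<gamma> \<in> MI \<and> ?a + ?b \<le> pimax i"
      using True unfolding MI_iff by (auto split: if_splits intro: diff_le_self[THEN le_trans])
    show ?thesis
    proof (cases "?\<gamma> \<in> MI")
      case False
      then show ?thesis using MI Ea Eb E by auto
    next
      case g: True
      have "(if ?a > 0 then ec ?\<alpha> \<beta> else 0) + (if ?b > 0 then ec \<alpha> ?\<beta> else 0) = of_nat ((?a + ?b) choose ?a) * R"
        using g Ea Eb unfolding pascal by (auto simp: distrib_right)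
      moreover have "of_nat ((?a + ?b) choose ?a) = (0 :: 'a)" if "\<not> ?a + ?b \<le> pimax i"
      proof -
        have "?\<gamma> i \<le> pimax i" using g unfolding MI_iff by blast
        then have "?a + ?b = p ^ t i" using that pimax_Suc[OF i] by simp
        moreover have "?a \<le> pimax i" "?b \<le> pimax i" using b MI_le by auto
        ultimately show ?thesis using p_dvd_choose[of ?a "t i"] pimax_Suc[OF i] by auto
      qed
      ultimately show ?thesis using True E MI g by auto
    qed
  qed simp
  have L: "pd i (xm \<alpha> u \<odot> xm \<beta> v) =
      scaleO (oc u v) (scaleO (if ?a + ?b > 0 then ec \<alpha> \<beta> else 0) (xm ?\<gamma> (u \<union> v)))"
  proof (cases "\<alpha> + \<beta> \<in> MI")
    case True
    then show ?thesis using b i by (auto simp: mul_mono pd_scale pd_even_mono mult.commute)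
  next
    case False
    then have "ec \<alpha> \<beta> = 0" by (simp add: ec_def)
    then show ?thesis using b by (simp add: mul_mono)
  qed
  have Ra: "pd i (xm \<alpha> u) \<odot> xm \<beta> v = scaleO (oc u v) (scaleO (if ?a > 0 then ec ?\<alpha> \<beta> else 0) (xm ?\<gamma> (u \<union> v)))"
    using b i sa upd_MI[of \<alpha> i] by (auto simp: mul_mono pd_even_mono mult.commute)
  have Rb: "xm \<alpha> u \<odot> pd i (xm \<beta> v) = scaleO (oc u v) (scaleO (if ?b > 0 then ec \<alpha> ?\<beta> else 0) (xm ?\<gamma> (u \<union> v)))"
    using b i sb upd_MI[of \<beta> i] by (auto simp: mul_mono pd_even_mono mult.commute)
  show ?thesis unfolding L Ra Rb key by (simp add: VO.scale_left_distrib VO.scale_right_distrib)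
qed

text \<open>The sign part of the odd Leibniz rule. It is stated at a coordinate \<open>z\<close>
  because the index sets on the two sides need not agree when a coefficient is zero. The delicate
  case is an index lying in both \<open>u\<close> and \<open>v\<close>, where the product vanishes
  and the two terms on the right must cancel.\<close>

lemma oc_Leibniz:
  assumes fin: "finite u" "finite v"
  shows "(if i \<in> u \<union> v then oc u v * (- 1) ^ inv_num {i} (u \<union> v) else 0 :: 'a) * xm \<gamma> (u \<union> v - {i}) z =
    (if i \<in> u then (- 1) ^ inv_num {i} u * oc (u - {i}) v else 0) * xm \<gamma> (u - {i} \<union> v) z +
    (- 1) ^ card u * ((if i \<in> v then (- 1) ^ inv_num {i} v * oc u (v - {i}) else 0) * xm \<gamma> (u \<union> (v - {i})) z)"
proof -
  define u' v' where "u' = u - {i}" and "v' = v - {i}"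
  have fin': "finite u'" "finite v'" using fin by (auto simp: u'_def v'_def)
  have ni: "i \<notin> u'" "i \<notin> v'" by (auto simp: u'_def v'_def)
  have ii: "inv_num {i} {i} = 0" by (simp add: inv_num_single_left)
  have Iu: "inv_num {i} (insert i w) = inv_num {i} w" if "finite w" "i \<notin> w" for w
    using inv_num_Un_right[of "{i}" "{i}" w] that ii by simp
  have Il: "inv_num (insert i w) x = inv_num {i} x + inv_num w x" if "finite w" "i \<notin> w" "finite x" for w x
    using inv_num_Un_left[of "{i}" w x] that by simp
  have Ir: "inv_num x (insert i w) = inv_num x {i} + inv_num x w" if "finite w" "i \<notin> w" "finite x" for w x
    using inv_num_Un_right[of x "{i}" w] that by simp
  have sw: "inv_num {i} w + inv_num w {i} = card w" if "finite w" "i \<notin> w" for w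
    using inv_num_add[of "{i}" w] that by simp
  have sq: "(- 1) ^ a * ((- 1) ^ b * x) = (x :: 'a)" if "a = b" for a b x
    using that minus_one_cancel by simp
  consider (a) "i \<in> u" "i \<in> v" | (b) "i \<in> u" "i \<notin> v" | (c) "i \<notin> u" "i \<in> v" | (d) "i \<notin> u" "i \<notin> v" by blast
  then show ?thesis
  proof cases
    case a
    then have u: "u = insert i u'" and v: "v = insert i v'" by (auto simp: u'_def v'_def)
    have d1: "u - {i} = u'" "v - {i} = v'" by (simp_all add: u'_def v'_def)
    have 0: "oc u v = 0" using a by (auto simp: oc_def)
    have s: "u' \<union> v = u \<union> v'" using u v by auto
    have "(- 1) ^ inv_num {i} u * oc u' v + (- 1) ^ card u * ((- 1) ^ inv_num {i} v * oc u v') = (0 :: 'a)"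
    proof (cases "u' \<inter> v' = {}")
      case True
      then have dj: "u' \<inter> v = {}" "u \<inter> v' = {}" using ni u v by auto
      \<comment> \<open>The sign exponents of the two terms differ by an odd number, hence the terms
        cancel.\<close>
      have e1: "inv_num {i} u + inv_num u' v = card u' + inv_num u' v'"
        unfolding u v Iu[OF fin'(1) ni(1)] Ir[OF fin'(2) ni(2) fin'(1)] sw[OF fin'(1) ni(1), symmetric] by simp
      have e2: "card u + (inv_num {i} v + inv_num u v') = Suc (card u' + inv_num u' v') + 2 * inv_num {i} v'"
        unfolding u v Iu[OF fin'(2) ni(2)] Il[OF fin'(1) ni(1) fin'(2)] using fin' ni by simp
      have "(- 1) ^ inv_num {i} u * oc u' v = ((- 1) ^ (inv_num {i} u + inv_num u' v) :: 'a)"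
        using dj by (simp add: oc_def wedge_sign_inv power_add)
      moreover have "(- 1) ^ card u * ((- 1) ^ inv_num {i} v * oc u v') = ((- 1) ^ (card u + (inv_num {i} v + inv_num u v')) :: 'a)"
        using dj by (simp add: oc_def wedge_sign_inv power_add)
      ultimately show ?thesis unfolding e1 e2 by (simp add: power_add power_mult)
    next
      case False
      then have "u' \<inter> v \<noteq> {}" "u \<inter> v' \<noteq> {}" using u v by auto
      then show ?thesis by (simp add: oc_def)
    qed
    then show ?thesis using a 0 s unfolding d1 by (simp flip: mult.assoc distrib_right)
  next
    case b
    then have u: "u = insert i u'" and v: "v = v'" "v - {i} = v" by (auto simp: u'_def v'_def)
    have d1: "u - {i} = u'" by (simp_all add: u'_def)
    have s: "u \<union> v - {i} = u' \<union> v" using b d1 by auto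
    have "oc u v * (- 1) ^ inv_num {i} (u \<union> v) = ((- 1) ^ inv_num {i} u * oc u' v :: 'a)"
    proof (cases "u \<inter> v = {}")
      case True
      then have dj: "u' \<inter> v = {}" by (auto simp: u'_def)
      have "inv_num u v + inv_num {i} (u \<union> v) = inv_num {i} u + inv_num u' v + 2 * inv_num {i} v"
        using True fin fin' Il[OF fin'(1) ni(1) fin(2)] inv_num_Un_right[of "{i}" u v] by (simp flip: u)
      then show ?thesis using True dj by (simp add: oc_def wedge_sign_inv power_mult flip: power_add)
         (simp add: power_add power_mult)
    next
      case False
      then have "u' \<inter> v \<noteq> {}" using b by (auto simp: u'_def)
      then show ?thesis using False by (simp add: oc_def)
    qed
    then show ?thesis using b unfolding d1 s by simp
  next
    case c
    then have v: "v = insert i v'" by (auto simp: u'_def v'_def)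
    have d1: "v - {i} = v'" by (simp_all add: v'_def)
    have s: "u \<union> v - {i} = u \<union> v'" using c d1 by auto
    have "oc u v * (- 1) ^ inv_num {i} (u \<union> v) = ((- 1) ^ card u * ((- 1) ^ inv_num {i} v * oc u v') :: 'a)"
    proof (cases "u \<inter> v = {}")
      case True
      then have dj: "u \<inter> v' = {}" by (auto simp: v'_def)
      have "inv_num u v + inv_num {i} (u \<union> v) = card u + (inv_num {i} v + inv_num u v')"
        using True fin fin' Ir[OF fin'(2) ni(2) fin(1)] inv_num_Un_right[of "{i}" u v] sw[OF fin(1) c(1)]
        by (simp flip: v)
      then show ?thesis using True dj by (simp add: oc_def wedge_sign_inv flip: power_add)
    next
      case False
      then have "u \<inter> v' \<noteq> {}" using c by (auto simp: v'_def)
      then show ?thesis using False by (simp add: oc_def)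
    qed
    then show ?thesis using c unfolding d1 s by (simp add: mult.assoc)
  next
    case d
    then show ?thesis by simp
  qed
qed

lemma pd_odd_mul_mono:
  assumes b: "\<alpha> \<in> MI" "u \<subseteq> Od" "\<beta> \<in> MI" "v \<subseteq> Od" and i: "i \<notin> Ev"
  shows "pd i (xm \<alpha> u \<odot> xm \<beta> v) =
    pd i (xm \<alpha> u) \<odot> xm \<beta> v + scaleO ((- 1) ^ card u) (xm \<alpha> u \<odot> pd i (xm \<beta> v))"
proof -
  have fin: "finite u" "finite v" using b finite_sub_Od by auto
  have L: "pd i (xm \<alpha> u \<odot> xm \<beta> v) = scaleO (ec \<alpha> \<beta>)
      (scaleO (if i \<in> u \<union> v then oc u v * (- 1) ^ inv_num {i} (u \<union> v) else 0) (xm (\<alpha> + \<beta>) (u \<union> v - {i})))"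
  proof (cases "\<alpha> + \<beta> \<in> MI")
    case True
    then show ?thesis using b i by (auto simp: mul_mono pd_scale pd_odd_mono inv_num_single_left)
  next
    case False
    then have "ec \<alpha> \<beta> = 0" by (simp add: ec_def)
    then show ?thesis using b by (simp add: mul_mono)
  qed
  have sub: "u - {i} \<subseteq> Od" "v - {i} \<subseteq> Od" using b by auto
  have Ra: "pd i (xm \<alpha> u) \<odot> xm \<beta> v = scaleO (ec \<alpha> \<beta>)
      (scaleO (if i \<in> u then (- 1) ^ inv_num {i} u * oc (u - {i}) v else 0) (xm (\<alpha> + \<beta>) (u - {i} \<union> v)))"
    using b i sub by (auto simp: mul_mono pd_odd_mono mul_scale_left inv_num_single_left mult_ac)
  have Rb: "xm \<alpha> u \<odot> pd i (xm \<beta> v) = scaleO (ec \<alpha> \<beta>)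
      (scaleO (if i \<in> v then (- 1) ^ inv_num {i} v * oc u (v - {i}) else 0) (xm (\<alpha> + \<beta>) (u \<union> (v - {i}))))"
    using b i sub by (auto simp: mul_mono pd_odd_mono mul_scale_right inv_num_single_left mult_ac)
  show ?thesis unfolding L Ra Rb
  proof
    fix z
    show "scaleO (ec \<alpha> \<beta>)
      (scaleO (if i \<in> u \<union> v then oc u v * (- 1) ^ inv_num {i} (u \<union> v) else 0) (xm (\<alpha> + \<beta>) (u \<union> v - {i}))) z =
      (scaleO (ec \<alpha> \<beta>) (scaleO (if i \<in> u then (- 1) ^ inv_num {i} u * oc (u - {i}) v else 0) (xm (\<alpha> + \<beta>) (u - {i} \<union> v))) +
       scaleO ((- 1) ^ card u) (scaleO (ec \<alpha> \<beta>)
      (scaleO (if i \<in> v then (- 1) ^ inv_num {i} v * oc u (v - {i}) else 0) (xm (\<alpha> + \<beta>) (u \<union> (v - {i})))))) z"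
      unfolding fun_app oc_Leibniz[OF fin] by (simp add: algebra_simps)
  qed
qed

lemma pd_mul:
  assumes "hasp \<theta> f"
  shows "pd i (f \<odot> g) = pd i f \<odot> g + scaleO ((- 1) ^ (\<theta> * par m i)) (f \<odot> pd i g)"
proof -
  have mono: "pd i (xm \<alpha> u \<odot> xm \<beta> v) =
      pd i (xm \<alpha> u) \<odot> xm \<beta> v + scaleO ((- 1) ^ (\<theta> * par m i)) (xm \<alpha> u \<odot> pd i (xm \<beta> v))"
    if b: "\<alpha> \<in> MI" "u \<subseteq> Od" "even (card u + \<theta>)" "\<beta> \<in> MI" "v \<subseteq> Od" for \<alpha> u \<beta> v
  proof (cases "i \<in> Ev")
    case True
    then show ?thesis using b pd_even_mul_mono by simp
  next
    case False
    have "(- 1 :: 'a) ^ card u = (- 1) ^ \<theta>" using b by (simp add: minus_one_power_iff)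
    then show ?thesis using b False pd_odd_mul_mono by simp
  qed
  have "pd i (f \<odot> g) = pd i f \<odot> g + scaleO ((- 1) ^ (\<theta> * par m i)) (f \<odot> pd i g)"
    if "f \<in> OA" "hasp \<theta> f" "g \<in> OA" for f g
    using that(1,2)
  proof (induction f rule: hasp_induct)
    case fm: (mono \<alpha> u)
    show ?case using that(3)
    proof (induction g rule: OA_induct)
      case gm: (mono \<beta> v) show ?case by (rule mono) (use fm gm in auto)
    qed (auto simp: pd_add pd_scale mul_add_right mul_scale_right VO.scale_right_distrib mult.commute)
  qed (auto simp: pd_add pd_scale mul_add_left mul_scale_left VO.scale_right_distrib mult.commute)
  from this[OF trunc_OA[of f] hasp_trunc trunc_OA[of g]] assms show ?thesis by simp
qed

lemma pd_commute: "pd i (pd j f) = scaleO ((- 1) ^ (par m i * par m j)) (pd j (pd i f))"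
proof -
  have mono: "pd i (pd j (xm \<alpha> u)) = scaleO ((- 1) ^ (par m i * par m j)) (pd j (pd i (xm \<alpha> u)))"
    if b: "\<alpha> \<in> MI" "u \<subseteq> Od" for \<alpha> u
  proof -
    have sub: "u - {k} \<subseteq> Od" for k using b by auto
    note simps = b sub upd_MI[of \<alpha> i] upd_MI[of \<alpha> j] pd_scale pd_even_mono pd_odd_mono
    consider "i \<in> Ev" "j \<in> Ev" | "i \<in> Ev" "j \<notin> Ev" | "i \<notin> Ev" "j \<in> Ev" | "i \<notin> Ev" "j \<notin> Ev" by blast
    then show ?thesis
    proof cases
      case 1
      then show ?thesis using simps by (cases "i = j") (auto simp: fun_upd_twist)
    next
      case 2
      then show ?thesis using simps by auto
    next
      case 3
      then show ?thesis using simps by auto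
    next
      case 4
      show ?thesis
      proof (cases "i \<in> u \<and> j \<in> u \<and> i \<noteq> j")
        case True
        have fin: "finite u" using b finite_sub_Od by auto
        have pos: "card {k \<in> u. k < x} = card {k \<in> u - {y}. k < x} + (if y < x then 1 else 0)" if "y \<in> u" for x y
        proof (cases "y < x")
          case True
          then have "{k \<in> u. k < x} = insert y {k \<in> u - {y}. k < x}" using that by auto
          then show ?thesis using fin True by simp
        next
          case False
          then have "{k \<in> u. k < x} = {k \<in> u - {y}. k < x}" by auto
          then show ?thesis using False by simp
        qed
        have s: "u - {j} - {i} = u - {i} - {j}" by auto
        have mem: "i \<in> u - {j}" "j \<in> u - {i}" "i \<in> u" "j \<in> u" using True by auto
        have ij: "pd i (pd j (xm \<alpha> u)) =
            scaleO ((- 1) ^ (card {k \<in> u. k < j} + card {k \<in> u - {j}. k < i})) (xm \<alpha> (u - {j} - {i}))"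
          by (simp add: pd_odd_mono[OF b 4(2)] pd_odd_mono[OF b(1) sub 4(1)] mem pd_scale power_add mult.commute
              del: Diff_iff)
        have ji: "pd j (pd i (xm \<alpha> u)) =
            scaleO ((- 1) ^ (card {k \<in> u. k < i} + card {k \<in> u - {i}. k < j})) (xm \<alpha> (u - {j} - {i}))"
          unfolding s
          by (simp add: pd_odd_mono[OF b 4(1)] pd_odd_mono[OF b(1) sub 4(2)] mem pd_scale power_add mult.commute
              del: Diff_iff)
        \<comment> \<open>Deleting one index lowers the position of the other only if the deleted
          one is smaller, which happens in exactly one of the two orders.\<close>
        have "odd (card {k \<in> u. k < j} + card {k \<in> u - {j}. k < i} +
            (card {k \<in> u. k < i} + card {k \<in> u - {i}. k < j}))"
          using pos[OF mem(3), of j] pos[OF mem(4), of i] True by (cases "i < j") auto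
        then show ?thesis unfolding ij ji using 4 by (auto simp: minus_one_power_iff)
      next
        case False
        then show ?thesis using simps 4 by auto
      qed
    qed
  qed
  have "pd i (pd j f) = scaleO ((- 1) ^ (par m i * par m j)) (pd j (pd i f))" if "f \<in> OA" for f using that
  proof (induction f rule: OA_induct)
    case (mono \<alpha> u) then show ?case by (rule \<open>\<And>u \<alpha>. \<alpha> \<in> MI \<Longrightarrow> u \<subseteq> Od \<Longrightarrow> pd i (pd j (xm \<alpha> u)) = scaleO ((- 1) ^ (par m i * par m j)) (pd j (pd i (xm \<alpha> u)))\<close>)
  qed (auto simp: pd_add pd_scale VO.scale_right_distrib mult.commute)
  from this[OF trunc_OA[of f]] show ?thesis by simp
qed

lemma pd_commute_even: "i \<in> Ev \<Longrightarrow> pd i (pd j f) = pd j (pd i f)"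
  "j \<in> Ev \<Longrightarrow> pd i (pd j f) = pd j (pd i f)"
  using pd_commute[of i j f] by simp_all

abbreviation WE :: "'a super_vf set" where "WE \<equiv> W_even p m n t"
abbreviation br :: "'a super_vf \<Rightarrow> 'a super_vf \<Rightarrow> 'a super_vf" where "br \<equiv> bracket p m n t"
abbreviation Hf :: "'a super_poly \<Rightarrow> 'a super_vf" where "Hf \<equiv> DH p m n t"
abbreviation cj :: "nat \<Rightarrow> nat" where "cj \<equiv> conj_idx m"
abbreviation ta :: "nat \<Rightarrow> 'a" where "ta \<equiv> tau m"
abbreviation \<omega> :: "'a super_poly" where "\<omega> \<equiv> xm 0 Od"

subsection \<open>The action of \<open>W\<close> on \<open>\<O>\<close>\<close>

definition app :: "'a super_vf \<Rightarrow> 'a super_poly \<Rightarrow> 'a super_poly" where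
  "app D f = (\<Sum>i\<in>Y m n. D i \<odot> pd i f)"

lemma WE_iff: "D \<in> WE \<longleftrightarrow>
    (\<forall>i. D i \<in> OA) \<and> (\<forall>i. i \<notin> Y m n \<longrightarrow> D i = 0) \<and> (\<forall>i. hasp (par m i) (D i))"
proof -
  have "D i \<in> OA" if "\<forall>i\<in>Y m n. D i \<in> OA" "\<forall>i. i \<notin> Y m n \<longrightarrow> D i = 0" for i
    using that by (cases "i \<in> Y m n") auto
  moreover have "hasp (par m i) (D i)" if "\<forall>i. i \<notin> Y m n \<longrightarrow> D i = 0"
    "\<forall>i\<in>Y m n. \<forall>\<alpha> u. D i (\<alpha>, u) \<noteq> 0 \<longrightarrow> even (card u + par m i)" for i
    using that by (cases "i \<in> Y m n") (auto simp: hasp_def zero_fun_apply)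
  ultimately show ?thesis
    unfolding W_even_def W_alg_def hasp_def by blast
qed

lemma WE_OA: "D \<in> WE \<Longrightarrow> D i \<in> OA"
  and WE_out: "D \<in> WE \<Longrightarrow> i \<notin> Y m n \<Longrightarrow> D i = 0"
  and WE_hasp: "D \<in> WE \<Longrightarrow> hasp (par m i) (D i)"
  by (simp_all add: WE_iff)

lemma WE_I: "(\<And>i. D i \<in> OA) \<Longrightarrow> (\<And>i. i \<notin> Y m n \<Longrightarrow> D i = 0) \<Longrightarrow> (\<And>i. hasp (par m i) (D i)) \<Longrightarrow> D \<in> WE"
  by (simp add: WE_iff)

lemma WE_0 [simp]: "0 \<in> WE" by (simp add: WE_iff fun_app)
lemma WE_add: "D \<in> WE \<Longrightarrow> E \<in> WE \<Longrightarrow> D + E \<in> WE" by (simp add: WE_iff fun_app hasp_add)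
lemma WE_scale: "D \<in> WE \<Longrightarrow> scaleW c D \<in> WE" by (simp add: WE_iff fun_app hasp_scale)

lemma app_add: "app D (f + g) = app D f + app D g"
  by (simp add: app_def pd_add mul_add_right sum.distrib)
lemma app_diff: "app D (f - g) = app D f - app D g"
  by (simp add: app_def pd_diff mul_diff_right sum_subtractf)
lemma app_scale: "app D (scaleO c f) = scaleO c (app D f)"
  by (simp add: app_def pd_scale mul_scale_right VO.scale_sum_right)
lemma app_0 [simp]: "app D 0 = 0"
  by (simp add: app_def)
lemma app_sum: "app D (sum F A) = (\<Sum>a\<in>A. app D (F a))"
  by (induction A rule: infinite_finite_induct) (simp_all add: app_add)

lemma app_add_left: "app (D + E) f = app D f + app E f"
  by (simp add: app_def mul_add_left sum.distrib fun_app)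
lemma app_scale_left: "app (scaleW c D) f = scaleO c (app D f)"
  by (simp add: app_def mul_scale_left VO.scale_sum_right fun_app)
lemma app_0_left [simp]: "app 0 f = 0"
  by (simp add: app_def fun_app)

lemma app_OA [simp]: "app D f \<in> OA"
  by (simp add: app_def)

lemma pd_const [simp]: "pd i (xm 0 {}) = 0"
  by (cases "i \<in> Ev") (simp_all add: pd_even_mono pd_odd_mono)

lemma app_const [simp]: "app D (xm 0 {}) = 0"
  by (simp add: app_def)

lemma hasp_app:
  assumes "D \<in> WE" "hasp \<theta> f" shows "hasp \<theta> (app D f)"
  unfolding app_def
proof (rule hasp_sum)
  fix i
  have "hasp (par m i + (\<theta> + par m i)) (D i \<odot> pd i f)"
    using assms by (intro hasp_mul hasp_pd WE_hasp)
  then show "hasp \<theta> (D i \<odot> pd i f)"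
    by (rule hasp_cong[THEN iffD1, rotated]) auto
qed

lemma minus_one_sq [simp]: "(- 1) ^ k * (- 1) ^ k = (1 :: 'a)"
  by (simp flip: power_mult_distrib)

text \<open>Moving \<open>f\<close> past \<open>D i\<close> costs the same sign as the Leibniz rule
  for \<open>pd i\<close>; the two cancel, so even fields satisfy the unsigned Leibniz rule.\<close>

lemma app_mul:
  assumes D: "D \<in> WE" and f: "hasp \<theta> f"
  shows "app D (f \<odot> g) = app D f \<odot> g + f \<odot> app D g"
proof -
  have "D i \<odot> pd i (f \<odot> g) = D i \<odot> pd i f \<odot> g + f \<odot> (D i \<odot> pd i g)" for i
  proof -
    let ?s = "(- 1) ^ (\<theta> * par m i) :: 'a"
    have "D i \<odot> f = scaleO ?s (f \<odot> D i)"
      using mul_commute[OF WE_hasp[OF D] f, of i] by (simp add: mult.commute)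
    then show ?thesis
      by (simp add: pd_mul[OF f] mul_add_right mul_scale_right mul_scale_left flip: mul_assoc)
  qed
  then show ?thesis
    by (simp add: app_def sum.distrib mul_sum_left mul_sum_right)
qed

text \<open>The second-order parts of the two compositions coincide, since the sign from commuting
  coefficients cancels the sign from commuting derivatives. Hence the commutator is of first order,
  which gives \<open>app_br\<close>.\<close>

lemma app_app_swap:
  assumes D: "D \<in> WE" and E: "E \<in> WE"
  shows "(\<Sum>j\<in>Y m n. E j \<odot> app D (pd j f)) = (\<Sum>j\<in>Y m n. D j \<odot> app E (pd j f))"
proof -
  have t: "E j \<odot> (D i \<odot> pd i (pd j f)) = D i \<odot> (E j \<odot> pd j (pd i f))" for i j
  proof -
    let ?s = "(- 1) ^ (par m i * par m j) :: 'a"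
    have "E j \<odot> D i = scaleO ?s (D i \<odot> E j)"
      using mul_commute[OF WE_hasp[OF E] WE_hasp[OF D], of j i] by (simp add: mult.commute)
    moreover have "pd i (pd j f) = scaleO ?s (pd j (pd i f))" by (rule pd_commute)
    ultimately show ?thesis
      by (simp add: mul_scale_right mul_scale_left flip: mul_assoc)
  qed
  have "(\<Sum>j\<in>Y m n. E j \<odot> app D (pd j f)) = (\<Sum>j\<in>Y m n. \<Sum>i\<in>Y m n. D i \<odot> (E j \<odot> pd j (pd i f)))"
    by (simp add: app_def mul_sum_right t)
  also have "\<dots> = (\<Sum>i\<in>Y m n. \<Sum>j\<in>Y m n. D i \<odot> (E j \<odot> pd j (pd i f)))"
    by (rule sum.swap)
  also have "\<dots> = (\<Sum>j\<in>Y m n. D j \<odot> app E (pd j f))"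
    by (simp add: app_def mul_sum_right)
  finally show ?thesis .
qed

lemma app_app:
  assumes D: "D \<in> WE" and E: "E \<in> WE"
  shows "app D (app E f) = (\<Sum>j\<in>Y m n. app D (E j) \<odot> pd j f) + (\<Sum>j\<in>Y m n. E j \<odot> app D (pd j f))"
  by (simp add: app_def[of E] app_sum app_mul[OF D WE_hasp[OF E]] sum.distrib)

lemma parity_part_hasp:
  assumes "hasp \<theta> f" "\<theta> < 2"
  shows "parity_part \<eta> f = (if \<eta> = \<theta> then f else 0)"
proof
  fix z :: "(nat \<Rightarrow> nat) \<times> nat set"
  obtain \<alpha> u where z: "z = (\<alpha>, u)" by (cases z)
  have "f (\<alpha>, u) \<noteq> 0 \<Longrightarrow> card u mod 2 = \<theta>"
    using assms unfolding hasp_def by (metis even_add mod_less mod2_eq_if less_2_cases_iff odd_one even_zero)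
  then show "parity_part \<eta> f z = (if \<eta> = \<theta> then f else 0) z"
    by (auto simp: z parity_part_def fun_app)
qed

lemma vf_0 [simp]: "vf 0 i = (0 :: 'a super_vf)"
  by (simp add: vf_def fun_eq_iff fun_app)

text \<open>In an even field the coefficient of index i has parity \<open>par m i\<close>, so one
  summand of the parity sums survives and its sign exponent is even: the superbracket becomes an
  ordinary commutator, computed coefficient by coefficient.\<close>

lemma br_WE:
  assumes D: "D \<in> WE" and E: "E \<in> WE"
  shows "br D E = (\<lambda>k. app D (E k) - app E (D k))"
proof
  fix k
  have parity: "parity_part \<theta> (F i) = (if \<theta> = par m i then F i else 0)" if "F \<in> WE" for F \<theta> i
    by (rule parity_part_hasp[OF WE_hasp[OF that]]) (auto simp: par_def)
  have pm: "par m i \<in> {0, 1}" for i by (auto simp: par_def)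
  have "br D E = (\<Sum>i\<in>Y m n. \<Sum>j\<in>Y m n. hom_bracket p m n t (par m i) (par m j) (D i) i (E j) j)"
    unfolding bracket_def
  proof (intro sum.cong refl)
    fix i j
    have h0: "hom_bracket p m n t \<theta> \<eta> 0 i b j = (0 :: 'a super_vf)" "hom_bracket p m n t \<theta> \<eta> b i 0 j = (0 :: 'a super_vf)"
      for \<theta> \<eta> b by (simp_all add: hom_bracket_def)
    have "(\<Sum>\<theta>\<in>{0,1}. \<Sum>\<eta>\<in>{0,1}. hom_bracket p m n t \<theta> \<eta> (parity_part \<theta> (D i)) i (parity_part \<eta> (E j)) j) =
       (\<Sum>\<theta>\<in>{0,1}. \<Sum>\<eta>\<in>{0,1}. if \<theta> = par m i then if \<eta> = par m j then
          hom_bracket p m n t (par m i) (par m j) (D i) i (E j) j else 0 else 0)"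
      by (intro sum.cong refl) (simp add: parity[OF D] parity[OF E] h0)
    also have "\<dots> = hom_bracket p m n t (par m i) (par m j) (D i) i (E j) j"
      by (cases "i \<in> Ev"; cases "j \<in> Ev") simp_all
    finally show "(\<Sum>\<theta>\<in>{0,1}. \<Sum>\<eta>\<in>{0,1}. hom_bracket p m n t \<theta> \<eta> (parity_part \<theta> (D i)) i (parity_part \<eta> (E j)) j) =
      hom_bracket p m n t (par m i) (par m j) (D i) i (E j) j" .
  qed
  also have "\<dots> = (\<Sum>i\<in>Y m n. \<Sum>j\<in>Y m n. vf (D i \<odot> pd i (E j)) j - vf (E j \<odot> pd j (D i)) i)"
    by (intro sum.cong refl) (simp add: hom_bracket_def flip: mult_2)
  finally have "br D E k = (\<Sum>i\<in>Y m n. \<Sum>j\<in>Y m n. (if k = j then D i \<odot> pd i (E k) else 0)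
      - (if k = i then E j \<odot> pd j (D k) else 0))"
    by (simp add: sum_fun_app fun_app vf_def if_distrib cong: if_cong)
  also have "\<dots> = (\<Sum>i\<in>Y m n. \<Sum>j\<in>Y m n. if k = j then D i \<odot> pd i (E k) else 0)
      - (\<Sum>i\<in>Y m n. \<Sum>j\<in>Y m n. if k = i then E j \<odot> pd j (D k) else 0)"
    by (simp add: sum_subtractf)
  also have "(\<Sum>i\<in>Y m n. \<Sum>j\<in>Y m n. if k = j then D i \<odot> pd i (E k) else 0) = app D (E k)"
    using WE_out[OF E, of k] by (auto simp: app_def intro!: sum.cong)
  also have "(\<Sum>i\<in>Y m n. \<Sum>j\<in>Y m n. if k = i then E j \<odot> pd j (D k) else 0) = app E (D k)"
    using WE_out[OF D, of k] by (subst sum.swap) (auto simp: app_def intro!: sum.cong)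
  finally show "br D E k = app D (E k) - app E (D k)" .
qed

lemma br_app: "D \<in> WE \<Longrightarrow> E \<in> WE \<Longrightarrow> br D E k = app D (E k) - app E (D k)"
  by (simp add: br_WE)

lemma br_in_WE: "D \<in> WE \<Longrightarrow> E \<in> WE \<Longrightarrow> br D E \<in> WE"
  by (rule WE_I) (auto simp: br_WE WE_out hasp_diff hasp_app WE_hasp)

lemma app_br:
  assumes D: "D \<in> WE" and E: "E \<in> WE"
  shows "app (br D E) f = app D (app E f) - app E (app D f)"
proof -
  have "app (br D E) f = (\<Sum>j\<in>Y m n. app D (E j) \<odot> pd j f) - (\<Sum>j\<in>Y m n. app E (D j) \<odot> pd j f)"
    by (simp add: app_def[of "br D E"] br_app[OF D E] mul_diff_left sum_subtractf)
  then show ?thesis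
    using app_app[OF D E, of f] app_app[OF E D, of f] app_app_swap[OF D E, of f] by simp
qed

lemma br_Jacobi:
  assumes "E \<in> WE" "x \<in> WE" "y \<in> WE"
  shows "br E (br x y) = br x (br E y) - br y (br E x)"
proof
  fix k
  show "br E (br x y) k = (br x (br E y) - br y (br E x)) k"
    using assms by (simp add: br_app br_in_WE app_br app_diff fun_app algebra_simps)
qed

lemma cj_simps [simp]:
  "i \<in> Ev \<Longrightarrow> cj i \<in> Ev" "cj (cj i) = i" "i \<notin> Ev \<Longrightarrow> cj i = i"
  "i \<in> Ev \<Longrightarrow> cj i \<noteq> i" "i \<in> Ev \<Longrightarrow> i \<noteq> cj i"
  by (auto simp: conj_idx_def Y0_def)

lemma cj_Ev [simp]: "cj i \<in> Ev \<longleftrightarrow> i \<in> Ev"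
  by (metis cj_simps(1,2))

lemma cj_Od [simp]: "cj i \<in> Od \<longleftrightarrow> i \<in> Od"
  by (metis cj_Ev cj_simps(3) Od_not_Ev)

lemma cj_Y [simp]: "cj i \<in> Y m n \<longleftrightarrow> i \<in> Y m n"
  by (simp add: Y_iff)

lemma par_cj [simp]: "par m (cj i) = par m i"
  by (simp add: par_def)

lemma cj_eq: "cj i = j \<longleftrightarrow> i = cj j"
  by auto

lemma ta_cj: "i \<in> Ev \<Longrightarrow> ta (cj i) = - ta i"
  by (auto simp: tau_def conj_idx_def Y0_def)

lemma ta_Od [simp]: "i \<notin> Ev \<Longrightarrow> ta i = 1"
  by (auto simp: tau_def Y0_def)

lemma ta_sq [simp]: "ta i * ta i = 1" and ta_nz [simp]: "ta i \<noteq> 0"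
  by (auto simp: tau_def)

lemma sum_cj_Ev: "(\<Sum>i\<in>Ev. F (cj i)) = (\<Sum>i\<in>Ev. F i)"
  by (rule sum.reindex_bij_witness[of _ cj cj]) auto

lemma sum_cj_Y: "(\<Sum>i\<in>Y m n. F (cj i)) = (\<Sum>i\<in>Y m n. F i)"
  by (rule sum.reindex_bij_witness[of _ cj cj]) auto

lemma parity_parts: "parity_part 0 f + parity_part (Suc 0) f = f"
  by (auto simp: fun_eq_iff parity_part_def fun_app)

lemma Hf_parts: "Hf f j = (if j \<in> Y m n then
    \<Sum>\<theta>\<in>{0,1}. scaleO (ta (cj j) * (- 1) ^ (par m j * \<theta>)) (pd (cj j) (parity_part \<theta> f)) else 0)"
proof -
  have "Hf f j = (\<Sum>\<theta>\<in>{0,1}. \<Sum>i\<in>Y m n. if i = cj j then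
      scaleO (ta (cj j) * (- 1) ^ (par m j * \<theta>)) (pd (cj j) (parity_part \<theta> f)) else 0)"
    unfolding DH_def sum_fun_app[where x = j]
    by (intro sum.cong refl) (auto simp: fun_app vf_def)
  then show ?thesis by simp
qed

text \<open>For an even index the sign in \<open>DH\<close> is trivial, so no parity assumption on
  \<open>f\<close> is made. This is what controls the arbitrary preimage chosen in
  \<open>Phi\<close>.\<close>

lemma Hf_Ev: "j \<in> Ev \<Longrightarrow> Hf f j = scaleO (ta (cj j)) (pd (cj j) f)"
  using pd_add[of "cj j" "parity_part 0 f" "parity_part (Suc 0) f"]
  by (simp add: Hf_parts Y_iff parity_parts flip: VO.scale_right_distrib)

lemma Hf_app: "hasp 0 f \<Longrightarrow> Hf f j = scaleO (ta (cj j)) (pd (cj j) f)"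
  by (simp add: Hf_parts parity_part_hasp[of 0])

lemma Hf_WE: "hasp 0 f \<Longrightarrow> Hf f \<in> WE"
  using hasp_pd[of 0 f "cj _"] by (intro WE_I) (auto simp: Hf_app intro!: hasp_scale)

lemma Hf_add: "hasp 0 f \<Longrightarrow> hasp 0 g \<Longrightarrow> Hf (f + g) = Hf f + Hf g"
  by (rule ext) (simp add: Hf_app hasp_add pd_add VO.scale_right_distrib plus_fun_apply)

lemma Hf_scale: "hasp 0 f \<Longrightarrow> Hf (scaleO c f) = scaleW c (Hf f)"
  by (rule ext) (simp add: Hf_app hasp_scale pd_scale fun_app mult.commute)

subsection \<open>Poisson bracket\<close>

definition pb :: "'a super_poly \<Rightarrow> 'a super_poly \<Rightarrow> 'a super_poly" where
  "pb f g = app (Hf f) g"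

lemma pb_eq: "hasp 0 f \<Longrightarrow> pb f g = (\<Sum>i\<in>Y m n. scaleO (ta (cj i)) (pd (cj i) f \<odot> pd i g))"
  by (simp add: pb_def app_def Hf_app mul_scale_left)

lemma hasp_pb: "hasp 0 f \<Longrightarrow> hasp \<theta> g \<Longrightarrow> hasp \<theta> (pb f g)"
  by (simp add: pb_def hasp_app Hf_WE)

lemma pb_OA [simp]: "pb f g \<in> OA"
  by (simp add: pb_def)

text \<open>Leibniz gives two sums. In the one where \<partial>_j hits \<open>f\<close>, exchanging
  the factors and reindexing i to i' produces a minus sign, from \<open>tau\<close> for even i and
  from the odd factors for odd i. This identity makes \<open>Hf\<close> a homomorphism of
  brackets.\<close>

lemma pd_pb:
  assumes f: "hasp 0 f" and g: "hasp 0 g"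
  shows "pd j (pb f g) = pb f (pd j g) - pb g (pd j f)"
proof -
  let ?s = "\<lambda>i. (- 1) ^ (par m i * par m j) :: 'a"
  have "pd j (pb f g) = (\<Sum>i\<in>Y m n. scaleO (ta (cj i)) (pd j (pd (cj i) f) \<odot> pd i g))
      + (\<Sum>i\<in>Y m n. scaleO (ta (cj i)) (pd (cj i) f \<odot> pd i (pd j g)))"
  proof -
    have "pd j (pd (cj i) f \<odot> pd i g) = pd j (pd (cj i) f) \<odot> pd i g + pd (cj i) f \<odot> pd i (pd j g)" for i
    proof -
      have "hasp (par m i) (pd (cj i) f)" using hasp_pd[OF f, of "cj i"] by simp
      from pd_mul[OF this] show ?thesis
        by (simp add: pd_commute[of j i g] mul_scale_right mult.commute[of "par m j"])
    qed
    then show ?thesis by (simp add: pb_eq[OF f] pd_sum pd_scale sum.distrib VO.scale_right_distrib)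
  qed
  moreover have "(\<Sum>i\<in>Y m n. scaleO (ta (cj i)) (pd j (pd (cj i) f) \<odot> pd i g)) = - pb g (pd j f)"
  proof -
    have "scaleO (ta (cj i)) (pd j (pd (cj i) f) \<odot> pd i g) = - scaleO (ta i) (pd i g \<odot> pd (cj i) (pd j f))" for i
    proof (cases "i \<in> Ev")
      case True
      have "pd i g \<odot> pd j (pd (cj i) f) = pd j (pd (cj i) f) \<odot> pd i g"
        by (rule mul_commute_even[OF hasp_pd_even[OF g True] hasp_pd[OF hasp_pd[OF f]]])
      then show ?thesis using True by (simp add: ta_cj pd_commute_even(1)[of "cj i"] VO.scale_minus_left)
    next
      case False
      have 1: "hasp (0 + par m i) (pd i g)" by (rule hasp_pd[OF g])
      have 2: "hasp (0 + par m j + par m i) (pd i (pd j f))" by (rule hasp_pd[OF hasp_pd[OF f]])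
      show ?thesis using False pd_commute[of j i f] mul_commute[OF 1 2]
        by (simp add: mul_scale_left)
    qed
    then have "(\<Sum>i\<in>Y m n. scaleO (ta (cj i)) (pd j (pd (cj i) f) \<odot> pd i g)) =
        - (\<Sum>i\<in>Y m n. scaleO (ta i) (pd i g \<odot> pd (cj i) (pd j f)))"
      by (simp add: sum_negf)
    also have "\<dots> = - (\<Sum>i\<in>Y m n. scaleO (ta (cj i)) (pd (cj i) g \<odot> pd i (pd j f)))"
      using sum_cj_Y[of "\<lambda>i. scaleO (ta (cj i)) (pd (cj i) g \<odot> pd i (pd j f))"] by simp
    finally show ?thesis by (simp add: pb_eq[OF g])
  qed
  ultimately show ?thesis by (simp add: pb_eq[OF f])
qed

lemma br_Hf:
  assumes "hasp 0 f" "hasp 0 g"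
  shows "br (Hf f) (Hf g) = Hf (pb f g)"
proof
  fix k
  show "br (Hf f) (Hf g) k = Hf (pb f g) k"
    using assms by (simp add: br_WE Hf_WE Hf_app hasp_pb app_scale pd_pb VO.scale_right_diff_distrib
        flip: pb_def)
qed

lemma br_Hf_left:
  assumes "hasp 0 f" "w \<in> WE"
  shows "br (Hf f) w = (\<lambda>k. pb f (w k) - scaleO (ta (cj k)) (app w (pd (cj k) f)))"
  using assms by (simp add: br_WE Hf_WE Hf_app app_scale flip: pb_def)

section \<open>Iterated even derivatives and their p-power iterates\<close>

lemma pd_mul_even: "i \<in> Ev \<Longrightarrow> pd i (f \<odot> g) = pd i f \<odot> g + f \<odot> pd i g"
proof -
  assume i: "i \<in> Ev"
  have "pd i (f \<odot> g) = pd i f \<odot> g + f \<odot> pd i g" if "f \<in> OA" for f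
    using that
  proof (induction f rule: OA_induct)
    case (mono \<alpha> u)
    from pd_mul[OF hasp_xm, of u "card u" i \<alpha> g] show ?case using i by simp
  qed (auto simp: pd_add pd_scale mul_add_left mul_scale_left VO.scale_right_distrib)
  from this[OF trunc_OA[of f]] show ?thesis by simp
qed

abbreviation pdk :: "nat \<Rightarrow> nat \<Rightarrow> 'a super_poly \<Rightarrow> 'a super_poly" where
  "pdk i k \<equiv> pd i ^^ k"

lemma pdk_add: "pdk i k (f + g) = pdk i k f + pdk i k g"
  by (induction k arbitrary: f g) (simp_all add: pd_add)
lemma pdk_scale: "pdk i k (scaleO c f) = scaleO c (pdk i k f)"
  by (induction k arbitrary: f) (simp_all add: pd_scale)
lemma pdk_0 [simp]: "pdk i k 0 = 0"
  by (induction k) simp_all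
lemma pdk_diff: "pdk i k (f - g) = pdk i k f - pdk i k g"
  by (induction k arbitrary: f g) (simp_all add: pd_diff)
lemma pdk_sum: "pdk i k (sum F A) = (\<Sum>a\<in>A. pdk i k (F a))"
  by (induction A rule: infinite_finite_induct) (simp_all add: pdk_add)
lemma pdk_OA: "f \<in> OA \<Longrightarrow> pdk i k f \<in> OA"
  by (cases k) simp_all
lemma hasp_pdk: "i \<in> Ev \<Longrightarrow> hasp \<theta> f \<Longrightarrow> hasp \<theta> (pdk i k f)"
  by (induction k) (simp_all add: hasp_pd_even)
lemma pdk_pd: "i \<in> Ev \<Longrightarrow> pdk i k (pd j f) = pd j (pdk i k f)"
  by (induction k) (simp_all add: pd_commute_even)

lemma pdk_mul:
  assumes i: "i \<in> Ev"
  shows "pdk i k (f \<odot> g) = (\<Sum>a\<le>k. scaleO (of_nat (k choose a)) (pdk i a f \<odot> pdk i (k - a) g))"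
proof (induction k)
  case (Suc k)
  let ?F = "\<lambda>a. pdk i a f" and ?G = "\<lambda>a. pdk i a g"
  have "pdk i (Suc k) (f \<odot> g) = (\<Sum>a\<le>k. scaleO (of_nat (k choose a)) (?F (Suc a) \<odot> ?G (k - a)))
      + (\<Sum>a\<le>k. scaleO (of_nat (k choose a)) (?F a \<odot> ?G (Suc k - a)))"
    by (simp add: Suc.IH pd_sum pd_scale pd_mul_even[OF i] VO.scale_right_distrib sum.distrib Suc_diff_le)
  also have "(\<Sum>a\<le>k. scaleO (of_nat (k choose a)) (?F (Suc a) \<odot> ?G (k - a))) =
      (\<Sum>a\<le>Suc k. scaleO (if a = 0 then 0 else of_nat (k choose (a - 1))) (?F a \<odot> ?G (Suc k - a)))"
    by (subst sum.atMost_Suc_shift) (simp add: if_distrib)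
  also have "(\<Sum>a\<le>k. scaleO (of_nat (k choose a)) (?F a \<odot> ?G (Suc k - a))) =
      (\<Sum>a\<le>Suc k. scaleO (of_nat (k choose a)) (?F a \<odot> ?G (Suc k - a)))"
    by (simp add: binomial_eq_0)
  also have "(\<Sum>a\<le>Suc k. scaleO (if a = 0 then 0 else of_nat (k choose (a - 1))) (?F a \<odot> ?G (Suc k - a))) +
      (\<Sum>a\<le>Suc k. scaleO (of_nat (k choose a)) (?F a \<odot> ?G (Suc k - a))) =
      (\<Sum>a\<le>Suc k. scaleO (of_nat (Suc k choose a)) (?F a \<odot> ?G (Suc k - a)))"
    unfolding sum.distrib[symmetric] VO.scale_left_distrib[symmetric]
  proof (intro sum.cong refl arg_cong2[where f = scaleO])
    fix a show "(if a = 0 then 0 else of_nat (k choose (a - 1))) + of_nat (k choose a) = (of_nat (Suc k choose a) :: 'a)"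
      by (cases a) simp_all
  qed
  finally show ?case .
qed simp

text \<open>Only the outer terms of the Leibniz formula survive mod p, so p-power iterates of an
  even derivative are derivations again.\<close>

lemma pdk_mul_p:
  assumes i: "i \<in> Ev"
  shows "pdk i (p ^ s) (f \<odot> g) = pdk i (p ^ s) f \<odot> g + f \<odot> pdk i (p ^ s) g"
proof -
  let ?q = "p ^ s"
  have q: "?q > 0" using p_gt_3 by simp
  have "pdk i ?q (f \<odot> g) = (\<Sum>a\<le>?q. scaleO (of_nat (?q choose a)) (pdk i a f \<odot> pdk i (?q - a) g))"
    by (rule pdk_mul[OF i])
  also have "\<dots> = (\<Sum>a\<in>{0, ?q}. scaleO (of_nat (?q choose a)) (pdk i a f \<odot> pdk i (?q - a) g))"
    by (rule sum.mono_neutral_right) (auto simp: p_dvd_choose)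
  also have "\<dots> = pdk i ?q f \<odot> g + f \<odot> pdk i ?q g"
    using q by (simp add: add.commute)
  finally show ?thesis .
qed

text \<open>On even fields this is the k-th power of ad \<partial>_i, written coefficientwise; see
  \<open>ad_ddx_power\<close>.\<close>

definition Dl :: "nat \<Rightarrow> nat \<Rightarrow> 'a super_vf \<Rightarrow> 'a super_vf" where
  "Dl i k E = (\<lambda>j. pdk i k (E j))"

lemma Dl_WE: "i \<in> Ev \<Longrightarrow> E \<in> WE \<Longrightarrow> Dl i k E \<in> WE"
  by (rule WE_I) (auto simp: Dl_def pdk_OA WE_OA WE_out hasp_pdk WE_hasp)

lemma Dl_app:
  assumes i: "i \<in> Ev"
  shows "pdk i (p ^ s) (app D f) = app (Dl i (p ^ s) D) f + app D (pdk i (p ^ s) f)"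
  by (simp add: app_def pdk_sum pdk_mul_p[OF i] pdk_pd[OF i] sum.distrib Dl_def)

lemma Dl_br:
  assumes i: "i \<in> Ev" and x: "x \<in> WE" and y: "y \<in> WE"
  shows "Dl i (p ^ s) (br x y) = br x (Dl i (p ^ s) y) - br y (Dl i (p ^ s) x)"
proof
  fix k
  show "Dl i (p ^ s) (br x y) k = (br x (Dl i (p ^ s) y) - br y (Dl i (p ^ s) x)) k"
    using assms by (simp add: br_app Dl_WE fun_app Dl_def[of i "p ^ s" "br x y"] pdk_diff Dl_app)
      (simp add: Dl_def algebra_simps)
qed

lemma ddx_WE: "r \<in> Ev \<Longrightarrow> ddx r \<in> WE"
  by (rule WE_I) (auto simp: ddx_def vf_def Y_iff hasp_xm)

lemma app_ddx: "r \<in> Ev \<Longrightarrow> app (ddx r) f = pd r f"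
proof -
  assume r: "r \<in> Ev"
  have "app (ddx r) f = (\<Sum>i\<in>Y m n. if i = r then xm 0 {} \<odot> pd r f else 0)"
    unfolding app_def by (rule sum.cong) (auto simp: ddx_def vf_def)
  then show ?thesis using r by (simp add: Y_iff mul_one)
qed

lemma br_ddx: "r \<in> Ev \<Longrightarrow> E \<in> WE \<Longrightarrow> br (ddx r) E = (\<lambda>j. pd r (E j))"
proof -
  assume *: "r \<in> Ev" "E \<in> WE"
  have "app E (ddx r j) = 0" for j by (simp add: ddx_def vf_def)
  with * show ?thesis by (simp add: br_WE ddx_WE app_ddx)
qed

lemma ad_ddx_power: "r \<in> Ev \<Longrightarrow> E \<in> WE \<Longrightarrow> (br (ddx r) ^^ k) E = Dl r k E"
proof (induction k)
  case 0 then show ?case by (simp add: Dl_def)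
next
  case (Suc k)
  then show ?case by (simp add: br_ddx Dl_WE) (simp add: Dl_def)
qed

section \<open>The Z-grading\<close>

definition homo :: "int \<Rightarrow> 'a super_poly \<Rightarrow> bool" where
  "homo d f \<longleftrightarrow> (\<forall>\<alpha> u. f (\<alpha>, u) \<noteq> 0 \<longrightarrow> int (mono_degree m \<alpha> u) = d)"

lemma homo_0 [simp]: "homo d 0" by (simp add: homo_def fun_app)

lemma homo_add: "homo d f \<Longrightarrow> homo d g \<Longrightarrow> homo d (f + g)"
  unfolding homo_def fun_app by (metis add.right_neutral add_0)

lemma homo_diff: "homo d f \<Longrightarrow> homo d g \<Longrightarrow> homo d (f - g)"
  unfolding homo_def fun_app by (metis diff_zero)

lemma homo_scale: "homo d f \<Longrightarrow> homo d (scaleO c f)"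
  unfolding homo_def fun_app by auto

lemma homo_sum: "(\<And>i. i \<in> A \<Longrightarrow> homo d (F i)) \<Longrightarrow> homo d (sum F A)"
  by (induction A rule: infinite_finite_induct) (auto simp: homo_add)

lemma homo_xm: "int (mono_degree m \<alpha> u) = d \<Longrightarrow> homo d (xm \<alpha> u)"
  by (auto simp: homo_def xmono_def)

lemma homo_trunc: "homo d f \<Longrightarrow> homo d (trunc f)"
  by (auto simp: homo_def trunc_def)

lemma homo_induct [consumes 2, case_names zero add scale mono]:
  assumes "f \<in> OA" "homo d f"
    and "P 0" "\<And>f g. P f \<Longrightarrow> P g \<Longrightarrow> P (f + g)" "\<And>c f. P f \<Longrightarrow> P (scaleO c f)"
    and "\<And>\<alpha> u. \<alpha> \<in> MI \<Longrightarrow> u \<subseteq> Od \<Longrightarrow> int (mono_degree m \<alpha> u) = d \<Longrightarrow> P (xm \<alpha> u)"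
  shows "P f"
  using assms(1) by (rule OA_induct_supp[where Q = "\<lambda>\<alpha> u. int (mono_degree m \<alpha> u) = d"])
    (use assms in \<open>auto simp: homo_def\<close>)

lemma mono_degree_add:
  "finite u \<Longrightarrow> finite v \<Longrightarrow> u \<inter> v = {} \<Longrightarrow>
    mono_degree m (\<alpha> + \<beta>) (u \<union> v) = mono_degree m \<alpha> u + mono_degree m \<beta> v"
  by (simp add: mono_degree_def sum.distrib card_Un_disjoint)

lemma homo_mul:
  assumes "homo d f" "homo e g" shows "homo (d + e) (f \<odot> g)"
proof -
  have mono: "homo (d + e) (xm \<alpha> u \<odot> xm \<beta> v)"
    if "\<alpha> \<in> MI" "u \<subseteq> Od" "int (mono_degree m \<alpha> u) = d" "\<beta> \<in> MI" "v \<subseteq> Od" "int (mono_degree m \<beta> v) = e"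
    for \<alpha> u \<beta> v
    using that by (auto simp: mul_mono oc_def mono_degree_add finite_sub_Od intro!: homo_scale homo_xm)
  have "homo (d + e) (f \<odot> g)" if "f \<in> OA" "homo d f" "g \<in> OA" "homo e g" for f g
    using that(1,2)
  proof (induction f rule: homo_induct)
    case fm: (mono \<alpha> u)
    show ?case using that(3,4)
    proof (induction g rule: homo_induct)
      case gm: (mono \<beta> v) show ?case by (rule mono) (use fm gm in auto)
    qed (auto simp: mul_add_right mul_scale_right homo_add homo_scale)
  qed (auto simp: mul_add_left mul_scale_left homo_add homo_scale)
  from this[OF trunc_OA[of f] homo_trunc trunc_OA[of g] homo_trunc] assms show ?thesis by simp
qed

lemma sum_upd: "i \<in> Ev \<Longrightarrow> (\<Sum>j\<in>Ev. (\<alpha>(i := c)) j) + \<alpha> i = (\<Sum>j\<in>Ev. \<alpha> j) + (c :: nat)"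
proof -
  assume i: "i \<in> Ev"
  have "(\<Sum>j\<in>Ev - {i}. (\<alpha>(i := c)) j) = (\<Sum>j\<in>Ev - {i}. \<alpha> j)"
    by (rule sum.cong) auto
  with i show ?thesis by (simp add: sum.remove[of Ev i])
qed

lemma homo_pd:
  assumes "homo d f" shows "homo (d - 1) (pd i f)"
proof -
  have "homo (d - 1) (pd i f)" if "f \<in> OA" "homo d f" for f using that
  proof (induction f rule: homo_induct)
    case (mono \<alpha> u)
    show ?case
    proof (cases "i \<in> Ev")
      case True
      have "int (mono_degree m (\<alpha>(i := \<alpha> i - 1)) u) = d - 1" if "\<alpha> i > 0"
      proof -
        have "(\<Sum>j\<in>Ev. (\<alpha>(i := \<alpha> i - 1)) j) + 1 = (\<Sum>j\<in>Ev. \<alpha> j)"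
          using sum_upd[OF True, of \<alpha> "\<alpha> i - 1"] that by linarith
        then show ?thesis using mono(3) unfolding mono_degree_def by linarith
      qed
      then show ?thesis using mono True by (auto simp: pd_even_mono intro!: homo_xm)
    next
      case False
      have "int (mono_degree m \<alpha> (u - {i})) = d - 1" if "i \<in> u"
        using mono that card_Suc_Diff1[of u i] finite_sub_Od[of u] by (auto simp: mono_degree_def)
      then show ?thesis using mono False by (auto simp: pd_odd_mono intro!: homo_xm homo_scale)
    qed
  qed (auto simp: pd_add pd_scale homo_add homo_scale)
  from this[OF trunc_OA homo_trunc] assms show ?thesis by simp
qed

lemma homo_pdk: "homo d f \<Longrightarrow> homo (d - int k) (pdk i k f)"
proof (induction k)
  case (Suc k)
  then have "homo (d - int k - 1) (pd i (pdk i k f))" by (intro homo_pd) auto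
  then show ?case by (simp add: algebra_simps)
qed simp

abbreviation WD :: "int \<Rightarrow> 'a super_vf set" where "WD \<equiv> W_deg p m n t"

lemma WD_iff: "D \<in> WD k \<longleftrightarrow>
    (\<forall>i. D i \<in> OA) \<and> (\<forall>i. i \<notin> Y m n \<longrightarrow> D i = 0) \<and> (\<forall>i. homo (k + 1) (D i))"
proof
  assume "D \<in> WD k"
  then show "(\<forall>i. D i \<in> OA) \<and> (\<forall>i. i \<notin> Y m n \<longrightarrow> D i = 0) \<and> (\<forall>i. homo (k + 1) (D i))"
    unfolding W_deg_def
  proof (induction rule: VW.span_induct_alt)
    case base
    have "\<forall>i. (0 :: 'a super_vf) i = 0" by (simp add: zero_fun_apply)
    then show ?case by simp
  next
    case (step c x y)
    then obtain f s where x: "x = vf f s" "f \<in> O_deg p m n t (k + 1)" "s \<in> Y m n" by blast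
    then have "f \<in> OA" "homo (k + 1) f" by (auto simp: O_deg_def homo_def)
    moreover have "(scaleW c x + y) i = scaleO c (x i) + y i" for i by (simp add: plus_fun_apply scaleW_app)
    moreover have "x i = (if i = s then f else 0)" for i by (simp add: x(1) vf_def)
    ultimately show ?case using step.IH x(3) by (auto simp: homo_add homo_scale)
  qed
next
  assume D: "(\<forall>i. D i \<in> OA) \<and> (\<forall>i. i \<notin> Y m n \<longrightarrow> D i = 0) \<and> (\<forall>i. homo (k + 1) (D i))"
  have "D = (\<Sum>i\<in>Y m n. vf (D i) i)"
  proof
    fix j
    show "D j = (\<Sum>i\<in>Y m n. vf (D i) i) j"
      using D by (simp add: sum_fun_app[where x = j] vf_def)
  qed
  also have "\<dots> \<in> WD k"
    unfolding W_deg_def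
  proof (rule VW.span_sum, rule VW.span_base)
    fix i assume "i \<in> Y m n"
    moreover have "D i \<in> O_deg p m n t (k + 1)" using D by (auto simp: O_deg_def homo_def)
    ultimately show "vf (D i) i \<in> {vf f s |f s. f \<in> O_deg p m n t (k + 1) \<and> s \<in> Y m n}" by blast
  qed
  finally show "D \<in> WD k" .
qed

lemma WD_homo: "D \<in> WD k \<Longrightarrow> homo (k + 1) (D i)"
  by (simp add: WD_iff)

lemma WED_iff: "D \<in> W_even_deg p m n t k \<longleftrightarrow> D \<in> WE \<and> (\<forall>i. homo (k + 1) (D i))"
  by (auto simp: W_even_deg_def WD_iff WE_iff)

lemma homo_cong: "d = e \<Longrightarrow> homo d f \<Longrightarrow> homo e f" by simp

lemma homo_app:
  assumes "\<And>i. homo (k + 1) (D i)" "homo d f"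
  shows "homo (k + d) (app D f)"
  unfolding app_def
proof (rule homo_sum)
  fix i
  have "homo ((k + 1) + (d - 1)) (D i \<odot> pd i f)" by (intro homo_mul homo_pd assms)
  then show "homo (k + d) (D i \<odot> pd i f)" by simp
qed

text \<open>The polynomial model of \<open>N_alg\<close>: the two vanishing coordinates are the
  excluded monomials, and the constants belong to it although \<open>Hf\<close> kills them. Thus
  \<open>NA = Hf\<close> followed by the image of \<open>Hev\<close>, as proved in
  \<open>N_eq\<close>.\<close>

definition Hev :: "'a super_poly set" where
  "Hev = {f \<in> OA. hasp 0 f \<and> f (pimax, {}) = 0 \<and> f (pimax, Od) = 0}"

abbreviation NA :: "'a super_vf set" where "NA \<equiv> N_alg p m n t"

lemma Hev_OA: "f \<in> Hev \<Longrightarrow> f \<in> OA" and Hev_hasp: "f \<in> Hev \<Longrightarrow> hasp 0 f"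
  by (simp_all add: Hev_def)

lemma Hev_0 [simp]: "0 \<in> Hev" and Hev_add: "f \<in> Hev \<Longrightarrow> g \<in> Hev \<Longrightarrow> f + g \<in> Hev"
  and Hev_scale: "f \<in> Hev \<Longrightarrow> scaleO c f \<in> Hev"
  by (simp_all add: Hev_def fun_app hasp_add hasp_scale)

lemma Hev_sum: "(\<And>i. i \<in> A \<Longrightarrow> F i \<in> Hev) \<Longrightarrow> sum F A \<in> Hev"
  by (induction A rule: infinite_finite_induct) (auto simp: Hev_add)

lemma Hev_xm:
  "\<alpha> \<in> MI \<Longrightarrow> u \<subseteq> Od \<Longrightarrow> even (card u) \<Longrightarrow> (\<alpha>, u) \<noteq> (pimax, {}) \<Longrightarrow> (\<alpha>, u) \<noteq> (pimax, Od) \<Longrightarrow> xm \<alpha> u \<in> Hev"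
  by (auto simp: Hev_def hasp_xm) (auto simp: xmono_def)

lemma Hf_0 [simp]: "Hf 0 = 0"
  by (rule ext) (simp add: Hf_app zero_fun_apply)

lemma Hev_induct [consumes 1, case_names zero add scale mono]:
  assumes "f \<in> Hev" and "P 0"
    and add: "\<And>f g. f \<in> Hev \<Longrightarrow> g \<in> Hev \<Longrightarrow> P f \<Longrightarrow> P g \<Longrightarrow> P (f + g)"
    and scale: "\<And>c f. f \<in> Hev \<Longrightarrow> P f \<Longrightarrow> P (scaleO c f)"
    and mono: "\<And>\<alpha> u. \<alpha> \<in> MI \<Longrightarrow> u \<subseteq> Od \<Longrightarrow> even (card u) \<Longrightarrow> (\<alpha>, u) \<noteq> (pimax, {}) \<Longrightarrow>
      (\<alpha>, u) \<noteq> (pimax, Od) \<Longrightarrow> P (xm \<alpha> u)"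
  shows "P f"
proof -
  let ?Q = "\<lambda>\<alpha> u. even (card u) \<and> (\<alpha>, u) \<noteq> (pimax, {}) \<and> (\<alpha>, u) \<noteq> (pimax, Od)"
  have Q: "?Q \<alpha> u" if "f (\<alpha>, u) \<noteq> 0" for \<alpha> u
    using that assms(1) unfolding Hev_def hasp_def by auto
  have "f \<in> Hev \<and> P f" using Hev_OA[OF assms(1)] Q
  proof (rule OA_induct_supp)
    fix \<alpha> u assume "\<alpha> \<in> MI" "u \<subseteq> Od" "?Q \<alpha> u"
    then show "xm \<alpha> u \<in> Hev \<and> P (xm \<alpha> u)" using mono[of \<alpha> u] Hev_xm[of \<alpha> u] by blast
  qed (use assms in \<open>auto simp: Hev_add Hev_scale\<close>)
  then show ?thesis by simp
qed

lemma N_eq: "NA = Hf ` Hev"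
proof (intro equalityI subsetI)
  fix x assume "x \<in> NA"
  then show "x \<in> Hf ` Hev" unfolding N_alg_def
  proof (induction rule: VW.span_induct_alt)
    case base
    show ?case by (rule image_eqI[of _ _ 0]) auto
  next
    case (step c x y)
    then obtain \<alpha> u g where "x = Hf (xm \<alpha> u)" "xm \<alpha> u \<in> Hev" "y = Hf g" "g \<in> Hev"
      using Hev_xm by blast
    then show ?case
      by (intro image_eqI[of _ _ "scaleO c (xm \<alpha> u) + g"])
        (auto simp: Hf_add Hf_scale Hev_hasp hasp_scale Hev_add Hev_scale)
  qed
next
  fix x assume "x \<in> Hf ` Hev"
  then obtain f where f: "f \<in> Hev" and x: "x = Hf f" by blast
  from f have "Hf f \<in> NA"
  proof (induction rule: Hev_induct)
    case (mono \<alpha> u)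
    then show ?case unfolding N_alg_def by (intro VW.span_base) blast
  qed (auto simp: Hf_add Hf_scale Hev_hasp N_alg_def intro: VW.span_add VW.span_scale VW.span_zero)
  then show "x \<in> NA" using x by simp
qed

lemma N_Hf: "f \<in> Hev \<Longrightarrow> Hf f \<in> NA"
  by (simp add: N_eq)

lemma N_WE: "x \<in> NA \<Longrightarrow> x \<in> WE"
  by (auto simp: N_eq Hf_WE Hev_hasp)

lemma N_add: "x \<in> NA \<Longrightarrow> y \<in> NA \<Longrightarrow> x + y \<in> NA"
  and N_scale: "x \<in> NA \<Longrightarrow> scaleW c x \<in> NA"
  by (auto simp: N_alg_def intro: VW.span_add VW.span_scale)

definition vanish :: "(nat \<Rightarrow> nat) \<times> nat set \<Rightarrow> 'a super_poly \<Rightarrow> bool" where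
  "vanish z f \<longleftrightarrow> f z = 0"

lemma vanish_simps [simp]: "vanish z 0" "vanish z f \<Longrightarrow> vanish z g \<Longrightarrow> vanish z (f + g)"
  "vanish z f \<Longrightarrow> vanish z (scaleO c f)"
  by (simp_all add: vanish_def fun_app)

lemma vanish_xm: "vanish z (xm \<alpha> u) \<longleftrightarrow> z \<noteq> (\<alpha>, u)"
  by (simp add: vanish_def xmono_def)

lemma pd_top:
  assumes i: "i \<in> Ev" shows "pd i h (pimax, u) = 0"
proof -
  have "vanish (pimax, u) (pd i h)" if "h \<in> OA" for h using that
  proof (induction h rule: OA_induct)
    case (mono \<alpha> v)
    have "(\<alpha>(i := \<alpha> i - 1)) i \<noteq> pimax i" if "\<alpha> i > 0"
      using MI_le[OF mono(1), of i] that by simp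
    then show ?case using mono i by (auto simp: pd_even_mono vanish_xm dest: fun_cong[of _ _ i])
  qed (auto simp: pd_add pd_scale)
  from this[OF trunc_OA[of h]] show ?thesis by (simp add: vanish_def)
qed

text \<open>A monomial of the even element \<open>f\<close> that contains j contains a further odd
  index. So every monomial of the product has a nonempty odd part, and this odd part avoids
  j.\<close>

lemma odd_pd_mul_coeff:
  assumes f: "hasp 0 f" and j: "j \<in> Od" and w: "w = {} \<or> j \<in> w"
  shows "(pd j f \<odot> pd j g) (\<gamma>, w) = 0"
proof -
  have mono: "vanish (\<gamma>, w) (pd j (xm \<alpha> u) \<odot> pd j (xm \<beta> v))"
    if b: "\<alpha> \<in> MI" "u \<subseteq> Od" "even (card u)" "\<beta> \<in> MI" "v \<subseteq> Od" for \<alpha> u \<beta> v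
  proof (cases "j \<in> u \<and> j \<in> v")
    case True
    have "u \<noteq> {j}" using b by auto
    then have "u - {j} \<noteq> {}" using True by auto
    then have "(u - {j}) \<union> (v - {j}) \<noteq> w" using w by auto
    moreover have "u - {j} \<subseteq> Od" "v - {j} \<subseteq> Od" using b by auto
    ultimately show ?thesis using True b j
      by (auto simp: pd_odd_mono mul_scale_left mul_scale_right mul_mono vanish_xm)
  next
    case False
    then show ?thesis using b j by (auto simp: pd_odd_mono)
  qed
  have "vanish (\<gamma>, w) (pd j f \<odot> pd j g)" if "f \<in> OA" "hasp 0 f" "g \<in> OA" for f g
    using that(1,2)
  proof (induction f rule: hasp_induct)
    case fm: (mono \<alpha> u)
    show ?case using that(3)
    proof (induction g rule: OA_induct)
      case gm: (mono \<beta> v) show ?case by (rule mono) (use fm gm in auto)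
    qed (auto simp: pd_add pd_scale mul_add_right mul_scale_right)
  qed (auto simp: pd_add pd_scale mul_add_left mul_scale_left)
  from this[OF trunc_OA[of f] hasp_trunc[OF f] trunc_OA[of g]] show ?thesis by (simp add: vanish_def)
qed

lemma two_nz: "(2 :: 'a) \<noteq> 0"
  using of_nat_0_iff[of 2] p_gt_3 by (auto dest: dvd_imp_le)

lemma eq_minus_self:
  fixes x :: "'a super_poly"
  assumes "x = - x" shows "x = 0"
proof -
  have "x + x = 0" using assms by (simp only: eq_neg_iff_add_eq_0)
  then have "scaleO 2 x = 0" using VO.scale_left_distrib[of 1 1 x] by simp
  then show ?thesis using two_nz by simp
qed

text \<open>The even part of the Poisson bracket is a divergence, hence has no component at the top \<open>\<pi>\<close>.\<close>

lemma pb_even_top: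
  assumes "hasp 0 f" "hasp 0 g"
  shows "(\<Sum>i\<in>Ev. scaleO (ta (cj i)) (pd (cj i) f \<odot> pd i g)) (pimax, u) = 0"
proof -
  let ?S = "\<Sum>i\<in>Ev. scaleO (ta (cj i)) (f \<odot> pd (cj i) (pd i g))"
  have 1: "?S = (\<Sum>i\<in>Ev. scaleO (ta (cj (cj i))) (f \<odot> pd (cj (cj i)) (pd (cj i) g)))"
    by (rule sum_cj_Ev[symmetric])
  have 2: "(\<Sum>i\<in>Ev. scaleO (ta (cj (cj i))) (f \<odot> pd (cj (cj i)) (pd (cj i) g))) = - ?S"
    unfolding sum_negf[symmetric]
    by (intro sum.cong refl) (simp add: ta_cj VO.scale_minus_left pd_commute_even)
  have S: "?S = 0" by (rule eq_minus_self[OF trans[OF 1 2]])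
  have "(\<Sum>i\<in>Ev. scaleO (ta (cj i)) (pd (cj i) f \<odot> pd i g)) =
      (\<Sum>i\<in>Ev. scaleO (ta (cj i)) (pd (cj i) (f \<odot> pd i g)))"
    using S by (simp add: pd_mul_even VO.scale_right_distrib sum.distrib)
  moreover have "(\<Sum>i\<in>Ev. scaleO (ta (cj i)) (pd (cj i) (f \<odot> pd i g))) (pimax, u) = 0"
    unfolding sum_fun_app by (rule sum.neutral) (simp add: pd_top fun_app)
  ultimately show ?thesis by (simp only:)
qed

text \<open>Neither excluded monomial can appear in a bracket: the even part of the sum is a
  divergence, and the odd part is covered by \<open>odd_pd_mul_coeff\<close>.\<close>

lemma pb_Hev:
  assumes f: "f \<in> Hev" and g: "g \<in> Hev"
  shows "pb f g \<in> Hev"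
proof -
  have h: "hasp 0 f" "hasp 0 g" using f g Hev_hasp by auto
  have "pb f g (pimax, u) = 0" if u: "u = {} \<or> u = Od" for u
  proof -
    have "pb f g = (\<Sum>i\<in>Ev. scaleO (ta (cj i)) (pd (cj i) f \<odot> pd i g)) + (\<Sum>i\<in>Od. pd i f \<odot> pd i g)"
      unfolding pb_eq[OF h(1)] sum_Y by simp
    moreover have "(\<Sum>i\<in>Od. pd i f \<odot> pd i g) (pimax, u) = 0"
      unfolding sum_fun_app using u by (auto intro!: sum.neutral odd_pd_mul_coeff h)
    ultimately show ?thesis using pb_even_top[OF h] by (simp add: plus_fun_apply)
  qed
  then show ?thesis using h by (simp add: Hev_def hasp_pb)
qed

lemma pb_anti:
  assumes f: "hasp 0 f" and g: "hasp 0 g"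
  shows "pb f g = - pb g f"
proof -
  have "scaleO (ta (cj i)) (pd (cj i) f \<odot> pd i g) = - scaleO (ta i) (pd i g \<odot> pd (cj i) f)" for i
  proof (cases "i \<in> Ev")
    case True
    have "pd i g \<odot> pd (cj i) f = pd (cj i) f \<odot> pd i g"
      by (rule mul_commute_even[OF hasp_pd_even[OF g True] hasp_pd[OF f]])
    then show ?thesis using True by (simp add: ta_cj VO.scale_minus_left)
  next
    case False
    have 1: "hasp (0 + par m i) (pd i g)" and 2: "hasp (0 + par m i) (pd i f)"
      by (rule hasp_pd[OF g], rule hasp_pd[OF f])
    show ?thesis using False mul_commute[OF 1 2] by simp
  qed
  then have "pb f g = - (\<Sum>i\<in>Y m n. scaleO (ta i) (pd i g \<odot> pd (cj i) f))"
    by (simp add: pb_eq[OF f] sum_negf)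
  also have "\<dots> = - pb g f"
    using sum_cj_Y[of "\<lambda>i. scaleO (ta (cj i)) (pd (cj i) g \<odot> pd i f)"] by (simp add: pb_eq[OF g])
  finally show ?thesis .
qed

lemma N_br: "x \<in> NA \<Longrightarrow> y \<in> NA \<Longrightarrow> br x y \<in> NA"
  by (auto simp: N_eq br_Hf Hev_hasp intro!: imageI pb_Hev)

text \<open>An even monomial containing j has another odd index, which also occurs in \<partial>_j
  x^\<omega>, so each product vanishes. Being annihilated by all even Hamiltonian fields is what
  allows x^\<omega> to be a factor in \<open>Phi\<close> and \<open>Theta\<close>.\<close>

lemma pb_omega:
  assumes f: "hasp 0 f" shows "pb f \<omega> = 0"
proof -
  have mono: "pd j (xm \<alpha> u) \<odot> pd j \<omega> = 0" if b: "\<alpha> \<in> MI" "u \<subseteq> Od" "even (card u)" and j: "j \<in> Od" for \<alpha> u j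
  proof (cases "j \<in> u")
    case True
    have "u \<noteq> {j}" using b by auto
    then have "(u - {j}) \<inter> (Od - {j}) \<noteq> {}" using True b by auto
    moreover have "u - {j} \<subseteq> Od" using b by auto
    ultimately show ?thesis using True b j
      by (simp add: pd_odd_mono mul_scale_left mul_scale_right mul_mono oc_def)
  next
    case False
    then show ?thesis using b j by (simp add: pd_odd_mono)
  qed
  have "pd (cj j) f \<odot> pd j \<omega> = 0" if "f \<in> OA" "hasp 0 f" "j \<in> Y m n" for f j
  proof (cases "j \<in> Ev")
    case True
    then show ?thesis by (simp add: pd_even_mono)
  next
    case False
    then have j: "j \<in> Od" using that Y_iff by auto
    from that(1,2) have "pd j f \<odot> pd j \<omega> = 0"
    proof (induction f rule: hasp_induct)
      case (mono \<alpha> u) show ?case by (rule \<open>\<And>u j \<alpha>. \<alpha> \<in> MI \<Longrightarrow> u \<subseteq> Od \<Longrightarrow> even (card u) \<Longrightarrow> j \<in> Od \<Longrightarrow> pd j (xm \<alpha> u) \<odot> pd j \<omega> = 0\<close>) (use mono j in auto)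
    qed (auto simp: pd_add pd_scale mul_add_left mul_scale_left)
    then show ?thesis using False by simp
  qed
  from this[OF trunc_OA[of f] hasp_trunc[OF f]] show ?thesis by (simp add: pb_eq[OF f])
qed

section \<open>The maps on the right-hand side are derivations of the stated degrees\<close>

abbreviation Dr :: "'a vf_map set" where "Dr \<equiv> Der p m n t"
abbreviation Dd :: "int \<Rightarrow> 'a vf_map set" where "Dd \<equiv> Der_deg p m n t"
abbreviation rs :: "'a vf_map \<Rightarrow> 'a vf_map" where "rs \<equiv> restr p m n t"

lemma rs_N [simp]: "x \<in> NA \<Longrightarrow> rs \<phi> x = \<phi> x"
  by (simp add: restr_def)

lemma Dd_restrI:
  assumes W: "\<And>x. x \<in> NA \<Longrightarrow> \<phi> x \<in> WE"
    and "\<And>x y. x \<in> NA \<Longrightarrow> y \<in> NA \<Longrightarrow> \<phi> (x + y) = \<phi> x + \<phi> y"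
    and "\<And>c x. x \<in> NA \<Longrightarrow> \<phi> (scaleW c x) = scaleW c (\<phi> x)"
    and "\<And>x y. x \<in> NA \<Longrightarrow> y \<in> NA \<Longrightarrow> \<phi> (br x y) = br x (\<phi> y) - br y (\<phi> x)"
    and deg: "\<And>d x i. x \<in> NA \<Longrightarrow> (\<And>j. homo (d + 1) (x j)) \<Longrightarrow> homo (d + k + 1) (\<phi> x i)"
  shows "rs \<phi> \<in> Dd k"
proof -
  have "rs \<phi> \<in> Dr" using assms
    by (auto simp: Der_def N_add N_scale N_br) (simp_all add: restr_def)
  moreover have "rs \<phi> x \<in> W_even_deg p m n t (d + k)" if "x \<in> N_deg p m n t d" for x d
    using that W deg[of x d] by (auto simp: WED_iff N_deg_def WD_homo)
  ultimately show ?thesis by (simp add: Der_deg_def)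
qed

lemma ad_Dd:
  assumes "E \<in> W_even_deg p m n t k"
  shows "rs (br E) \<in> Dd k"
proof (rule Dd_restrI)
  have E: "E \<in> WE" "\<And>i. homo (k + 1) (E i)" using assms by (auto simp: WED_iff)
  fix x assume x: "x \<in> NA"
  show "br E x \<in> WE" using E x by (simp add: br_in_WE N_WE)
  show "br E (scaleW c x) = scaleW c (br E x)" for c
    using E x N_scale[OF x, of c] by (intro ext) (simp add: br_app N_WE scaleW_app app_scale app_scale_left VO.scale_right_diff_distrib)
  show "homo (d + k + 1) (br E x i)" if h: "\<And>j. homo (d + 1) (x j)" for d i
  proof -
    have "homo (k + (d + 1)) (app E (x i))" by (intro homo_app E h)
    moreover have "homo (d + (k + 1)) (app x (E i))" by (intro homo_app E h)
    ultimately show ?thesis using E x by (simp add: br_app N_WE homo_diff algebra_simps)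
  qed
  fix y assume y: "y \<in> NA"
  show "br E (x + y) = br E x + br E y"
    using E x y N_add[OF x y] by (intro ext) (simp add: br_app N_WE fun_app app_add app_add_left)
  show "br E (br x y) = br x (br E y) - br y (br E x)"
    using E x y by (intro br_Jacobi) (auto simp: N_WE)
qed

lemma Dl_add: "Dl i k (x + y) = Dl i k x + Dl i k y"
  and Dl_scale: "Dl i k (scaleW c x) = scaleW c (Dl i k x)"
  by (rule ext, simp add: Dl_def fun_app pdk_add pdk_scale)+

lemma homo_Dl: "homo d (x j) \<Longrightarrow> homo (d - int k) (Dl i k x j)"
  by (simp add: Dl_def homo_pdk)

lemma rs_ad_ddx: "r \<in> Ev \<Longrightarrow> rs (br (ddx r) ^^ k) = rs (Dl r k)"
  by (auto simp: restr_def fun_eq_iff[of "\<lambda>x. if _ then _ else _"] ad_ddx_power N_WE)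

lemma Dl_Dd:
  assumes r: "r \<in> Ev"
  shows "rs (Dl r (p ^ s)) \<in> Dd (- int (p ^ s))"
proof (rule Dd_restrI)
  fix x :: "'a super_vf" and i d assume "\<And>j. homo (d + 1) (x j)"
  from homo_Dl[where k = "p ^ s" and i = r and x = x and j = i, OF this[of i]] show "homo (d + - int (p ^ s) + 1) (Dl r (p ^ s) x i)"
    by (simp add: algebra_simps)
qed (use r in \<open>auto simp: Dl_WE N_WE Dl_add Dl_scale Dl_br\<close>)

abbreviation act :: "'a super_poly \<Rightarrow> 'a super_vf \<Rightarrow> 'a super_vf" where "act \<equiv> O_act p m n t"

lemma act_app: "act g F i = g \<odot> F i"
  by (simp add: O_act_def)

lemma act_WE: "hasp 0 g \<Longrightarrow> F \<in> WE \<Longrightarrow> act g F \<in> WE"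
  by (rule WE_I) (auto simp: act_app WE_out dest: hasp_mul[of 0 g _ "F _"] WE_hasp)

lemma app_act: "app (act g F) h = g \<odot> app F h"
  by (simp add: app_def act_app mul_sum_right mul_assoc)

lemma br_act:
  assumes "E \<in> WE" "F \<in> WE" "hasp 0 g"
  shows "br E (act g F) = act (app E g) F + act g (br E F)"
proof
  fix k
  show "br E (act g F) k = (act (app E g) F + act g (br E F)) k"
    using assms by (simp add: br_app act_WE act_app plus_fun_apply app_mul[of E 0] app_act mul_diff_right)
qed

lemma hasp_omega: "even n \<Longrightarrow> hasp 0 \<omega>"
  by (simp add: hasp_xm)

lemma homo_omega: "homo (int n) \<omega>"
  by (rule homo_xm) (simp add: mono_degree_def)

text \<open>Fields in \<open>NA\<close> annihilate x^\<omega>, so multiplication by x^\<omega>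
  commutes with their adjoint action and carries the derivation \<open>Dl r (p ^ s)\<close> to a
  derivation. For even n it also preserves evenness.\<close>

lemma Theta_Dd:
  assumes n: "even n" and r: "r \<in> Ev"
  shows "Theta p m n t r s \<in> Dd (int n - int (p ^ s))"
proof -
  let ?\<phi> = "\<lambda>x. act \<omega> (Dl r (p ^ s) x)"
  have "Theta p m n t r s = rs ?\<phi>"
    using r by (auto simp: Theta_def restr_def fun_eq_iff[of "\<lambda>x. if _ then _ else _"] ad_ddx_power N_WE)
  also have "\<dots> \<in> Dd (int n - int (p ^ s))"
  proof (rule Dd_restrI)
    fix x assume x: "x \<in> NA"
    have xw: "x \<in> WE" "Dl r (p ^ s) x \<in> WE" using x r by (auto simp: N_WE Dl_WE)
    show "?\<phi> x \<in> WE" using n xw by (simp add: act_WE hasp_omega)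
    show "?\<phi> (scaleW c x) = scaleW c (?\<phi> x)" for c
      by (rule ext) (simp add: Dl_scale act_app scaleW_app mul_scale_right)
    show "homo (d + (int n - int (p ^ s)) + 1) (?\<phi> x i)" if "\<And>j. homo (d + 1) (x j)" for d i
      using homo_mul[OF homo_omega homo_Dl[where k = "p ^ s" and i = r and x = x and j = i, OF that[of i]]]
      by (simp add: act_app algebra_simps)
    fix y assume y: "y \<in> NA"
    have yw: "y \<in> WE" "Dl r (p ^ s) y \<in> WE" using y r by (auto simp: N_WE Dl_WE)
    show "?\<phi> (x + y) = ?\<phi> x + ?\<phi> y"
      by (rule ext) (simp add: Dl_add act_app plus_fun_apply mul_add_right)
    have 0: "app z \<omega> = 0" if "z \<in> NA" for z
      using that pb_omega by (auto simp: N_eq pb_def Hev_hasp)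
    have a0: "act 0 z = 0" for z by (rule ext) (simp add: act_app zero_fun_apply)
    show "?\<phi> (br x y) = br x (?\<phi> y) - br y (?\<phi> x)"
      using n r xw yw 0[OF x] 0[OF y]
      by (simp add: Dl_br br_act hasp_omega a0) (rule ext, simp add: act_app minus_apply mul_diff_right)
  qed
  finally show ?thesis .
qed

text \<open>The preimage chosen by \<open>inv_into\<close> has the same \<partial>_r as
  \<open>f\<close>, read off from the component of index r'. Since p^s is at least 1, the iterated
  derivatives agree as well.\<close>

lemma Phi_Hf:
  assumes f: "f \<in> Hev" and r: "r \<in> Ev"
  shows "Phi p m n t r s (Hf f) = act (pdk r (p ^ s) f) (Hf \<omega>)"
proof -
  have "Hf f \<in> Hf ` OA" using f Hev_OA by auto
  then have f0: "inv_into OA Hf (Hf f) \<in> OA" "Hf (inv_into OA Hf (Hf f)) = Hf f" (is "Hf ?f0 = _")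
    by (simp_all add: inv_into_into f_inv_into_f)
  have "scaleO (ta r) (pd r ?f0) = scaleO (ta r) (pd r f)"
    using f0(2) Hf_Ev[of "cj r" ?f0] Hf_Ev[of "cj r" f] r by simp
  then have e: "pd r ?f0 = pd r f" by simp
  obtain k where k: "p ^ s = Suc k" using p_gt_3 by (cases "p ^ s") auto
  have "pdk r (p ^ s) ?f0 = pdk r (p ^ s) f"
    unfolding k funpow_Suc_right comp_def using e by simp
  then show ?thesis using f by (simp add: Phi_def N_Hf)
qed

lemma Hf_pdk: "r \<in> Ev \<Longrightarrow> hasp 0 f \<Longrightarrow> Dl r k (Hf f) = Hf (pdk r k f)"
  by (rule ext) (simp add: Dl_def Hf_app hasp_pdk pdk_scale pdk_pd)

text \<open>D_H(x^\<omega>) commutes with all Hamiltonian fields of even functions, so their adjoint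
  action only differentiates the coefficient \<partial>_r^q f; on coefficients \<partial>_r^q is a
  derivation of the Poisson bracket.\<close>

lemma Phi_Dd:
  assumes n: "even n" and r: "r \<in> Ev"
  shows "Phi p m n t r s \<in> Dd (int n - int (p ^ s))"
proof -
  let ?\<phi> = "Phi p m n t r s" and ?q = "p ^ s"
  have rs: "?\<phi> = rs ?\<phi>" by (rule ext) (simp add: Phi_def restr_def)
  have W: "Hf \<omega> \<in> WE" using n by (simp add: Hf_WE hasp_omega)
  have "rs ?\<phi> \<in> Dd (int n - int (p ^ s))"
  proof (rule Dd_restrI)
    fix x assume x: "x \<in> NA"
    then obtain f where f: "f \<in> Hev" and xf: "x = Hf f" by (auto simp: N_eq)
    have hf: "hasp 0 f" using f Hev_hasp by simp
    show "?\<phi> x \<in> WE" using f hf W r by (simp add: xf Phi_Hf act_WE hasp_pdk)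
    have sc: "scaleW c x = Hf (scaleO c f)" for c using hf by (simp add: xf Hf_scale)
    show "?\<phi> (scaleW c x) = scaleW c (?\<phi> x)" for c
      unfolding sc using f r Hev_scale[OF f]
      by (rule_tac ext) (simp add: xf Phi_Hf act_app scaleW_app pdk_scale mul_scale_left)
    show "homo (d + (int n - int ?q) + 1) (?\<phi> x i)" if h: "\<And>j. homo (d + 1) (x j)" for d i
    proof -
      obtain k where k: "?q = Suc k" using p_gt_3 by (cases ?q) auto
      \<comment> \<open>\<open>f\<close> itself may have a constant term of the wrong degree, so
        homogeneity is taken from \<partial>_r f, which is a coefficient of \<open>x\<close> up to
        sign.\<close>
      have "homo (d + 1) (scaleO (ta r) (x (cj r)))" using h by (intro homo_scale)
      moreover have "scaleO (ta r) (x (cj r)) = pd r f" using r hf by (simp add: xf Hf_app)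
      ultimately have "homo (d + 1 - int k) (pdk r k (pd r f))" by (intro homo_pdk) simp
      then have 1: "homo (d + 1 - int k) (pdk r ?q f)" by (simp add: k funpow_swap1)
      have "homo (int n - 1) (Hf \<omega> i)" using n homo_pd[OF homo_omega]
        by (auto simp: Hf_app hasp_omega intro!: homo_scale)
      from homo_mul[OF 1 this] show ?thesis using f r k by (simp add: xf Phi_Hf act_app algebra_simps)
    qed
    fix y assume y: "y \<in> NA"
    then obtain g where g: "g \<in> Hev" and yg: "y = Hf g" by (auto simp: N_eq)
    have hg: "hasp 0 g" using g Hev_hasp by simp
    have ad: "x + y = Hf (f + g)" using hf hg by (simp add: xf yg Hf_add)
    show "?\<phi> (x + y) = ?\<phi> x + ?\<phi> y"
      unfolding ad unfolding xf yg using f g r Hev_add[OF f g]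
      by (intro ext) (simp add: Phi_Hf act_app plus_fun_apply pdk_add mul_add_left)
    have b0: "br (Hf h) (Hf \<omega>) = 0" if "hasp 0 h" for h
      using that n by (simp add: br_Hf hasp_omega pb_omega)
    have a0: "act h 0 = 0" for h by (rule ext) (simp add: act_app zero_fun_apply)
    have "br x (?\<phi> y) - br y (?\<phi> x) = act (pb f (pdk r ?q g)) (Hf \<omega>) - act (pb g (pdk r ?q f)) (Hf \<omega>)"
      using f g hf hg r W by (simp add: xf yg Phi_Hf br_act Hf_WE hasp_pdk b0 a0 flip: pb_def)
    also have "\<dots> = act (pdk r ?q (pb f g)) (Hf \<omega>)"
    proof -
      have "pdk r ?q (pb f g) = pb (pdk r ?q f) g + pb f (pdk r ?q g)"
        using Dl_app[OF r, of s "Hf f" g] Hf_pdk[OF r hf] by (simp add: pb_def)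
      also have "pb (pdk r ?q f) g = - pb g (pdk r ?q f)"
        by (rule pb_anti) (use hf hg r in \<open>auto simp: hasp_pdk\<close>)
      finally show ?thesis
        by (rule_tac ext) (simp add: act_app minus_apply[of "act _ _"] mul_diff_left)
    qed
    also have "\<dots> = ?\<phi> (br x y)"
      using f g hf hg r by (simp add: xf yg br_Hf Phi_Hf pb_Hev)
    finally show "?\<phi> (br x y) = br x (?\<phi> y) - br y (?\<phi> x)" by simp
  qed
  with rs show ?thesis by metis
qed

lemma Dd_subset_neg: "k \<le> - 1 \<Longrightarrow> \<delta> \<in> Dd k \<Longrightarrow> \<delta> \<in> Der_neg p m n t"
  unfolding Der_neg_def by (rule VL.span_base) auto

end

section \<open>Set sums of subspaces of maps\<close>

lemma subspaceL_plus: "VL.subspace A \<Longrightarrow> VL.subspace B \<Longrightarrow> VL.subspace (A + B)"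
proof -
  have "{x + y |x y. x \<in> A \<and> y \<in> B} = A + B" by (auto simp: set_plus_def)
  then show "VL.subspace A \<Longrightarrow> VL.subspace B \<Longrightarrow> VL.subspace (A + B)"
    using VL.subspace_sums[of A B] by simp
qed

lemma subspaceL_sum: "(\<And>i. i \<in> I \<Longrightarrow> VL.subspace (A i)) \<Longrightarrow> VL.subspace (\<Sum>i\<in>I. A i)"
  by (induction I rule: infinite_finite_induct) (auto simp: VL.subspace_0 subspaceL_plus VL.subspace_single_0)

lemma subspaceL_line: "VL.subspace (line \<phi>)"
proof (rule VL.subspaceI)
  show "0 \<in> line \<phi>" unfolding line_def by (auto intro!: exI[of _ 0])
  show "x + y \<in> line \<phi>" if "x \<in> line \<phi>" "y \<in> line \<phi>" for x y
    using that unfolding line_def by (auto simp flip: VL.scale_left_distrib)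
  show "scaleL c x \<in> line \<phi>" if "x \<in> line \<phi>" for c x
    using that unfolding line_def by auto
qed

lemma set_plus_subset: "VL.subspace S \<Longrightarrow> A \<subseteq> S \<Longrightarrow> B \<subseteq> S \<Longrightarrow> A + B \<subseteq> S"
  unfolding set_plus_def using VL.subspace_add by blast

lemma set_sum_subset: "VL.subspace S \<Longrightarrow> (\<And>i. i \<in> I \<Longrightarrow> A i \<subseteq> S) \<Longrightarrow> (\<Sum>i\<in>I. A i) \<subseteq> S"
  by (induction I rule: infinite_finite_induct) (auto simp: VL.subspace_0 dest!: set_plus_subset[THEN subsetD, rotated -1])

lemma line_subset: "VL.subspace S \<Longrightarrow> \<phi> \<in> S \<Longrightarrow> line \<phi> \<subseteq> S"
  by (auto simp: line_def VL.subspace_scale)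

lemma subset_plus_left: "VL.subspace B \<Longrightarrow> A \<subseteq> A + B"
  and subset_plus_right: "VL.subspace B \<Longrightarrow> A \<subseteq> B + A"
  using set_zero_plus2[of B A] VL.subspace_0[of B] by (auto simp: add.commute)

lemma subset_set_sum:
  assumes "finite I" "i \<in> I" "\<And>i. i \<in> I \<Longrightarrow> VL.subspace (A i)"
  shows "A i \<subseteq> (\<Sum>i\<in>I. A i)"
  unfolding sum.remove[OF assms(1,2)] by (rule subset_plus_left, rule subspaceL_sum) (use assms in auto)

context ham
begin

abbreviation xi :: "nat \<Rightarrow> 'a super_poly" where "xi i \<equiv> xm (0(i := Suc 0)) {}"

abbreviation dg :: "(nat \<Rightarrow> nat) \<Rightarrow> nat" where "dg \<alpha> \<equiv> \<Sum>i\<in>Ev. \<alpha> i"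

lemma zero_upd [simp]: "(0 :: nat \<Rightarrow> nat)(j := 0) = 0"
  by (auto simp: fun_eq_iff)

subsection \<open>Generation of the Poisson algebra\<close>

lemma mono_degree_dg: "mono_degree m \<alpha> u = dg \<alpha> + card u"
  by (simp add: mono_degree_def)

lemma pimax_ge_3: "i \<in> Ev \<Longrightarrow> 3 \<le> pimax i"
proof -
  assume i: "i \<in> Ev"
  have "p \<le> p ^ t i" using p_gt_3 t_pos[OF i] by (simp add: self_le_power)
  then show ?thesis using p_gt_3 i by (simp add: pi_max_def)
qed

lemma single_MI: "i \<in> Ev \<Longrightarrow> b \<le> pimax i \<Longrightarrow> 0(i := b) \<in> MI"
  by (simp add: MI_iff)

lemma upd_in_MI: "\<alpha> \<in> MI \<Longrightarrow> c \<le> pimax i \<Longrightarrow> \<alpha>(i := c) \<in> MI"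
  by (simp add: MI_iff)

lemma Ev_card: "2 \<le> card (Ev - {i})"
proof -
  have "card Ev = 2 * m" by (simp add: Y0_def)
  then show ?thesis using m_gt_1 card_Diff1_le[of Ev i] by (cases "i \<in> Ev") auto
qed

lemma other_Ev: "\<exists>j\<in>Ev. j \<noteq> i"
proof -
  have "Ev - {i} \<noteq> {}" using Ev_card[of i] by (metis card.empty not_numeral_le_zero)
  then show ?thesis by auto
qed

text \<open>Since m > 1 there is a second even variable, whose top exponent is at least 3. With
  \<open>b = 0\<close> this says that 0 differs from \<open>pimax\<close>.\<close>

lemma single_ne_pimax: "0(i := b) \<noteq> pimax"
proof
  assume "0(i := b) = pimax"
  moreover obtain j where "j \<in> Ev" "j \<noteq> i" using other_Ev by blast
  ultimately have "pimax j = 0" by (metis fun_upd_other idx_app(1))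
  then show False using pimax_ge_3[OF \<open>j \<in> Ev\<close>] by simp
qed

lemma Od_ne [simp]: "Od \<noteq> {}" "{} \<noteq> Od"
  using card_Od n_gt_3 by (metis card.empty not_less_zero)+

lemma MI_full:
  assumes "\<alpha> \<in> MI" "\<forall>i\<in>Ev. \<not> \<alpha> i < pimax i" shows "\<alpha> = pimax"
proof
  fix i show "\<alpha> i = pimax i"
    using MI_le[OF assms(1), of i] MI_out[OF assms(1), of i] assms(2)
    by (cases "i \<in> Ev") (auto simp: pi_max_def not_less intro: le_antisym)
qed

lemma Hev_ev: "\<alpha> \<in> MI \<Longrightarrow> \<alpha> \<noteq> pimax \<Longrightarrow> xm \<alpha> {} \<in> Hev"
  by (rule Hev_xm) auto

lemma dg_upd: "i \<in> Ev \<Longrightarrow> dg (\<alpha>(i := c)) + \<alpha> i = dg \<alpha> + c"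
  by (rule sum_upd)

lemma dg_single: "i \<in> Ev \<Longrightarrow> dg (0(i := b)) = b"
  using dg_upd[of i 0 b] by simp

lemma dg_ge: "i \<in> Ev \<Longrightarrow> \<alpha> i \<le> dg \<alpha>"
  by (rule member_le_sum) auto

lemma dg_ge2: "i \<in> Ev \<Longrightarrow> j \<in> Ev \<Longrightarrow> i \<noteq> j \<Longrightarrow> \<alpha> i + \<alpha> j \<le> dg \<alpha>"
proof -
  assume a: "i \<in> Ev" "j \<in> Ev" "i \<noteq> j"
  have "(\<Sum>k\<in>{i, j}. \<alpha> k) \<le> dg \<alpha>" using a by (intro sum_mono2) auto
  then show ?thesis using a by simp
qed

lemma oc_empty [simp]: "oc {} u = 1" "oc u {} = 1"
  by (simp_all add: oc_def wedge_sign_inv)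

lemma mul_single:
  assumes j: "j \<in> Ev" and b: "b \<le> pimax j" and \<beta>: "\<beta> \<in> MI" and u: "u \<subseteq> Od"
  shows "xm (0(j := b)) {} \<odot> xm \<beta> u =
    (if \<beta> j + b \<le> pimax j then scaleO (of_nat ((\<beta> j + b) choose b)) (xm (\<beta>(j := \<beta> j + b)) u) else 0)"
proof -
  have s: "0(j := b) + \<beta> = \<beta>(j := \<beta> j + b)" by (auto simp: fun_eq_iff)
  have MI: "\<beta>(j := \<beta> j + b) \<in> MI \<longleftrightarrow> \<beta> j + b \<le> pimax j"
    using \<beta> by (auto simp: MI_iff split: if_splits)
  have "(\<Prod>i\<in>Ev. of_nat (((0(j := b)) i + \<beta> i) choose ((0(j := b)) i)) :: 'a)
      = (\<Prod>i\<in>Ev. if i = j then of_nat ((\<beta> j + b) choose b) else 1)"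
    by (rule prod.cong) (auto simp: add.commute)
  also have "\<dots> = of_nat ((\<beta> j + b) choose b)" using j by simp
  finally have "ec (0(j := b)) \<beta> = (if \<beta> j + b \<le> pimax j then of_nat ((\<beta> j + b) choose b) else 0)"
    unfolding ec_def s MI by simp
  then show ?thesis using assms by (simp add: mul_mono single_MI s)
qed

lemma mul_xi:
  assumes j: "j \<in> Ev" and \<beta>: "\<beta> \<in> MI" and u: "u \<subseteq> Od"
  shows "xi j \<odot> xm \<beta> u =
    (if \<beta> j < pimax j then scaleO (of_nat (Suc (\<beta> j))) (xm (\<beta>(j := Suc (\<beta> j))) u) else 0)"
  using mul_single[OF j _ \<beta> u, of "Suc 0"] pimax_ge_3[OF j] by (simp add: Suc_le_eq)

lemma mul_xi_pred:
  assumes j: "j \<in> Ev" and \<alpha>: "\<alpha> \<in> MI" "0 < \<alpha> j" and u: "u \<subseteq> Od"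
  shows "xi j \<odot> xm (\<alpha>(j := \<alpha> j - 1)) u = scaleO (of_nat (\<alpha> j)) (xm \<alpha> u)"
proof -
  have "\<alpha> j - 1 < pimax j" "Suc (\<alpha> j - 1) = \<alpha> j" using MI_le[OF \<alpha>(1), of j] \<alpha>(2) by auto
  then show ?thesis using mul_xi[OF j upd_MI[OF \<alpha>(1), of j] u] by (simp only: fun_upd_same fun_upd_upd if_True fun_upd_triv)
qed

lemma pb_even_left:
  assumes "\<alpha> \<in> MI"
  shows "pb (xm \<alpha> {}) g = (\<Sum>i\<in>Ev. scaleO (ta i) (pd i (xm \<alpha> {}) \<odot> pd (cj i) g))"
proof -
  have "pb (xm \<alpha> {}) g = (\<Sum>i\<in>Ev. scaleO (ta (cj i)) (pd (cj i) (xm \<alpha> {}) \<odot> pd i g))"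
    using assms by (simp add: pb_eq hasp_xm sum_Y pd_odd_mono)
  also have "\<dots> = (\<Sum>i\<in>Ev. scaleO (ta i) (pd i (xm \<alpha> {}) \<odot> pd (cj i) g))"
    using sum_cj_Ev[of "\<lambda>i. scaleO (ta i) (pd i (xm \<alpha> {}) \<odot> pd (cj i) g)"] by simp
  finally show ?thesis .
qed

lemma pb_single:
  assumes j: "j \<in> Ev" and b: "Suc b \<le> pimax j"
  shows "pb (xm (0(j := Suc b)) {}) g = scaleO (ta j) (xm (0(j := b)) {} \<odot> pd (cj j) g)"
proof -
  have "pb (xm (0(j := Suc b)) {}) g = (\<Sum>i\<in>Ev. if i = j then scaleO (ta j) (xm (0(j := b)) {} \<odot> pd (cj j) g) else 0)"
    unfolding pb_even_left[OF single_MI[OF j b]]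
    by (rule sum.cong) (use j b in \<open>auto simp: pd_even_mono single_MI\<close>)
  then show ?thesis using j by simp
qed

lemma pb_xi: "j \<in> Ev \<Longrightarrow> pb (xi j) g = scaleO (ta j) (pd (cj j) g)"
  using pb_single[of j 0 g] pimax_ge_3[of j] by (simp add: mul_one)

lemma pb_mul_left:
  assumes "hasp 0 f" "hasp 0 h" "hasp 0 g"
  shows "pb (f \<odot> h) g = pb f g \<odot> h + f \<odot> pb h g"
proof -
  have "hasp 0 (f \<odot> h)" using hasp_mul[OF assms(1,2)] by simp
  then have "pb (f \<odot> h) g = - pb g (f \<odot> h)" by (rule pb_anti) (rule assms)
  also have "\<dots> = - (pb g f \<odot> h + f \<odot> pb g h)"
    using app_mul[OF Hf_WE[OF assms(3)] assms(1)] by (simp add: pb_def)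
  also have "\<dots> = pb f g \<odot> h + f \<odot> pb h g"
    using pb_anti[of f g] pb_anti[of h g] assms by (simp add: mul_minus_left mul_minus_right)
  finally show ?thesis .
qed

lemma hasp_xi [simp]: "hasp 0 (xi i)"
  by (rule hasp_xm) simp

text \<open>The basic generation step. For empty \<open>u\<close> the factors have degrees b+1 and
  |\<alpha>|-b+1, both smaller than |\<alpha>| when 2 <= b <= |\<alpha>|-2; the only further concern
  is that the binomial be nonzero mod p.\<close>

lemma pb_shift:
  assumes j: "j \<in> Ev" and \<alpha>: "\<alpha> \<in> MI" and b: "b \<le> \<alpha> j" "Suc b \<le> pimax j"
    and c: "\<alpha> (cj j) < pimax (cj j)" and u: "u \<subseteq> Od"
  shows "pb (xm (0(j := Suc b)) {}) (xm (\<alpha>(j := \<alpha> j - b, cj j := Suc (\<alpha> (cj j)))) u) =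
    scaleO (ta j * of_nat (\<alpha> j choose b)) (xm \<alpha> u)"
proof -
  have MI1: "\<alpha>(j := \<alpha> j - b) \<in> MI" using MI_le[OF \<alpha>, of j] by (intro upd_in_MI \<alpha>) auto
  have "\<alpha>(j := \<alpha> j - b, cj j := Suc (\<alpha> (cj j))) \<in> MI" using c by (intro upd_in_MI MI1) auto
  then have "pd (cj j) (xm (\<alpha>(j := \<alpha> j - b, cj j := Suc (\<alpha> (cj j)))) u) = xm (\<alpha>(j := \<alpha> j - b)) u"
    using j u by (auto simp: pd_even_mono intro!: arg_cong2[where f = xm])
  then show ?thesis
    using j b MI_le[OF \<alpha>, of j] by (simp add: pb_single mul_single[OF j _ MI1 u])
qed

lemma xi_xi:
  assumes "j \<in> Ev" "l \<in> Ev" "j \<noteq> l"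
  shows "xi j \<odot> xi l = xm (0(j := Suc 0, l := Suc 0)) {}"
  using assms pimax_ge_3[of l] pimax_ge_3[of j]
  by (simp add: mul_xi single_MI fun_upd_twist)

text \<open>The bracket with \<open>x\<^sub>j x\<^sub>l'\<close> replaces a factor \<open>x\<^sub>l\<close> by \<open>x\<^sub>j\<close>, and a factor \<open>x\<^sub>j'\<close> by \<open>x\<^sub>l'\<close>.\<close>

lemma pb_swap:
  assumes j: "j \<in> Ev" and l: "l \<in> Ev" "l \<noteq> j" "l \<noteq> cj j" and \<alpha>: "\<alpha> \<in> MI" "0 < \<alpha> j" "\<alpha> l < pimax l"
  shows "\<exists>c. pb (xi j \<odot> xi (cj l)) (xm (\<alpha>(j := \<alpha> j - 1, l := Suc (\<alpha> l))) {}) =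
    scaleO (ta (cj l) * of_nat (\<alpha> j)) (xm \<alpha> {}) +
    (if 0 < \<alpha> (cj j) \<and> \<alpha> (cj l) < pimax (cj l)
     then scaleO c (xm (\<alpha>(j := \<alpha> j - 1, l := Suc (\<alpha> l), cj j := \<alpha> (cj j) - 1, cj l := Suc (\<alpha> (cj l)))) {}) else 0)"
proof -
  let ?\<gamma> = "\<alpha>(j := \<alpha> j - 1, l := Suc (\<alpha> l))"
  have jl: "cj l \<noteq> j" "cj l \<noteq> cj j" "cj j \<noteq> l" "cj l \<noteq> l" using l j by (auto simp: cj_eq)
  have MI0: "\<alpha>(j := \<alpha> j - 1) \<in> MI" by (rule upd_MI[OF \<alpha>(1)])
  have \<gamma>: "?\<gamma> \<in> MI" using \<alpha>(3) by (intro upd_in_MI MI0) simp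
  have "pb (xi j \<odot> xi (cj l)) (xm ?\<gamma> {}) =
      pb (xi j) (xm ?\<gamma> {}) \<odot> xi (cj l) + xi j \<odot> pb (xi (cj l)) (xm ?\<gamma> {})"
    by (rule pb_mul_left) (auto intro: hasp_xm)
  moreover have "xi j \<odot> pb (xi (cj l)) (xm ?\<gamma> {}) = scaleO (ta (cj l) * of_nat (\<alpha> j)) (xm \<alpha> {})"
  proof -
    have "pd l (xm ?\<gamma> {}) = xm (\<alpha>(j := \<alpha> j - 1)) {}"
      using l \<gamma> by (auto simp: pd_even_mono intro!: arg_cong2[where f = xm])
    moreover have "xi j \<odot> xm (\<alpha>(j := \<alpha> j - 1)) {} = scaleO (of_nat (\<alpha> j)) (xm \<alpha> {})"
      by (rule mul_xi_pred[OF j \<alpha>(1,2)]) simp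
    ultimately show ?thesis using l by (simp add: pb_xi mul_scale_right)
  qed
  moreover have "\<exists>c. pb (xi j) (xm ?\<gamma> {}) \<odot> xi (cj l) = (if 0 < \<alpha> (cj j) \<and> \<alpha> (cj l) < pimax (cj l)
     then scaleO c (xm (?\<gamma>(cj j := \<alpha> (cj j) - 1, cj l := Suc (\<alpha> (cj l)))) {}) else 0)"
  proof (cases "0 < \<alpha> (cj j)")
    case True
    have \<gamma>': "?\<gamma>(cj j := \<alpha> (cj j) - 1) \<in> MI"
      using upd_MI[OF \<gamma>, of "cj j"] jl j by simp
    have "pd (cj j) (xm ?\<gamma> {}) = xm (?\<gamma>(cj j := \<alpha> (cj j) - 1)) {}"
      using True j \<gamma> jl by (auto simp: pd_even_mono)
    moreover have "xm (?\<gamma>(cj j := \<alpha> (cj j) - 1)) {} \<odot> xi (cj l) = xi (cj l) \<odot> xm (?\<gamma>(cj j := \<alpha> (cj j) - 1)) {}"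
      by (rule mul_commute_even[of _ 0]) (auto intro: hasp_xm)
    moreover have "cj l \<in> Ev" using l by simp
    note mul_xi[OF this \<gamma>', of "{}"]
    ultimately show ?thesis using True j l jl
      by (auto simp: pb_xi mul_scale_left)
  next
    case False
    then have "pd (cj j) (xm ?\<gamma> {}) = 0" using j \<gamma> jl by (simp add: pd_even_mono)
    then show ?thesis using False j by (simp add: pb_xi)
  qed
  ultimately show ?thesis by (auto simp: add.commute)
qed

lemma oc_sign: "u \<inter> v = {} \<Longrightarrow> oc u v \<noteq> 0"
  by (simp add: oc_def wedge_sign_inv)

lemma mul_odd_mono:
  assumes "\<beta> \<in> MI" "u \<subseteq> Od" "v \<subseteq> Od"
  shows "xm \<beta> u \<odot> xm 0 v = scaleO (oc u v) (xm \<beta> (u \<union> v))"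
    and "xm 0 u \<odot> xm \<beta> v = scaleO (oc u v) (xm \<beta> (u \<union> v))"
  using assms ec_commute[of \<beta> 0] by (simp_all add: mul_mono ec_def)

lemma pb_odd_left:
  assumes "s \<subseteq> Od" "even (card s)"
  shows "pb (xm 0 s) g = (\<Sum>j\<in>s. pd j (xm 0 s) \<odot> pd j g)"
proof -
  have "pb (xm 0 s) g = (\<Sum>j\<in>Od. pd j (xm 0 s) \<odot> pd j g)"
    using assms by (simp add: pb_eq hasp_xm sum_Y pd_even_mono)
  also have "\<dots> = (\<Sum>j\<in>s. pd j (xm 0 s) \<odot> pd j g)"
    by (rule sum.mono_neutral_right) (use assms in \<open>auto simp: pd_odd_mono\<close>)
  finally show ?thesis .
qed

lemma pd_odd_in:
  assumes "\<alpha> \<in> MI" "u \<subseteq> Od" "j \<in> u"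
  shows "\<exists>c. c \<noteq> 0 \<and> pd j (xm \<alpha> u) = scaleO c (xm \<alpha> (u - {j}))"
  using assms by (intro exI[of _ "(- 1) ^ card {k \<in> u. k < j}"]) (auto simp: pd_odd_mono subset_iff)

lemma pb_so:
  assumes \<alpha>: "\<alpha> \<in> MI" and u: "u \<subseteq> Od" and k: "k \<in> u" and j: "j \<in> Od" "j \<notin> u"
  shows "\<exists>c. c \<noteq> 0 \<and> pb (xm 0 {k, j}) (xm \<alpha> (insert j (u - {k}))) = scaleO c (xm \<alpha> u)"
proof -
  let ?v = "insert j (u - {k})"
  have kO: "k \<in> Od" "k \<noteq> j" using u k j by auto
  have v: "?v \<subseteq> Od" "j \<in> ?v" "k \<notin> ?v" "?v - {j} = u - {k}" using u k j by auto
  obtain c1 where c1: "c1 \<noteq> 0" "pd j (xm 0 {k, j}) = scaleO c1 (xm 0 ({k, j} - {j}))"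
    using pd_odd_in[of 0 "{k, j}" j] kO j by auto
  obtain c2 where c2: "c2 \<noteq> 0" "pd j (xm \<alpha> ?v) = scaleO c2 (xm \<alpha> (u - {k}))"
    using pd_odd_in[OF \<alpha> v(1,2)] v(4) by auto
  have kj: "{k, j} - {j} = {k}" using kO by auto
  have 0: "pd k (xm \<alpha> ?v) = 0" using v kO \<alpha> by (simp add: pd_odd_mono)
  have "pb (xm 0 {k, j}) (xm \<alpha> ?v) = scaleO (c1 * c2) (xm 0 {k} \<odot> xm \<alpha> (u - {k}))"
    using kO j 0 by (simp add: pb_odd_left c1 c2 kj mul_scale_left mul_scale_right mult.commute)
  moreover have "xm 0 {k} \<odot> xm \<alpha> (u - {k}) = scaleO (oc {k} (u - {k})) (xm \<alpha> u)"
    using kO u k \<alpha> by (subst mul_odd_mono(2)) (auto simp: insert_absorb)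
  ultimately have "pb (xm 0 {k, j}) (xm \<alpha> ?v) = scaleO (c1 * c2 * oc {k} (u - {k})) (xm \<alpha> u)"
    by (simp only: VO.scale_scale)
  then show ?thesis using c1(1) c2(1) oc_sign[of "{k}" "u - {k}"]
    by (intro exI[of _ "c1 * c2 * oc {k} (u - {k})"]) (simp only: mult_eq_0_iff, blast)
qed

text \<open>Two odd indices are traded for one even one: the second factor has total degree one less
  than the target, and the first is cubic. The odd part of the bracket vanishes because the
  remaining index set avoids both k and l.\<close>

lemma pb_raise_odd:
  assumes \<alpha>: "\<alpha> \<in> MI" and u: "u \<subseteq> Od" "k \<in> u" "l \<in> u" "k \<noteq> l" and i: "i \<in> Ev" "\<alpha> (cj i) < pimax (cj i)"
    and e: "even (card u)"
  shows "\<exists>c. c \<noteq> 0 \<and> pb (xi i \<odot> xm 0 {k, l}) (xm (\<alpha>(cj i := Suc (\<alpha> (cj i)))) (u - {k, l})) = scaleO c (xm \<alpha> u)"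
proof -
  let ?\<gamma> = "\<alpha>(cj i := Suc (\<alpha> (cj i)))" and ?w = "u - {k, l}" and ?s = "xm 0 {k, l}"
  have \<gamma>: "?\<gamma> \<in> MI" using i by (intro upd_in_MI \<alpha>) auto
  have kl: "{k, l} \<subseteq> Od" "card {k, l} = 2" "?w \<subseteq> Od" using u by auto
  have ew: "even (card ?w)" using e u kl finite_sub_Od[OF u(1)] by (simp add: card_Diff_subset)
  have "pb (xi i \<odot> ?s) (xm ?\<gamma> ?w) = pb (xi i) (xm ?\<gamma> ?w) \<odot> ?s + xi i \<odot> pb ?s (xm ?\<gamma> ?w)"
    using kl ew by (intro pb_mul_left hasp_xm) auto
  moreover have "pb ?s (xm ?\<gamma> ?w) = 0"
    using kl \<gamma> by (simp add: pb_odd_left) (auto simp: pd_odd_mono intro!: sum.neutral)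
  moreover have "pd (cj i) (xm ?\<gamma> ?w) = xm \<alpha> ?w"
    using i \<gamma> kl by (simp add: pd_even_mono)
  moreover have "xm \<alpha> ?w \<odot> ?s = scaleO (oc ?w {k, l}) (xm \<alpha> u)"
    using kl \<alpha> u by (subst mul_odd_mono(1)) (auto intro!: arg_cong2[where f = scaleO] arg_cong2[where f = xm])
  moreover have "pb (xi i) (xm ?\<gamma> ?w) \<odot> ?s = scaleO (ta i) (pd (cj i) (xm ?\<gamma> ?w) \<odot> ?s)"
    using i by (simp only: pb_xi mul_scale_left)
  ultimately have "pb (xi i \<odot> ?s) (xm ?\<gamma> ?w) = scaleO (ta i * oc ?w {k, l}) (xm \<alpha> u)"
    by (simp only: mul_0_right VO.scale_scale add_0_right)
  then show ?thesis using oc_sign[of ?w "{k, l}"] by (intro exI[of _ "ta i * oc ?w {k, l}"]) auto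
qed

text \<open>The substitute for \<open>pb_raise_odd\<close> when raising an even exponent is
  impossible: an exponent drops by one while k is exchanged for the absent index j. One Leibniz term
  vanishes because j would occur twice.\<close>

lemma pb_exchange_odd:
  assumes \<alpha>: "\<alpha> \<in> MI" and u: "u \<subseteq> Od" "k \<in> u" and j: "j \<in> Od" "j \<notin> u"
    and i: "i \<in> Ev" "of_nat (\<alpha> i) \<noteq> (0 :: 'a)" and e: "even (card u)"
  shows "\<exists>c. c \<noteq> 0 \<and> pb (xi i \<odot> xm 0 {k, j}) (xm (\<alpha>(i := \<alpha> i - 1)) (insert j (u - {k}))) = scaleO c (xm \<alpha> u)"
proof -
  let ?\<gamma> = "\<alpha>(i := \<alpha> i - 1)" and ?w = "insert j (u - {k})" and ?s = "xm 0 {k, j}"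
  have \<gamma>: "?\<gamma> \<in> MI" by (rule upd_MI[OF \<alpha>])
  have fu: "finite u" using u finite_sub_Od by auto
  have "k \<noteq> j" using u j by auto
  then have kj: "{k, j} \<subseteq> Od" "card {k, j} = 2" "?w \<subseteq> Od" "card ?w = card u"
    using u j card_Suc_Diff1[OF fu u(2)] fu by auto
  have "pb (xi i \<odot> ?s) (xm ?\<gamma> ?w) = pb (xi i) (xm ?\<gamma> ?w) \<odot> ?s + xi i \<odot> pb ?s (xm ?\<gamma> ?w)"
    using kj e by (intro pb_mul_left hasp_xm) auto
  moreover have "pb (xi i) (xm ?\<gamma> ?w) \<odot> ?s = 0"
  proof -
    have "xm \<beta> ?w \<odot> ?s = 0" if "\<beta> \<in> MI" for \<beta>
      using kj that by (subst mul_odd_mono(1)) (auto simp: oc_def)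
    then show ?thesis using i kj \<gamma> upd_MI[OF \<gamma>, of "cj i"] by (simp add: pb_xi mul_scale_left pd_even_mono)
  qed
  moreover obtain c where c: "c \<noteq> 0" "pb ?s (xm ?\<gamma> ?w) = scaleO c (xm ?\<gamma> u)"
    using pb_so[OF \<gamma> u j] by blast
  moreover have "0 < \<alpha> i" using i by (cases "\<alpha> i") auto
  moreover have "xi i \<odot> xm ?\<gamma> u = scaleO (of_nat (\<alpha> i)) (xm \<alpha> u)"
    by (rule mul_xi_pred[OF i(1) \<alpha> \<open>0 < \<alpha> i\<close> u(1)])
  ultimately have "pb (xi i \<odot> ?s) (xm ?\<gamma> ?w) = scaleO (c * of_nat (\<alpha> i)) (xm \<alpha> u)"
    by (simp add: mul_scale_right)
  then show ?thesis using c i by (intro exI[of _ "c * of_nat (\<alpha> i)"]) auto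
qed

text \<open>A case of Lucas' theorem, by induction on c: in the Vandermonde sum only the two outer
  terms survive mod p.\<close>

lemma of_nat_choose_p_power:
  assumes "r < p ^ s"
  shows "(of_nat ((c * p ^ s + r) choose p ^ s) :: 'a) = of_nat c"
proof (induction c)
  case 0
  then show ?case using assms by (simp add: binomial_eq_0)
next
  case (Suc c)
  let ?q = "p ^ s" and ?N = "c * p ^ s + r"
  have q: "?q > 0" using p_gt_3 by simp
  have "(of_nat ((Suc c * ?q + r) choose ?q) :: 'a) = (\<Sum>k\<le>?q. of_nat (?q choose k) * of_nat (?N choose (?q - k)))"
    using vandermonde[of ?q ?N ?q] by (simp add: add.assoc flip: of_nat_mult of_nat_sum)
  also have "\<dots> = (\<Sum>k\<in>{0, ?q}. of_nat (?q choose k) * of_nat (?N choose (?q - k)))"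
    by (rule sum.mono_neutral_right) (auto simp: p_dvd_choose)
  also have "\<dots> = of_nat (Suc c)" using q Suc by simp
  finally show ?case .
qed

lemma of_nat_nz: "0 < c \<Longrightarrow> c < p \<Longrightarrow> (of_nat c :: 'a) \<noteq> 0"
  by (auto simp: of_nat_0_iff dest: dvd_imp_le)

lemma of_nat_pimax: "i \<in> Ev \<Longrightarrow> (of_nat (pimax i) :: 'a) = - 1"
proof -
  assume i: "i \<in> Ev"
  have "(of_nat (Suc (pimax i)) :: 'a) = 0"
    using t_pos[OF i] by (simp only: pimax_Suc[OF i] of_nat_0_iff) simp
  then show ?thesis by (simp add: eq_neg_iff_add_eq_0 add.commute)
qed

lemma choose_two_nz:
  assumes "of_nat a \<noteq> (0 :: 'a)" "of_nat (a - 1) \<noteq> (0 :: 'a)"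
  shows "of_nat (a choose 2) \<noteq> (0 :: 'a)"
proof -
  have "2 * (a choose 2) = a * (a - 1)" by (cases a) (simp_all add: choose_two)
  then have "2 * of_nat (a choose 2) = (of_nat a * of_nat (a - 1) :: 'a)"
    by (metis of_nat_mult of_nat_numeral)
  then show ?thesis using assms by auto
qed

end

text \<open>Abstract form of the kernel of a derivation, so that generation can be argued without
  derivations.\<close>

locale pb_subalgebra = ham p m n t ty
  for p m n t and ty :: "'a::field itself" +
  fixes Z :: "'a super_poly set"
  assumes Z_Hev: "f \<in> Z \<Longrightarrow> f \<in> Hev"
    and Z_add: "f \<in> Z \<Longrightarrow> g \<in> Z \<Longrightarrow> f + g \<in> Z"
    and Z_scale: "f \<in> Z \<Longrightarrow> scaleO c f \<in> Z"
    and Z_pb: "f \<in> Z \<Longrightarrow> g \<in> Z \<Longrightarrow> pb f g \<in> Z"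
begin

lemma Z_cancel: "scaleO c f \<in> Z \<Longrightarrow> c \<noteq> 0 \<Longrightarrow> f \<in> Z"
  using Z_scale[of "scaleO c f" "inverse c"] by simp

lemma Z_shift:
  assumes j: "j \<in> Ev" and \<alpha>: "\<alpha> \<in> MI" and b: "b \<le> \<alpha> j" "Suc b \<le> pimax j"
    and c: "\<alpha> (cj j) < pimax (cj j)" and nz: "of_nat (\<alpha> j choose b) \<noteq> (0 :: 'a)"
    and "xm (0(j := Suc b)) {} \<in> Z" "xm (\<alpha>(j := \<alpha> j - b, cj j := Suc (\<alpha> (cj j)))) {} \<in> Z"
  shows "xm \<alpha> {} \<in> Z"
  using pb_shift[OF j \<alpha> b c, of "{}"] Z_pb[OF assms(7,8)] nz by (auto intro: Z_cancel)

lemma Z_swap: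
  assumes j: "j \<in> Ev" and l: "l \<in> Ev" "l \<noteq> j" "l \<noteq> cj j" and \<alpha>: "\<alpha> \<in> MI" "\<alpha> l < pimax l"
    and nz: "of_nat (\<alpha> j) \<noteq> (0 :: 'a)"
    and "xi j \<odot> xi (cj l) \<in> Z" "xm (\<alpha>(j := \<alpha> j - 1, l := Suc (\<alpha> l))) {} \<in> Z"
    and "0 < \<alpha> (cj j) \<Longrightarrow> \<alpha> (cj l) < pimax (cj l) \<Longrightarrow>
      xm (\<alpha>(j := \<alpha> j - 1, l := Suc (\<alpha> l), cj j := \<alpha> (cj j) - 1, cj l := Suc (\<alpha> (cj l)))) {} \<in> Z"
  shows "xm \<alpha> {} \<in> Z"
proof -
  have "0 < \<alpha> j" using nz by (cases "\<alpha> j") auto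
  with pb_swap[OF j l \<alpha>(1) _ \<alpha>(2)] obtain c where
    c: "pb (xi j \<odot> xi (cj l)) (xm (\<alpha>(j := \<alpha> j - 1, l := Suc (\<alpha> l))) {}) =
    scaleO (ta (cj l) * of_nat (\<alpha> j)) (xm \<alpha> {}) +
    (if 0 < \<alpha> (cj j) \<and> \<alpha> (cj l) < pimax (cj l)
     then scaleO c (xm (\<alpha>(j := \<alpha> j - 1, l := Suc (\<alpha> l), cj j := \<alpha> (cj j) - 1, cj l := Suc (\<alpha> (cj l)))) {}) else 0)"
    (is "?L = ?A + ?B") by blast
  have "?B \<in> Z" using assms(8-10) Z_scale[OF assms(9), of 0] by (auto intro: Z_scale)
  then have "scaleO (- 1) ?B \<in> Z" by (rule Z_scale)
  moreover have "?L \<in> Z" using assms(8,9) by (rule Z_pb)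
  ultimately have "?L + scaleO (- 1) ?B \<in> Z" by (intro Z_add)
  then have "?A \<in> Z" unfolding c by (simp add: VO.scale_minus_left)
  then show ?thesis using nz by (auto intro: Z_cancel)
qed

end

text \<open>The induction hypothesis of the generation argument: everything up to degree D lies in
  \<open>Z\<close>, and the targets have degree D+1. The bound on D puts the cubic monomials x_i x_k
  x_l into \<open>Z\<close>.\<close>

locale pb_generated = pb_subalgebra p m n t ty Z
  for p m n t and ty :: "'a::field itself" and Z +
  fixes D :: nat
  assumes D: "D \<ge> 3"
    and low: "\<alpha> \<in> MI \<Longrightarrow> u \<subseteq> Od \<Longrightarrow> even (card u) \<Longrightarrow> (\<alpha>, u) \<noteq> (pimax, {}) \<Longrightarrow> (\<alpha>, u) \<noteq> (pimax, Od) \<Longrightarrow>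
      dg \<alpha> + card u \<le> D \<Longrightarrow> xm \<alpha> u \<in> Z"
begin

lemma low_ev: "\<alpha> \<in> MI \<Longrightarrow> \<alpha> \<noteq> pimax \<Longrightarrow> dg \<alpha> \<le> D \<Longrightarrow> xm \<alpha> {} \<in> Z"
  by (rule low) auto

lemma xi_s_Z:
  assumes "i \<in> Ev" "k \<in> Od" "l \<in> Od" "k \<noteq> l"
  shows "xi i \<odot> xm 0 {k, l} \<in> Z"
proof -
  have "xi i \<odot> xm 0 {k, l} = xm (0(i := Suc 0)) {k, l}"
    using assms pimax_ge_3[of i] by (simp add: mul_odd_mono(1) single_MI)
  also have "\<dots> \<in> Z"
  proof (rule low)
    show "dg (0(i := Suc 0)) + card {k, l} \<le> D" using assms D by (simp add: dg_single del: fun_upd_apply)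
  qed (use assms single_ne_pimax pimax_ge_3[of i] in \<open>auto intro!: single_MI\<close>)
  finally show ?thesis .
qed

text \<open>Normally \<open>pb_raise_odd\<close> applies. It is blocked only if all even exponents
  are full or the raised monomial would be the excluded one of exponent \<pi>. Then some exponent is
  full, hence -1 mod p, and \<open>pb_exchange_odd\<close> applies with an odd index missing from
  \<open>u\<close>.\<close>

lemma gen_odd:
  assumes \<alpha>: "\<alpha> \<in> MI" and u: "u \<subseteq> Od" "even (card u)" "u \<noteq> {}" and ne: "(\<alpha>, u) \<noteq> (pimax, Od)"
    and deg: "dg \<alpha> + card u = Suc D"
  shows "xm \<alpha> u \<in> Z"
proof -
  have fu: "finite u" using u finite_sub_Od by auto
  obtain k where k: "k \<in> u" using u by auto
  have "u \<noteq> {k}" using u by auto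
  then obtain l where l: "l \<in> u" "k \<noteq> l" using k by auto
  have kl: "k \<in> Od" "l \<in> Od" "card u \<ge> 2" "card (u - {k, l}) = card u - 2"
    using u k l fu card_mono[of u "{k, l}"] by (auto simp: card_Diff_subset)
  show ?thesis
  proof (cases "\<exists>i\<in>Ev. \<alpha> i < pimax i \<and> (\<alpha>(i := Suc (\<alpha> i)), u - {k, l}) \<noteq> (pimax, {})")
    case True
    then obtain i where i: "i \<in> Ev" "\<alpha> i < pimax i" "(\<alpha>(i := Suc (\<alpha> i)), u - {k, l}) \<noteq> (pimax, {})" by blast
    have "xm (\<alpha>(i := Suc (\<alpha> i))) (u - {k, l}) \<in> Z"
    proof (rule low)
      show "\<alpha>(i := Suc (\<alpha> i)) \<in> MI" using i by (intro upd_in_MI \<alpha>) auto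
      show "dg (\<alpha>(i := Suc (\<alpha> i))) + card (u - {k, l}) \<le> D"
        using dg_upd[OF i(1), of \<alpha> "Suc (\<alpha> i)"] deg kl by linarith
    qed (use i u kl in auto)
    moreover have "xi (cj i) \<odot> xm 0 {k, l} \<in> Z" using i kl l by (intro xi_s_Z) auto
    moreover obtain c where "c \<noteq> 0"
      "pb (xi (cj i) \<odot> xm 0 {k, l}) (xm (\<alpha>(i := Suc (\<alpha> i))) (u - {k, l})) = scaleO c (xm \<alpha> u)"
      using pb_raise_odd[OF \<alpha> u(1) k l(1,2), of "cj i"] i u by auto
    ultimately show ?thesis using Z_pb Z_cancel by metis
  next
    case False
    \<comment> \<open>If \<open>u\<close> were all of \<open>Od\<close>, then n > 3 would leave odd
      indices after removing k and l. So only full exponents could block raising, and that is the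
      excluded top monomial.\<close>
    have uO: "u \<noteq> Od"
    proof
      assume "u = Od"
      then have "card (u - {k, l}) \<noteq> 0" using kl n_gt_3 by simp
      then have "u - {k, l} \<noteq> {}" by force
      then have "\<forall>i\<in>Ev. \<not> \<alpha> i < pimax i" using False by auto
      then have "\<alpha> = pimax" by (rule MI_full[OF \<alpha>])
      then show False using ne \<open>u = Od\<close> by simp
    qed
    then obtain j where j: "j \<in> Od" "j \<notin> u" using u by auto
    \<comment> \<open>Either all exponents are full, or raising one of them reaches
      \<open>pimax\<close>; then every other exponent is already full.\<close>
    have "\<exists>i\<in>Ev. \<alpha> i = pimax i"
    proof (cases "\<exists>i'\<in>Ev. \<alpha> i' < pimax i'")
      case True
      then obtain i' where i': "i' \<in> Ev" "\<alpha> i' < pimax i'" by auto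
      then have eq: "\<alpha>(i' := Suc (\<alpha> i')) = pimax" using False by auto
      obtain i where "i \<in> Ev" "i \<noteq> i'" using other_Ev by blast
      then show ?thesis using fun_cong[OF eq, of i] by auto
    next
      case False
      obtain i where "i \<in> Ev" using other_Ev by blast
      then show ?thesis using False MI_le[OF \<alpha>, of i] by (meson le_antisym not_less)
    qed
    then obtain i where i: "i \<in> Ev" "\<alpha> i = pimax i" by blast
    have ai: "\<alpha> i \<ge> 3" using i pimax_ge_3 by simp
    have "xm (\<alpha>(i := \<alpha> i - 1)) (insert j (u - {k})) \<in> Z"
    proof (rule low)
      show "\<alpha>(i := \<alpha> i - 1) \<in> MI" by (rule upd_MI[OF \<alpha>])
      have c: "card (insert j (u - {k})) = card u" using j fu card_Suc_Diff1[OF fu k] by simp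
      show "dg (\<alpha>(i := \<alpha> i - 1)) + card (insert j (u - {k})) \<le> D"
        using dg_upd[OF i(1), of \<alpha> "\<alpha> i - 1"] deg c ai by linarith
      show "even (card (insert j (u - {k})))" using c u by simp
      have "\<alpha>(i := \<alpha> i - 1) \<noteq> pimax" using i ai by (metis diff_less fun_upd_same less_irrefl less_le_trans zero_less_numeral zero_less_one)
      then show "(\<alpha>(i := \<alpha> i - 1), insert j (u - {k})) \<noteq> (pimax, {})"
        "(\<alpha>(i := \<alpha> i - 1), insert j (u - {k})) \<noteq> (pimax, Od)" by auto
    qed (use u j in auto)
    moreover have "xi i \<odot> xm 0 {k, j} \<in> Z" using i kl j k by (intro xi_s_Z) auto
    moreover obtain c where "c \<noteq> 0"
      "pb (xi i \<odot> xm 0 {k, j}) (xm (\<alpha>(i := \<alpha> i - 1)) (insert j (u - {k}))) = scaleO c (xm \<alpha> u)"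
      using pb_exchange_odd[OF \<alpha> u(1) k j i(1) _ u(2)] i of_nat_pimax[of i] by auto
    ultimately show ?thesis using Z_pb Z_cancel by metis
  qed
qed

lemma xi_xi_Z:
  assumes "j \<in> Ev" "l \<in> Ev" "j \<noteq> l"
  shows "xi j \<odot> xi l \<in> Z"
proof -
  have "xi j \<odot> xi l = xm (0(j := Suc 0, l := Suc 0)) {}" using assms by (rule xi_xi)
  also have "\<dots> \<in> Z"
  proof (rule low_ev)
    show "0(j := Suc 0, l := Suc 0) \<in> MI" using assms pimax_ge_3[of j] pimax_ge_3[of l]
      by (auto intro!: upd_in_MI single_MI)
    show "0(j := Suc 0, l := Suc 0) \<noteq> pimax"
    proof
      assume "0(j := Suc 0, l := Suc 0) = pimax"
      then have "pimax l = Suc 0" by (metis fun_upd_same)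
      then show False using pimax_ge_3[OF assms(2)] by simp
    qed
    show "dg (0(j := Suc 0, l := Suc 0)) \<le> D"
      using dg_upd[OF assms(2), of "0(j := Suc 0)" "Suc 0"] dg_single[OF assms(1), of "Suc 0"] D by linarith
  qed
  finally show ?thesis .
qed

lemma gen_shift:
  assumes j: "j \<in> Ev" and \<alpha>: "\<alpha> \<in> MI" and deg: "dg \<alpha> = Suc D"
    and b: "2 \<le> b" "b \<le> \<alpha> j" "Suc b \<le> pimax j" "b + 2 \<le> dg \<alpha>"
    and c: "\<alpha> (cj j) < pimax (cj j)" and nz: "of_nat (\<alpha> j choose b) \<noteq> (0 :: 'a)"
  shows "xm \<alpha> {} \<in> Z"
proof (rule Z_shift[OF j \<alpha> b(2,3) c nz])
  show "xm (0(j := Suc b)) {} \<in> Z"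
    using b deg by (intro low_ev single_MI single_ne_pimax j) (auto simp: dg_single[OF j] simp del: fun_upd_apply)
  have MI1: "\<alpha>(j := \<alpha> j - b) \<in> MI" using MI_le[OF \<alpha>, of j] by (intro upd_in_MI \<alpha>) auto
  show "xm (\<alpha>(j := \<alpha> j - b, cj j := Suc (\<alpha> (cj j)))) {} \<in> Z" (is "xm ?\<gamma> {} \<in> Z")
  proof (rule low_ev)
    show "?\<gamma> \<in> MI" using c by (intro upd_in_MI MI1) auto
    have "?\<gamma> j = \<alpha> j - b" using j by simp
    then have "?\<gamma> j < pimax j" using MI_le[OF \<alpha>, of j] b by linarith
    then show "?\<gamma> \<noteq> pimax" by (metis less_irrefl)
    have "cj j \<in> Ev" "(\<alpha>(j := \<alpha> j - b)) (cj j) = \<alpha> (cj j)" using j by auto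
    then show "dg ?\<gamma> \<le> D"
      using dg_upd[OF j, of \<alpha> "\<alpha> j - b"] dg_upd[of "cj j" "\<alpha>(j := \<alpha> j - b)" "Suc (\<alpha> (cj j))"] b deg
      by linarith
  qed
qed

text \<open>Shift by the whole exponent, b = \<alpha>_j, so that the binomial is 1. If \<alpha>_j is
  full, b+1 is out of range; then b = 2 works, since the exponent is -1 mod p and the binomial is a
  nonzero constant.\<close>

lemma gen_mid:
  assumes j: "j \<in> Ev" and \<alpha>: "\<alpha> \<in> MI" and deg: "dg \<alpha> = Suc D"
    and a: "2 \<le> \<alpha> j" "\<alpha> j + 2 \<le> dg \<alpha>" and c: "\<alpha> (cj j) < pimax (cj j)"
  shows "xm \<alpha> {} \<in> Z"
proof (cases "\<alpha> j < pimax j")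
  case True
  then show ?thesis using gen_shift[OF j \<alpha> deg a(1) _ _ a(2) c] by simp
next
  case False
  then have aj: "\<alpha> j = pimax j" using MI_le[OF \<alpha>, of j] by simp
  have "of_nat (\<alpha> j choose 2) \<noteq> (0 :: 'a)"
  proof (rule choose_two_nz)
    show "of_nat (\<alpha> j) \<noteq> (0 :: 'a)" using aj j by (simp add: of_nat_pimax)
    have "(of_nat (\<alpha> j - 1) :: 'a) = - 2"
      using aj a of_nat_pimax[OF j] by (simp add: of_nat_diff)
    then show "of_nat (\<alpha> j - 1) \<noteq> (0 :: 'a)" using two_nz by simp
  qed
  then show ?thesis using gen_shift[OF j \<alpha> deg, of 2] a aj pimax_ge_3[OF j] c by simp
qed

text \<open>The remaining case is a full exponent at j'. If \<alpha>_j is not full, exchange the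
  roles of j and j'. If both are full, move one factor x_j to some x_l that is not full; this leaves
  each monomial on the right with a non-full exponent in the pair j, j', where
  \<open>gen_mid\<close> applies.\<close>

lemma gen_mid':
  assumes j: "j \<in> Ev" and \<alpha>: "\<alpha> \<in> MI" "\<alpha> \<noteq> pimax" and deg: "dg \<alpha> = Suc D"
    and a: "2 \<le> \<alpha> j" "\<alpha> j + 2 \<le> dg \<alpha>"
  shows "xm \<alpha> {} \<in> Z"
proof (cases "\<alpha> (cj j) < pimax (cj j)")
  case True
  then show ?thesis using gen_mid[OF j \<alpha>(1) deg a] by simp
next
  case False
  have j': "cj j \<in> Ev" "j \<noteq> cj j" using j by auto
  have aj': "\<alpha> (cj j) = pimax (cj j)" using False MI_le[OF \<alpha>(1), of "cj j"] by simp
  have sum: "\<alpha> j + \<alpha> (cj j) \<le> dg \<alpha>" using dg_ge2[OF j j'(1) j'(2)] .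
  show ?thesis
  proof (cases "\<alpha> j < pimax j")
    case True
    then show ?thesis using gen_mid[OF j'(1) \<alpha>(1) deg] a aj' pimax_ge_3[OF j'(1)] sum by simp
  next
    case False
    then have aj: "\<alpha> j = pimax j" using MI_le[OF \<alpha>(1), of j] by simp
    have "\<exists>l\<in>Ev. \<alpha> l < pimax l"
    proof (rule ccontr)
      assume "\<not> ?thesis"
      then have "\<alpha> = pimax" by (intro MI_full[OF \<alpha>(1)]) auto
      then show False using \<alpha> by simp
    qed
    then obtain l where l: "l \<in> Ev" "\<alpha> l < pimax l" by blast
    then have lj: "l \<noteq> j" "l \<noteq> cj j" using aj aj' by auto
    have jl: "cj l \<noteq> j" "cj l \<noteq> cj j" "cj l \<noteq> l" using lj l by (auto simp: cj_eq)
    have p3: "3 \<le> \<alpha> j" "3 \<le> \<alpha> (cj j)" using aj aj' pimax_ge_3 j j' by simp_all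
    let ?\<gamma> = "\<alpha>(j := \<alpha> j - 1, l := Suc (\<alpha> l))"
    have \<gamma>: "?\<gamma> \<in> MI" using l by (intro upd_in_MI upd_MI \<alpha>) auto
    have d\<gamma>: "dg ?\<gamma> = Suc D"
      using dg_upd[OF j, of \<alpha> "\<alpha> j - 1"] dg_upd[OF l(1), of "\<alpha>(j := \<alpha> j - 1)" "Suc (\<alpha> l)"] lj p3 deg by simp
    have g: "?\<gamma> j = \<alpha> j - 1" "?\<gamma> (cj j) = \<alpha> (cj j)" "?\<gamma> (cj l) = \<alpha> (cj l)" using lj jl j j' by auto
    show ?thesis
    proof (rule Z_swap[OF j l(1) lj \<alpha>(1) l(2)])
      show "of_nat (\<alpha> j) \<noteq> (0 :: 'a)" using aj j by (simp add: of_nat_pimax)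
      show "xi j \<odot> xi (cj l) \<in> Z" using j l jl by (intro xi_xi_Z) auto
      show "xm ?\<gamma> {} \<in> Z"
      proof (rule gen_mid[OF j'(1) \<gamma> d\<gamma>])
        show "2 \<le> ?\<gamma> (cj j)" using g p3 by linarith
        have "?\<gamma> j + ?\<gamma> (cj j) \<le> dg ?\<gamma>" by (rule dg_ge2[OF j j'])
        then show "?\<gamma> (cj j) + 2 \<le> dg ?\<gamma>" using g p3 by linarith
        show "?\<gamma> (cj (cj j)) < pimax (cj (cj j))" using g aj p3 by simp
      qed
      assume c: "\<alpha> (cj l) < pimax (cj l)"
      let ?\<beta> = "?\<gamma>(cj j := \<alpha> (cj j) - 1, cj l := Suc (\<alpha> (cj l)))"
      have \<beta>0: "?\<gamma>(cj j := \<alpha> (cj j) - 1) \<in> MI" using upd_MI[OF \<gamma>, of "cj j"] unfolding g(2) .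
      show "xm ?\<beta> {} \<in> Z"
      proof (rule gen_mid[OF j])
        show "?\<beta> \<in> MI" using c by (intro upd_in_MI \<beta>0) auto
        have gl: "(?\<gamma>(cj j := \<alpha> (cj j) - 1)) (cj l) = \<alpha> (cj l)" using g jl by simp
        have l': "cj l \<in> Ev" using l by simp
        show db: "dg ?\<beta> = Suc D"
          using dg_upd[OF j'(1), of ?\<gamma> "\<alpha> (cj j) - 1"]
            dg_upd[OF l', of "?\<gamma>(cj j := \<alpha> (cj j) - 1)" "Suc (\<alpha> (cj l))"] gl g(2) p3 d\<gamma> by linarith
        have b: "?\<beta> j = \<alpha> j - 1" "?\<beta> (cj j) = \<alpha> (cj j) - 1" using lj jl j j' by auto
        show "2 \<le> ?\<beta> j" using b p3 by linarith
        have "?\<beta> j + ?\<beta> (cj j) \<le> dg ?\<beta>" by (rule dg_ge2[OF j j'])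
        then show "?\<beta> j + 2 \<le> dg ?\<beta>" using b p3 by linarith
        show "?\<beta> (cj j) < pimax (cj j)" using b aj' p3 by linarith
      qed
    qed
  qed
qed

text \<open>Moving a factor x_j onto x_l creates an exponent 2, to which \<open>gen_mid\<close>
  applies. Degree at least 4 provides such an l outside the pair j, j'.\<close>

lemma gen_multilinear:
  assumes \<alpha>: "\<alpha> \<in> MI" and deg: "dg \<alpha> = Suc D" and le1: "\<And>i. i \<in> Ev \<Longrightarrow> \<alpha> i \<le> 1"
  shows "xm \<alpha> {} \<in> Z"
proof -
  have three: "\<exists>l\<in>Ev. \<alpha> l = 1 \<and> l \<noteq> j \<and> l \<noteq> k" if "j \<in> Ev" "k \<in> Ev" "j \<noteq> k" for j k
  proof (rule ccontr)
    assume "\<not> ?thesis"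
    then have "\<And>l. l \<in> Ev - {j, k} \<Longrightarrow> \<alpha> l = 0" using le1 by (metis DiffD1 DiffD2 insertCI le_antisym less_one not_le)
    then have "dg \<alpha> = (\<Sum>i\<in>{j, k}. \<alpha> i)" using that by (intro sum.mono_neutral_right) auto
    then have "dg \<alpha> \<le> 2" using that le1[of j] le1[of k] by simp
    then show False using deg D by simp
  qed
  have "\<exists>j\<in>Ev. \<alpha> j = 1"
  proof (rule ccontr)
    assume "\<not> ?thesis"
    then have "\<And>l. l \<in> Ev \<Longrightarrow> \<alpha> l = 0" using le1 by (metis le_antisym less_one not_le)
    then show False using deg by simp
  qed
  then obtain j where j: "j \<in> Ev" "\<alpha> j = 1" by blast
  obtain l where l: "l \<in> Ev" "\<alpha> l = 1" "l \<noteq> j" "l \<noteq> cj j" using three[of j "cj j"] j by auto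
  have jl: "cj l \<noteq> j" "cj l \<noteq> cj j" "cj l \<noteq> l" "cj j \<noteq> j" using l j by (auto simp: cj_eq)
  have lm: "\<alpha> l < pimax l" using l pimax_ge_3[of l] by simp
  have D4: "4 \<le> dg \<alpha>" using deg D by simp
  let ?\<gamma> = "\<alpha>(j := \<alpha> j - 1, l := Suc (\<alpha> l))"
  have \<gamma>: "?\<gamma> \<in> MI" using lm by (intro upd_in_MI upd_MI \<alpha>) auto
  have d\<gamma>: "dg ?\<gamma> = Suc D"
    using dg_upd[OF j(1), of \<alpha> "\<alpha> j - 1"] dg_upd[OF l(1), of "\<alpha>(j := \<alpha> j - 1)" "Suc (\<alpha> l)"] l j deg by simp
  have g: "?\<gamma> l = 2" "?\<gamma> (cj j) = \<alpha> (cj j)" "?\<gamma> (cj l) = \<alpha> (cj l)" using l jl j by auto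
  show ?thesis
  proof (rule Z_swap[OF j(1) l(1) l(3,4) \<alpha> lm])
    show "of_nat (\<alpha> j) \<noteq> (0 :: 'a)" using j by simp
    show "xi j \<odot> xi (cj l) \<in> Z" using j l jl by (intro xi_xi_Z) auto
    show "xm ?\<gamma> {} \<in> Z"
    proof (rule gen_mid[OF l(1) \<gamma> d\<gamma>])
      have "\<alpha> (cj l) \<le> 1" using l by (intro le1) simp
      then show "?\<gamma> (cj l) < pimax (cj l)" using g pimax_ge_3[of "cj l"] l by simp
    qed (use g d\<gamma> deg D4 in linarith)+
    assume c: "0 < \<alpha> (cj j)" "\<alpha> (cj l) < pimax (cj l)"
    let ?\<beta> = "?\<gamma>(cj j := \<alpha> (cj j) - 1, cj l := Suc (\<alpha> (cj l)))"
    have \<beta>0: "?\<gamma>(cj j := \<alpha> (cj j) - 1) \<in> MI" using upd_MI[OF \<gamma>, of "cj j"] unfolding g(2) .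
    show "xm ?\<beta> {} \<in> Z"
    proof (rule gen_mid[OF l(1)])
      show "?\<beta> \<in> MI" using c by (intro upd_in_MI \<beta>0) auto
      have gl: "(?\<gamma>(cj j := \<alpha> (cj j) - 1)) (cj l) = \<alpha> (cj l)" using g jl by simp
      have j'l': "cj l \<in> Ev" "cj j \<in> Ev" using l j by simp_all
      show db: "dg ?\<beta> = Suc D"
        using dg_upd[OF j'l'(2), of ?\<gamma> "\<alpha> (cj j) - 1"]
          dg_upd[OF j'l'(1), of "?\<gamma>(cj j := \<alpha> (cj j) - 1)" "Suc (\<alpha> (cj l))"] gl g(2) c d\<gamma> by linarith
      have b: "?\<beta> l = 2" "?\<beta> (cj l) = Suc (\<alpha> (cj l))" using l jl j by auto
      show "2 \<le> ?\<beta> l" using b by linarith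
      show "?\<beta> l + 2 \<le> dg ?\<beta>" using b db deg D4 by linarith
      have "\<alpha> (cj l) \<le> 1" using l by (intro le1) simp
      then show "?\<beta> (cj l) < pimax (cj l)" using b pimax_ge_3[of "cj l"] l by simp
    qed
  qed
qed

text \<open>The only even monomials of degree at least four that are not brackets of monomials of smaller
  degree are \<open>x\<^sub>j\<^sup>(\<^sup>p\<^sup>^\<^sup>s\<^sup>)\<close> and \<open>x\<^sub>j\<^sup>(\<^sup>p\<^sup>^\<^sup>s\<^sup>) x\<^sub>l\<close>.\<close>

lemma gen_even:
  assumes \<alpha>: "\<alpha> \<in> MI" "\<alpha> \<noteq> pimax" and deg: "dg \<alpha> = Suc D"
    and ex1: "\<And>j s. j \<in> Ev \<Longrightarrow> s \<ge> 1 \<Longrightarrow> \<alpha> j = p ^ s \<Longrightarrow> dg \<alpha> \<le> Suc (\<alpha> j) \<Longrightarrow> False"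
    and ex2: "\<And>j s. j \<in> Ev \<Longrightarrow> s \<ge> 1 \<Longrightarrow> \<alpha> j = Suc (p ^ s) \<Longrightarrow> dg \<alpha> = \<alpha> j \<Longrightarrow> False"
  shows "xm \<alpha> {} \<in> Z"
proof (cases "\<exists>j\<in>Ev. 2 \<le> \<alpha> j")
  case False
  then have "\<alpha> i \<le> 1" if "i \<in> Ev" for i using that by fastforce
  then show ?thesis by (rule gen_multilinear[OF \<alpha>(1) deg])
next
  case True
  then obtain j where j: "j \<in> Ev" "2 \<le> \<alpha> j" by blast
  show ?thesis
  proof (cases "\<alpha> j + 2 \<le> dg \<alpha>")
    case True
    then show ?thesis using gen_mid'[OF j(1) \<alpha> deg j(2)] by simp
  next
    case False
    have j': "cj j \<in> Ev" "j \<noteq> cj j" using j by auto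
    have sum: "\<alpha> j + \<alpha> (cj j) \<le> dg \<alpha>" by (rule dg_ge2[OF j(1) j'])
    have a: "\<alpha> j \<le> dg \<alpha>" "dg \<alpha> \<le> Suc (\<alpha> j)" "\<alpha> (cj j) \<le> 1" "3 \<le> \<alpha> j"
      using False sum deg D by linarith+
    have c: "\<alpha> (cj j) < pimax (cj j)" using a pimax_ge_3[OF j'(1)] by simp
    have pj: "\<alpha> j \<le> pimax j" by (rule MI_le[OF \<alpha>(1)])
    \<comment> \<open>Here at most one factor is not x_j. The shift is b = 2 if \<alpha>_j < p, and
      otherwise b = p^s with p^s the leading power in the base-p expansion of \<alpha>_j: the
      binomial is then the leading digit. The degree bounds for this b fail exactly at the excluded
      monomials.\<close>
    obtain s where s: "p ^ s \<le> \<alpha> j" "\<alpha> j < p ^ (s + 1)"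
      using ex_power_ivl1[of p "\<alpha> j"] p_gt_3 a by auto
    show ?thesis
    proof (cases "s = 0")
      case True
      then have lt: "\<alpha> j < p" using s by simp
      have "of_nat (\<alpha> j choose 2) \<noteq> (0 :: 'a)"
        using lt a by (intro choose_two_nz of_nat_nz) auto
      then show ?thesis using gen_shift[OF j(1) \<alpha>(1) deg, of 2] a deg D pj c by simp
    next
      case False
      then have s1: "s \<ge> 1" by simp
      then have q: "p ^ s \<ge> 4" using p_gt_3 self_le_power[of p s] by linarith
      have "\<alpha> j = (\<alpha> j div p ^ s) * p ^ s + \<alpha> j mod p ^ s" by (rule div_mult_mod_eq[symmetric])
      moreover have "\<alpha> j mod p ^ s < p ^ s" using q by (intro mod_less_divisor) linarith
      ultimately have "(of_nat (\<alpha> j choose p ^ s) :: 'a) = of_nat (\<alpha> j div p ^ s)"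
        using of_nat_choose_p_power by metis
      moreover have "of_nat (\<alpha> j div p ^ s) \<noteq> (0 :: 'a)"
      proof (rule of_nat_nz)
        show "0 < \<alpha> j div p ^ s" using s q p_gt_3 by (simp add: div_greater_zero_iff)
        show "\<alpha> j div p ^ s < p" using s(2) by (intro less_mult_imp_div_less) simp
      qed
      moreover have "p ^ s \<noteq> \<alpha> j" using ex1[OF j(1) s1] a by metis
      moreover have "Suc (p ^ s) \<noteq> \<alpha> j" if "dg \<alpha> = \<alpha> j" using ex2[OF j(1) s1] that by metis
      ultimately show ?thesis using gen_shift[OF j(1) \<alpha>(1) deg, of "p ^ s"] s q a pj c
        by (cases "dg \<alpha> = \<alpha> j") auto
    qed
  qed
qed

end

context ham
begin

subsection \<open>Derivations of negative degree\<close>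

lemma Dr_WE: "\<delta> \<in> Dr \<Longrightarrow> f \<in> Hev \<Longrightarrow> \<delta> (Hf f) \<in> WE"
  by (simp add: Der_def N_Hf)

lemma Dr_out: "\<delta> \<in> Dr \<Longrightarrow> x \<notin> NA \<Longrightarrow> \<delta> x = 0"
  by (simp add: Der_def)

lemma Dr_add: "\<delta> \<in> Dr \<Longrightarrow> f \<in> Hev \<Longrightarrow> g \<in> Hev \<Longrightarrow> \<delta> (Hf (f + g)) = \<delta> (Hf f) + \<delta> (Hf g)"
  by (simp add: Der_def N_Hf Hf_add Hev_hasp)

lemma Dr_scale: "\<delta> \<in> Dr \<Longrightarrow> f \<in> Hev \<Longrightarrow> \<delta> (Hf (scaleO c f)) = scaleW c (\<delta> (Hf f))"
  by (simp add: Der_def N_Hf Hf_scale Hev_hasp)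

lemma Dr_pb: "\<delta> \<in> Dr \<Longrightarrow> f \<in> Hev \<Longrightarrow> g \<in> Hev \<Longrightarrow>
    \<delta> (Hf (pb f g)) = br (Hf f) (\<delta> (Hf g)) - br (Hf g) (\<delta> (Hf f))"
  by (simp add: Der_def N_Hf Hev_hasp flip: br_Hf)

lemma Dd_Dr: "\<delta> \<in> Dd k \<Longrightarrow> \<delta> \<in> Dr"
  by (simp add: Der_deg_def)

lemma Dd_iff: "\<delta> \<in> Dd k \<longleftrightarrow> \<delta> \<in> Dr \<and>
    (\<forall>d. \<forall>x\<in>NA. (\<forall>j. homo (d + 1) (x j)) \<longrightarrow> (\<forall>j. homo (d + k + 1) (\<delta> x j)))"
proof -
  have N: "x \<in> N_deg p m n t d \<longleftrightarrow> x \<in> NA \<and> (\<forall>j. homo (d + 1) (x j))" for x d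
    using N_WE[of x] unfolding N_deg_def by (auto simp: WD_iff WE_iff)
  have W: "\<delta> \<in> Dr \<Longrightarrow> x \<in> NA \<Longrightarrow> \<delta> x \<in> WE" for x
    by (auto simp: N_eq Dr_WE)
  show ?thesis
    unfolding Der_deg_def mem_Collect_eq using W by (auto simp: N WED_iff)
qed

text \<open>The shift by -1 combines two conventions: \<open>Hf\<close> sends degree e to field
  degree e-2, and the coefficients of a field have degree one more than the field.\<close>

lemma Dd_homo:
  assumes "\<delta> \<in> Dd k" "f \<in> Hev" "homo e f"
  shows "homo (e + k - 1) (\<delta> (Hf f) j)"
proof -
  have "homo ((e - 2) + 1) (Hf f j)" for j
    using homo_pd[OF assms(3), of "cj j"] assms(2) by (auto simp: Hf_app Hev_hasp intro!: homo_scale)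
  then have "homo ((e - 2) + k + 1) (\<delta> (Hf f) j)"
    using assms(1) N_Hf[OF assms(2)] unfolding Dd_iff by blast
  then show ?thesis by (rule homo_cong[rotated]) simp
qed

lemma Dd_subspace: "VL.subspace (Dd k)"
proof (rule VL.subspaceI)
  have b0: "br x 0 = 0" if "x \<in> NA" for x
    using that by (intro ext) (simp add: br_app N_WE zero_fun_apply)
  show "0 \<in> Dd k"
    by (auto simp: Dd_iff Der_def zero_fun_apply b0)
  fix \<delta> \<epsilon> assume d: "\<delta> \<in> Dd k" and e: "\<epsilon> \<in> Dd k"
  have W: "\<delta> x \<in> WE" "\<epsilon> x \<in> WE" if "x \<in> NA" for x
    using d e that by (auto simp: Dd_iff Der_def)
  have ba: "br x (y + z) = br x y + br x z" if "x \<in> NA" "y \<in> WE" "z \<in> WE" for x y z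
    using that by (intro ext) (simp add: br_app N_WE WE_add fun_app app_add app_add_left)
  have "\<delta> + \<epsilon> \<in> Dr"
    using d e unfolding Dd_iff Der_def mem_Collect_eq
    by (auto simp: plus_fun_apply[of \<delta> \<epsilon>] WE_add W ba VW.scale_right_distrib)
  then show "\<delta> + \<epsilon> \<in> Dd k"
    using d e unfolding Dd_iff by (auto simp: plus_fun_apply intro: homo_add)
next
  fix c \<delta> assume d: "\<delta> \<in> Dd k"
  have W: "\<delta> x \<in> WE" if "x \<in> NA" for x
    using d that by (auto simp: Dd_iff Der_def)
  have bs: "br x (scaleW c y) = scaleW c (br x y)" if "x \<in> NA" "y \<in> WE" for x y
    using that by (intro ext) (simp add: br_app N_WE WE_scale scaleW_app app_scale app_scale_left VO.scale_right_diff_distrib)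
  have "scaleL c \<delta> \<in> Dr"
    using d unfolding Dd_iff Der_def mem_Collect_eq
    by (auto simp: scaleL_app WE_scale W bs VW.scale_right_distrib VW.scale_right_diff_distrib mult.commute)
  then show "scaleL c \<delta> \<in> Dd k"
    using d unfolding Dd_iff by (auto simp: scaleL_app scaleW_app intro: homo_scale)
qed

text \<open>The kernel is pulled back to polynomials, where generation by brackets has been
  studied.\<close>

definition kern :: "'a vf_map \<Rightarrow> 'a super_poly set" where
  "kern \<delta> = {f \<in> Hev. \<delta> (Hf f) = 0}"

lemma kern_subalgebra:
  assumes d: "\<delta> \<in> Dr" shows "pb_subalgebra p m n t (kern \<delta>)"
proof -
  have b0: "br (Hf f) 0 = 0" if "f \<in> Hev" for f
    using that by (intro ext) (simp add: br_app Hf_WE Hev_hasp zero_fun_apply)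
  show ?thesis
    by unfold_locales (auto simp: kern_def Hev_add Hev_scale pb_Hev Dr_add[OF d] Dr_scale[OF d] Dr_pb[OF d] b0)
qed

text \<open>The progress measure of the proof: a derivation is corrected until this holds for D
  above all occurring degrees.\<close>

definition kills :: "nat \<Rightarrow> 'a vf_map \<Rightarrow> bool" where
  "kills D \<delta> \<longleftrightarrow> (\<forall>\<alpha>\<in>MI. \<forall>u. u \<subseteq> Od \<and> even (card u) \<and> (\<alpha>, u) \<noteq> (pimax, {}) \<and> (\<alpha>, u) \<noteq> (pimax, Od) \<and>
     dg \<alpha> + card u \<le> D \<longrightarrow> \<delta> (Hf (xm \<alpha> u)) = 0)"

lemma killsD:
  "kills D \<delta> \<Longrightarrow> \<alpha> \<in> MI \<Longrightarrow> u \<subseteq> Od \<Longrightarrow> even (card u) \<Longrightarrow> (\<alpha>, u) \<noteq> (pimax, {}) \<Longrightarrow> (\<alpha>, u) \<noteq> (pimax, Od) \<Longrightarrow>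
    dg \<alpha> + card u \<le> D \<Longrightarrow> \<delta> (Hf (xm \<alpha> u)) = 0"
  by (simp add: kills_def)

lemma killsI:
  "(\<And>\<alpha> u. \<alpha> \<in> MI \<Longrightarrow> u \<subseteq> Od \<Longrightarrow> even (card u) \<Longrightarrow> (\<alpha>, u) \<noteq> (pimax, {}) \<Longrightarrow> (\<alpha>, u) \<noteq> (pimax, Od) \<Longrightarrow>
    dg \<alpha> + card u \<le> D \<Longrightarrow> \<delta> (Hf (xm \<alpha> u)) = 0) \<Longrightarrow> kills D \<delta>"
  by (simp add: kills_def)

lemma kills_mono: "kills D \<delta> \<Longrightarrow> D' \<le> D \<Longrightarrow> kills D' \<delta>"
  by (auto simp: kills_def)

lemma kills_SucI:
  assumes "kills D \<delta>"
    and "\<And>\<alpha> u. \<alpha> \<in> MI \<Longrightarrow> u \<subseteq> Od \<Longrightarrow> even (card u) \<Longrightarrow> (\<alpha>, u) \<noteq> (pimax, {}) \<Longrightarrow> (\<alpha>, u) \<noteq> (pimax, Od) \<Longrightarrow>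
      dg \<alpha> + card u = Suc D \<Longrightarrow> \<delta> (Hf (xm \<alpha> u)) = 0"
  shows "kills (Suc D) \<delta>"
  using assms by (auto simp: kills_def le_Suc_eq)

lemma kills_ev: "kills D \<delta> \<Longrightarrow> \<alpha> \<in> MI \<Longrightarrow> \<alpha> \<noteq> pimax \<Longrightarrow> dg \<alpha> \<le> D \<Longrightarrow> \<delta> (Hf (xm \<alpha> {})) = 0"
  by (rule killsD[of D]) auto

lemma kills_generated:
  assumes "\<delta> \<in> Dr" "kills D \<delta>" "D \<ge> 3"
  shows "pb_generated p m n t (kern \<delta>) D"
proof -
  interpret pb_subalgebra p m n t ty "kern \<delta>" by (rule kern_subalgebra[OF assms(1)])
  show ?thesis using assms(2,3)
    by unfold_locales (auto simp: kern_def Hev_xm kills_def)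
qed

lemma homo_neg: "homo d f \<Longrightarrow> d < 0 \<Longrightarrow> f = 0"
  by (rule ext) (force simp: homo_def zero_fun_apply)

lemma homo_mono: "homo (int (dg \<alpha> + card u)) (xm \<alpha> u)"
  by (rule homo_xm) (simp add: mono_degree_dg)

lemma Dd_mono_neg:
  assumes "\<delta> \<in> Dd k" "xm \<alpha> u \<in> Hev" "int (dg \<alpha> + card u) + k - 1 < 0"
  shows "\<delta> (Hf (xm \<alpha> u)) = 0"
proof
  fix j
  from homo_neg[OF Dd_homo[OF assms(1,2) homo_mono] assms(3)]
  show "\<delta> (Hf (xm \<alpha> u)) j = 0 j" by (simp add: zero_fun_apply)
qed

lemma kills_neg: "\<delta> \<in> Dd k \<Longrightarrow> int D + k - 1 < 0 \<Longrightarrow> kills D \<delta>"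
proof (rule killsI, rule Dd_mono_neg, assumption)
  fix \<alpha> u assume a: "dg \<alpha> + card u \<le> D" "int D + k - 1 < 0"
  then show "int (dg \<alpha> + card u) + k - 1 < 0" by linarith
qed (rule Hev_xm)

lemma pb_const [simp]: "pb f (xm 0 {}) = 0"
  by (simp add: pb_def)

lemma xi_Hev: "i \<in> Ev \<Longrightarrow> xi i \<in> Hev"
  using pimax_ge_3[of i] by (intro Hev_ev single_MI single_ne_pimax) auto

lemma kills_xi: "kills 1 \<delta> \<Longrightarrow> i \<in> Ev \<Longrightarrow> \<delta> (Hf (xi i)) = 0"
  using pimax_ge_3[of i] dg_single[of i "Suc 0"]
  by (intro kills_ev[of 1] single_MI single_ne_pimax) auto

lemma pd_xi: "j \<in> Ev \<Longrightarrow> pd i (xi j) = (if i = j then xm 0 {} else 0)"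
  using pimax_ge_3[of j] by (cases "i \<in> Ev") (auto simp: pd_even_mono pd_odd_mono single_MI)

lemma br_0_right: "D \<in> WE \<Longrightarrow> br D 0 = 0"
  by (intro ext) (simp add: br_app zero_fun_apply)

text \<open>Up to sign, \<partial>_i is the bracket with x_i', which the derivation kills.\<close>

lemma Dr_pd:
  assumes d: "\<delta> \<in> Dr" "kills 1 \<delta>" and i: "i \<in> Ev" and f: "f \<in> Hev"
  shows "\<delta> (Hf (pd i f)) j = pd i (\<delta> (Hf f) j)"
proof -
  let ?x = "xi (cj i)" and ?w = "\<delta> (Hf f)"
  have x: "?x \<in> Hev" "cj i \<in> Ev" using i by (auto intro: xi_Hev)
  have w: "?w \<in> WE" using d f by (simp add: Dr_WE)
  have pf: "pb ?x f \<in> Hev" by (rule pb_Hev[OF x(1) f])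
  have P: "pb ?x g = scaleO (ta (cj i)) (pd i g)" for g using pb_xi[OF x(2)] by simp
  have "pd i f = scaleO (ta (cj i)) (pb ?x f)" by (simp add: P)
  then have "\<delta> (Hf (pd i f)) = scaleW (ta (cj i)) (\<delta> (Hf (pb ?x f)))"
    using Dr_scale[OF d(1) pf] by simp
  also have "\<dots> = scaleW (ta (cj i)) (br (Hf ?x) ?w)"
    using Dr_pb[OF d(1) x(1) f] kills_xi[OF d(2) x(2)] f by (simp add: br_0_right Hf_WE Hev_hasp)
  finally have "\<delta> (Hf (pd i f)) j = scaleO (ta (cj i)) (br (Hf ?x) ?w j)" by (simp add: scaleW_app)
  also have "br (Hf ?x) ?w j = scaleO (ta (cj i)) (pd i (?w j))"
    using w by (simp add: br_Hf_left P pd_xi[OF x(2)])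
  finally show ?thesis by simp
qed

text \<open>Membership in the exterior algebra of the odd variables, equivalently annihilation by
  all even \<partial>_i; see \<open>flatI\<close> and \<open>flat_pd\<close>.\<close>

definition flat :: "'a super_poly \<Rightarrow> bool" where
  "flat f \<longleftrightarrow> f \<in> OA \<and> (\<forall>\<beta> v. f (\<beta>, v) \<noteq> 0 \<longrightarrow> \<beta> = 0)"

lemma pd_even_coeff:
  assumes i: "i \<in> Ev" and b: "\<beta> \<in> MI" "v \<subseteq> Od" "0 < \<beta> i"
  shows "pd i f (\<beta>(i := \<beta> i - 1), v) = f (\<beta>, v)"
proof -
  have "mono_partial m i z (\<beta>(i := \<beta> i - 1), v) = (if z = (\<beta>, v) then 1 else 0 :: 'a)" for z
  proof -
    obtain \<alpha> u where z: "z = (\<alpha>, u)" by (cases z)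
    have "\<alpha> = \<beta>" if "0 < \<alpha> i" "\<alpha>(i := \<alpha> i - 1) = \<beta>(i := \<beta> i - 1)"
    proof
      fix k
      show "\<alpha> k = \<beta> k"
        using fun_cong[OF that(2), of k] that(1) b(3) by (cases "k = i") auto
    qed
    then show ?thesis using i b by (auto simp: z mono_partial_def xmono_def zero_fun_apply)
  qed
  then have "pd i f (\<beta>(i := \<beta> i - 1), v) = (\<Sum>z\<in>Bas. if z = (\<beta>, v) then f z else 0)"
    unfolding partial_def sum_fun_app by (intro sum.cong refl) (simp add: scaleO_app)
  then show ?thesis using b by simp
qed

lemma flatI:
  assumes "f \<in> OA" "\<And>i. i \<in> Ev \<Longrightarrow> pd i f = 0" shows "flat f"
proof -
  have "\<beta> = 0" if nz: "f (\<beta>, v) \<noteq> 0" for \<beta> v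
  proof (rule ccontr)
    assume "\<beta> \<noteq> 0"
    then obtain i where i: "0 < \<beta> i" by (auto simp: fun_eq_iff)
    have b: "\<beta> \<in> MI" "v \<subseteq> Od" using assms(1) nz by (auto simp: OA_iff)
    then have "i \<in> Ev" using i MI_out[of \<beta> i] by auto
    then show False using pd_even_coeff[of i \<beta> v f] b i assms(2)[of i] nz by (simp add: zero_fun_apply)
  qed
  with assms(1) show ?thesis by (simp add: flat_def)
qed

lemma flat_expand:
  assumes "flat f"
  shows "f = (\<Sum>v\<in>Pow Od. scaleO (f (0, v)) (xm 0 v))"
proof
  fix z :: "(nat \<Rightarrow> nat) \<times> nat set"
  obtain \<beta> w where z: "z = (\<beta>, w)" by (cases z)
  have "(\<Sum>v\<in>Pow Od. scaleO (f (0, v)) (xm 0 v)) z = (\<Sum>v\<in>Pow Od. if v = w then (if \<beta> = 0 then f (0, v) else 0) else 0)"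
    unfolding sum_fun_app by (intro sum.cong refl) (auto simp: z scaleO_app xmono_def)
  also have "\<dots> = f z"
    using assms unfolding flat_def OA_iff by (auto simp: z)
  finally show "f z = (\<Sum>v\<in>Pow Od. scaleO (f (0, v)) (xm 0 v)) z" by simp
qed

lemma flat_pd: "flat f \<Longrightarrow> i \<in> Ev \<Longrightarrow> pd i f = 0"
  by (subst flat_expand) (auto simp: pd_sum pd_scale pd_even_mono intro!: sum.neutral)

text \<open>An even derivative of the value is the value on a monomial of degree at most D, hence
  zero.\<close>

lemma Dr_flat:
  assumes d: "\<delta> \<in> Dr" "kills D \<delta>" "D \<ge> 1"
    and \<alpha>: "\<alpha> \<in> MI" "u \<subseteq> Od" "even (card u)" "(\<alpha>, u) \<noteq> (pimax, {})" "(\<alpha>, u) \<noteq> (pimax, Od)"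
    and deg: "dg \<alpha> + card u \<le> Suc D"
  shows "flat (\<delta> (Hf (xm \<alpha> u)) j)"
proof (rule flatI)
  have h: "xm \<alpha> u \<in> Hev" using \<alpha> by (rule Hev_xm)
  show "\<delta> (Hf (xm \<alpha> u)) j \<in> OA" using Dr_WE[OF d(1) h] by (simp add: WE_OA)
  fix i assume i: "i \<in> Ev"
  have "\<delta> (Hf (pd i (xm \<alpha> u))) = 0"
  proof (cases "0 < \<alpha> i")
    case True
    have "\<alpha>(i := \<alpha> i - 1) \<noteq> pimax"
      using MI_le[OF \<alpha>(1), of i] True by (metis diff_less fun_upd_same less_numeral_extra(1) not_less)
    then have "\<delta> (Hf (xm (\<alpha>(i := \<alpha> i - 1)) u)) = 0"
      using dg_upd[OF i, of \<alpha> "\<alpha> i - 1"] True deg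
      by (intro killsD[OF d(2) upd_MI] \<alpha>) auto
    then show ?thesis using True i \<alpha> by (simp add: pd_even_mono)
  next
    case False
    then show ?thesis using i \<alpha> Dr_scale[OF d(1) h, of 0] by (simp add: pd_even_mono)
  qed
  then show "pd i (\<delta> (Hf (xm \<alpha> u)) j) = 0"
    using Dr_pd[OF d(1) kills_mono[OF d(2,3)] i h, of j] by (simp add: zero_fun_apply)
qed

lemma mul_one_right: "f \<in> OA \<Longrightarrow> f \<odot> xm 0 {} = f"
proof (induction f rule: OA_induct)
  case (mono \<alpha> u)
  then have "xm \<alpha> u \<odot> xm 0 {} = xm \<alpha> u" by (simp add: mul_odd_mono(1))
  then show ?case .
qed (simp_all add: mul_add_left mul_scale_left)

lemma app_xi:
  assumes "j \<in> Ev" "w j \<in> OA" shows "app w (xi j) = w j"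
proof -
  have "app w (xi j) = (\<Sum>i\<in>Y m n. if i = j then w j \<odot> xm 0 {} else 0)"
    unfolding app_def by (rule sum.cong) (auto simp: pd_xi[OF assms(1)])
  then show ?thesis using assms by (simp add: Y_iff mul_one_right)
qed

abbreviation xo :: "nat \<Rightarrow> 'a super_poly" where "xo k \<equiv> xm 0 {k}"

lemma pd_xo: "k \<in> Od \<Longrightarrow> pd i (xo k) = (if i = k then xm 0 {} else 0)"
proof -
  assume k: "k \<in> Od"
  have "{j \<in> {k}. j < k} = {}" by auto
  then have "pd k (xo k) = xm 0 {}" using k pd_odd_mono[of 0 "{k}" k]
    by (metis Diff_cancel Od_not_Ev VO.scale_one card.empty empty_subsetI insertI1 insert_subset power_0 zero_MI(1))
  then show ?thesis using k by (cases "i \<in> Ev") (auto simp: pd_even_mono pd_odd_mono)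
qed

lemma app_xo:
  assumes "k \<in> Od" "w k \<in> OA" shows "app w (xo k) = w k"
proof -
  have "app w (xo k) = (\<Sum>i\<in>Y m n. if i = k then w k \<odot> xm 0 {} else 0)"
    unfolding app_def by (rule sum.cong) (auto simp: pd_xo[OF assms(1)])
  then show ?thesis using assms by (simp add: Y_iff mul_one_right)
qed

lemma pb_even_flat: "\<alpha> \<in> MI \<Longrightarrow> flat g \<Longrightarrow> pb (xm \<alpha> {}) g = 0"
  by (simp add: pb_even_left flat_pd)

lemma flat_OA: "flat f \<Longrightarrow> f \<in> OA"
  by (simp add: flat_def)

lemma xi_pd:
  assumes "i \<in> Ev" "\<alpha> \<in> MI" "u \<subseteq> Od"
  shows "xi i \<odot> pd i (xm \<alpha> u) = scaleO (of_nat (\<alpha> i)) (xm \<alpha> u)"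
  using mul_xi_pred[OF assms(1,2) _ assms(3)] assms by (simp add: pd_even_mono)

text \<open>The Cartan elements of sp. Monomials are eigenvectors for them, and so are the
  components of fields with flat coefficients.\<close>

abbreviation hi :: "nat \<Rightarrow> 'a super_poly" where "hi i \<equiv> xi i \<odot> xi (cj i)"

lemma hi_mono: "i \<in> Ev \<Longrightarrow> hi i = xm (0(i := Suc 0, cj i := Suc 0)) {}"
  by (rule xi_xi) auto

lemma quad_MI: "i \<in> Ev \<Longrightarrow> j \<in> Ev \<Longrightarrow> 0(i := Suc 0, j := Suc 0) \<in> MI"
  using pimax_ge_3[of i] pimax_ge_3[of j] by (intro upd_in_MI single_MI) auto

lemma quad_ne: "j \<in> Ev \<Longrightarrow> 0(i := Suc 0, j := Suc 0) \<noteq> pimax"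
  using pimax_ge_3[of j] by (metis Suc_n_not_le_n fun_upd_same numeral_3_eq_3 order.strict_iff_not Suc_le_eq le_SucI)

lemma quad_dg: "i \<in> Ev \<Longrightarrow> j \<in> Ev \<Longrightarrow> i \<noteq> j \<Longrightarrow> dg (0(i := Suc 0, j := Suc 0)) = 2"
  using dg_upd[of j "0(i := Suc 0)" "Suc 0"] dg_single[of i "Suc 0"] by simp

lemma hi_Hev: "i \<in> Ev \<Longrightarrow> hi i \<in> Hev"
  by (simp only: hi_mono) (intro Hev_ev quad_MI quad_ne, auto)

lemma kills_hi: "kills 2 \<delta> \<Longrightarrow> i \<in> Ev \<Longrightarrow> \<delta> (Hf (hi i)) = 0"
  by (simp only: hi_mono) (intro kills_ev[of 2] quad_MI quad_ne eq_refl quad_dg, auto)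

lemma pd_hi: "i \<in> Ev \<Longrightarrow> pd j (hi i) = (if j = i then xi (cj i) else if j = cj i then xi i else 0)"
proof (cases "j \<in> Ev")
  case True
  assume i: "i \<in> Ev"
  have "cj i \<in> Ev" using i by simp
  have 1: "xi l \<in> OA" if "l \<in> Ev" for l using xi_Hev[OF that] Hev_OA by blast
  show ?thesis using i True 1[OF i] 1[OF \<open>cj i \<in> Ev\<close>]
    by (auto simp: pd_mul_even pd_xi[OF i] pd_xi[OF \<open>cj i \<in> Ev\<close>] mul_one mul_one_right)
next
  case False
  assume i: "i \<in> Ev"
  then have "pd j (hi i) = 0"
    unfolding hi_mono[OF i] using False by (intro pd_odd_mono[THEN trans] quad_MI) auto
  then show ?thesis using False i by auto
qed

lemma pb_hi:
  assumes i: "i \<in> Ev" and \<alpha>: "\<alpha> \<in> MI" "u \<subseteq> Od" "even (card u)"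
  shows "pb (hi i) (xm \<alpha> u) = scaleO (ta i * (of_nat (\<alpha> (cj i)) - of_nat (\<alpha> i))) (xm \<alpha> u)"
proof -
  let ?f = "xm \<alpha> u"
  have i': "cj i \<in> Ev" using i by simp
  have 1: "pb (hi i) ?f = pb (xi i) ?f \<odot> xi (cj i) + xi i \<odot> pb (xi (cj i)) ?f"
    using \<alpha> by (intro pb_mul_left hasp_xm) auto
  have 2: "pb (xi i) ?f \<odot> xi (cj i) = scaleO (ta i) (xi (cj i) \<odot> pd (cj i) ?f)"
    using mul_commute_even[OF hasp_xi hasp_pd_even[OF hasp_xm i'], of u 0 "cj i" \<alpha>] \<alpha> i
    by (simp add: pb_xi mul_scale_left)
  have 3: "xi i \<odot> pb (xi (cj i)) ?f = scaleO (ta (cj i)) (xi i \<odot> pd i ?f)"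
    using i by (simp add: pb_xi mul_scale_right)
  show ?thesis unfolding 1 2 3
    by (simp add: xi_pd[OF i \<alpha>(1,2)] xi_pd[OF i' \<alpha>(1,2)] ta_cj[OF i] VO.scale_minus_left right_diff_distrib
        VO.scale_left_diff_distrib)
qed

lemma br_hi:
  assumes i: "i \<in> Ev" and w: "w \<in> WE" "\<And>j. flat (w j)"
  shows "br (Hf (hi i)) w j = scaleO (ta i * ((if j = i then 1 else 0) - (if j = cj i then 1 else 0))) (w j)"
proof -
  have "pb (hi i) (w j) = 0"
    using w(2) unfolding hi_mono[OF i] by (intro pb_even_flat quad_MI) (use i in auto)
  moreover have "app w (pd (cj j) (hi i)) = (if j = i then w i else if j = cj i then w (cj i) else 0)"
    using i w by (auto simp: pd_hi app_xi flat_OA cj_eq)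
  ultimately show ?thesis
    using br_Hf_left[OF Hev_hasp[OF hi_Hev[OF i]] w(1)] i
    by (auto simp: ta_cj VO.scale_minus_left)
qed

text \<open>A derivation killing x_i x_i' sends an eigenvector to a field of the same eigenvalue. On
  component j of a flat field the eigenvalue is known, so a mismatch mod p forces that component to
  vanish.\<close>

lemma weight:
  assumes d: "\<delta> \<in> Dr" "kills 2 \<delta>" and i: "i \<in> Ev" and f: "xm \<alpha> u \<in> Hev"
    and \<alpha>: "\<alpha> \<in> MI" "u \<subseteq> Od" "even (card u)" and w: "\<And>j. flat (\<delta> (Hf (xm \<alpha> u)) j)"
    and nz: "of_nat (\<alpha> (cj i)) - of_nat (\<alpha> i) - (if j = i then 1 else 0) + (if j = cj i then 1 else 0) \<noteq> (0 :: 'a)"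
  shows "\<delta> (Hf (xm \<alpha> u)) j = 0"
proof -
  let ?f = "xm \<alpha> u" and ?c = "of_nat (\<alpha> (cj i)) - of_nat (\<alpha> i) :: 'a"
    and ?e = "(if j = i then 1 else 0) - (if j = cj i then 1 else 0) :: 'a"
  have W: "\<delta> (Hf ?f) \<in> WE" by (rule Dr_WE[OF d(1) f])
  have "scaleW (ta i * ?c) (\<delta> (Hf ?f)) = br (Hf (hi i)) (\<delta> (Hf ?f))"
    using Dr_pb[OF d(1) hi_Hev[OF i] f] kills_hi[OF d(2) i]
    by (simp add: pb_hi[OF i \<alpha>] Dr_scale[OF d(1) f] br_0_right Hf_WE Hev_hasp f)
  from fun_cong[OF this, of j] have "scaleO (ta i * ?c) (\<delta> (Hf ?f) j) = scaleO (ta i * ?e) (\<delta> (Hf ?f) j)"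
    by (simp add: scaleW_app br_hi[OF i W w])
  then have "scaleO (ta i * (?c - ?e)) (\<delta> (Hf ?f) j) = 0"
    by (simp add: right_diff_distrib VO.scale_left_diff_distrib)
  moreover have "?c - ?e \<noteq> 0" using nz by (simp add: algebra_simps)
  ultimately show ?thesis by simp
qed

text \<open>One Cartan element giving every even variable a nonzero weight. In degree two the
  individual \<open>hi i\<close> are not yet known to be killed; an inner correction can be fitted
  to this single element, and its weights then suffice.\<close>

definition hh :: "'a super_poly" where "hh = (\<Sum>i\<in>{1..m}. hi i)"

lemma half_Ev: "i \<in> {1..m} \<Longrightarrow> i \<in> Ev"
  by (simp add: Y0_def)

lemma hh_Hev: "hh \<in> Hev"
  unfolding hh_def by (intro Hev_sum hi_Hev half_Ev)

lemma pd_hh: "j \<in> Ev \<Longrightarrow> pd j hh = xi (cj j)" and pd_hh_odd: "j \<notin> Ev \<Longrightarrow> pd j hh = 0"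
proof -
  have e: "pd j hh = (\<Sum>i\<in>{1..m}. if j = i then xi (cj i) else if j = cj i then xi i else 0)"
    unfolding hh_def pd_sum by (intro sum.cong refl pd_hi half_Ev)
  show "pd j hh = xi (cj j)" if j: "j \<in> Ev"
  proof -
    define r where "r = (if j \<le> m then j else cj j)"
    have r: "r \<in> {1..m}" using j by (auto simp: r_def Y0_def conj_idx_def)
    have jr: "j = i \<or> j = cj i \<longleftrightarrow> i = r" if "i \<in> {1..m}" for i
      using that j by (auto simp: r_def Y0_def conj_idx_def)
    have "pd j hh = (\<Sum>i\<in>{1..m}. if i = r then xi (cj j) else 0)"
      unfolding e
    proof (intro sum.cong refl)
      fix i assume "i \<in> {1..m}"
      then show "(if j = i then xi (cj i) else if j = cj i then xi i else 0) = (if i = r then xi (cj j) else 0)"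
        using jr[of i] j by (auto simp: cj_eq)
    qed
    then show ?thesis using r by simp
  qed
  show "pd j hh = 0" if "j \<notin> Ev"
    unfolding e using that half_Ev by (intro sum.neutral) auto
qed

lemma Hf_hh: "Hf hh j = (if j \<in> Ev then scaleO (ta (cj j)) (xi j) else 0)"
  using hh_Hev by (simp add: Hf_app Hev_hasp pd_hh pd_hh_odd)

lemma pb_hh:
  assumes "\<alpha> \<in> MI" "u \<subseteq> Od"
  shows "pb hh (xm \<alpha> u) = scaleO (- (\<Sum>i\<in>Ev. ta i * of_nat (\<alpha> i))) (xm \<alpha> u)"
proof -
  have "pb hh (xm \<alpha> u) = (\<Sum>i\<in>Ev. scaleO (- ta i * of_nat (\<alpha> i)) (xm \<alpha> u))"
    using assms by (simp add: pb_def app_def sum_Y Hf_hh mul_scale_left xi_pd ta_cj mul_minus_left VO.scale_minus_left)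
  then show ?thesis by (simp add: sum_negf flip: VO.scale_sum_left)
qed

lemma app_minus: "app w (- f) = - app w f"
  using app_add[of w "- f" f] by (simp add: eq_neg_iff_add_eq_0)

lemma br_hh:
  assumes w: "w \<in> WE" "\<And>j. flat (w j)"
  shows "br (Hf hh) w j = scaleO (if j \<in> Ev then ta j else 0) (w j)"
proof -
  have "app (Hf hh) (w j) = 0"
    unfolding app_def using w by (intro sum.neutral) (auto simp: Hf_hh flat_pd)
  then show ?thesis
    using w by (simp add: br_app Hf_WE Hev_hasp hh_Hev Hf_hh app_scale app_minus app_xi flat_OA ta_cj VO.scale_minus_left)
qed

text \<open>The eigenvalue comparison of \<open>weight\<close>, assuming only that
  \<open>Hf hh\<close> is killed.\<close>

lemma hweight:
  assumes d: "\<delta> \<in> Dr" "\<delta> (Hf hh) = 0" and f: "xm \<alpha> u \<in> Hev"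
    and \<alpha>: "\<alpha> \<in> MI" "u \<subseteq> Od" and w: "\<And>j. flat (\<delta> (Hf (xm \<alpha> u)) j)"
    and nz: "(if j \<in> Ev then ta j else 0) + (\<Sum>i\<in>Ev. ta i * of_nat (\<alpha> i)) \<noteq> 0"
  shows "\<delta> (Hf (xm \<alpha> u)) j = 0"
proof -
  let ?f = "xm \<alpha> u" and ?c = "\<Sum>i\<in>Ev. ta i * of_nat (\<alpha> i) :: 'a" and ?e = "if j \<in> Ev then ta j else 0"
  have W: "\<delta> (Hf ?f) \<in> WE" by (rule Dr_WE[OF d(1) f])
  have "scaleW (- ?c) (\<delta> (Hf ?f)) = br (Hf hh) (\<delta> (Hf ?f))"
    using Dr_pb[OF d(1) hh_Hev f] d(2) Dr_scale[OF d(1) f, of "- ?c"]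
    by (simp only: pb_hh[OF \<alpha>] br_0_right Hf_WE Hev_hasp f diff_0_right)
  from fun_cong[OF this, of j] have e: "scaleO (- ?c) (\<delta> (Hf ?f) j) = scaleO ?e (\<delta> (Hf ?f) j)"
    by (simp only: scaleW_app br_hh[OF W w])
  have "scaleO (?e + ?c) (\<delta> (Hf ?f) j) = scaleO (- ?c + ?c) (\<delta> (Hf ?f) j)"
    by (simp only: VO.scale_left_distrib e)
  then have "scaleO (?e + ?c) (\<delta> (Hf ?f) j) = 0"
    by (simp only: left_minus VO.scale_zero_left)
  then show ?thesis using nz VO.scale_eq_0_iff by blast
qed

lemma of_int_nz: "c \<noteq> 0 \<Longrightarrow> \<bar>c\<bar> < int p \<Longrightarrow> (of_int c :: 'a) \<noteq> 0"
proof -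
  assume c: "c \<noteq> 0" "\<bar>c\<bar> < int p"
  have "(of_nat (nat \<bar>c\<bar>) :: 'a) \<noteq> 0" using c by (intro of_nat_nz) auto
  moreover have "(of_nat (nat \<bar>c\<bar>) :: 'a) = (if c < 0 then - of_int c else of_int c)" by (auto simp: of_nat_nat)
  ultimately show ?thesis by (auto split: if_splits)
qed

lemma p_ge_5: "p \<ge> 5"
proof -
  have "p \<noteq> 4" using prime_p prime_nat_iff[of 4] by (auto dest: spec[of _ 2])
  then show ?thesis using p_gt_3 by simp
qed

text \<open>Writing \<open>tau\<close> as 1 - 2 \<open>ng\<close> turns a sum of signs into an
  integer of known parity, which makes it easy to see that it is nonzero and smaller than p.\<close>

definition ng :: "nat \<Rightarrow> nat" where "ng i = (if m < i \<and> i \<le> 2 * m then 1 else 0)"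

lemma ta_ng: "ta i = 1 - 2 * of_nat (ng i)"
  by (simp add: tau_def ng_def)

lemma ta_sum: "(\<Sum>i\<in>Ev. ta i * of_nat (\<alpha> i)) = of_int (int (dg \<alpha>) - 2 * int (\<Sum>i\<in>Ev. ng i * \<alpha> i))"
  by (simp add: ta_ng sum_subtractf sum_distrib_left algebra_simps)

lemma ng_sum_le: "(\<Sum>i\<in>Ev. ng i * \<alpha> i) \<le> dg \<alpha>"
  by (rule sum_mono) (simp add: ng_def)

lemma ng_le: "ng i \<le> 1" by (simp add: ng_def)

text \<open>The weight is an odd integer of absolute value at most 3, and p is at least 5. The next
  lemma but one rests on the same count.\<close>

lemma weight_even_nz:
  assumes "dg \<alpha> = 2" shows "ta j + (\<Sum>i\<in>Ev. ta i * of_nat (\<alpha> i)) \<noteq> 0"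
proof -
  define K where "K = ng j + (\<Sum>i\<in>Ev. ng i * \<alpha> i)"
  have "K \<le> 3" unfolding K_def using ng_sum_le[of \<alpha>] ng_le[of j] assms by linarith
  then have "\<bar>3 - 2 * int K\<bar> < int p" using p_ge_5 by linarith
  moreover have "3 - 2 * int K \<noteq> 0" by presburger
  ultimately have "(of_int (3 - 2 * int K) :: 'a) \<noteq> 0" by (intro of_int_nz)
  moreover have "ta j + (\<Sum>i\<in>Ev. ta i * of_nat (\<alpha> i)) = of_int (3 - 2 * int K)"
    unfolding ta_sum assms K_def by (simp add: ta_ng algebra_simps)
  ultimately show ?thesis by simp
qed

lemma weight_odd_nz:
  assumes "dg \<alpha> = 1 \<or> dg \<alpha> = 3" shows "(\<Sum>i\<in>Ev. ta i * of_nat (\<alpha> i)) \<noteq> 0"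
proof -
  let ?K = "\<Sum>i\<in>Ev. ng i * \<alpha> i"
  have "?K \<le> dg \<alpha>" by (rule ng_sum_le)
  then have "\<bar>int (dg \<alpha>) - 2 * int ?K\<bar> < int p" using p_ge_5 assms by linarith
  moreover have "int (dg \<alpha>) - 2 * int ?K \<noteq> 0" using assms by presburger
  ultimately show ?thesis unfolding ta_sum by (intro of_int_nz)
qed

lemma homo_0_const:
  assumes "f \<in> OA" "homo 0 f" shows "f = scaleO (f (0, {})) (xm 0 {})"
proof
  fix z :: "(nat \<Rightarrow> nat) \<times> nat set"
  obtain \<beta> v where z: "z = (\<beta>, v)" by (cases z)
  have "\<beta> = 0 \<and> v = {}" if nz: "f (\<beta>, v) \<noteq> 0"
  proof -
    have b: "\<beta> \<in> MI" "v \<subseteq> Od" using assms nz by (auto simp: OA_iff)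
    have "int (dg \<beta> + card v) = 0" using assms(2) nz unfolding homo_def mono_degree_dg by blast
    then have "dg \<beta> + card v = 0" by (simp only: of_nat_eq_0_iff)
    then have "\<forall>i\<in>Ev. \<beta> i = 0" "v = {}" using b finite_sub_Od by auto
    moreover from this have "\<beta> = 0" using MI_out[OF b(1)] by (auto simp: fun_eq_iff)
    ultimately show ?thesis by simp
  qed
  then show "f z = scaleO (f (0, {})) (xm 0 {}) z" by (auto simp: z scaleO_app xmono_def)
qed

lemma flat_const: "flat (scaleO c (xm 0 {}))"
  unfolding flat_def by (intro conjI OA_scale OA_xm) (auto simp: scaleO_app xmono_def split: if_splits)

lemma homo_0_flat: "f \<in> OA \<Longrightarrow> homo 0 f \<Longrightarrow> flat f"
  using homo_0_const[of f] flat_const by metis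

text \<open>A constant has even parity, whereas the coefficient at an odd index of an even field has
  odd parity.\<close>

lemma WE_homo_0_odd:
  assumes w: "w \<in> WE" "homo 0 (w j)" and j: "j \<notin> Ev" shows "w j = 0"
proof -
  have "w j (0, {}) = 0" using WE_hasp[OF w(1), of j] j unfolding hasp_def by fastforce
  then show ?thesis using homo_0_const[OF WE_OA[OF w(1)] w(2)] by simp
qed

lemma app_odd_mono:
  assumes w: "\<And>j. j \<notin> Ev \<Longrightarrow> w j = 0" and v: "v \<subseteq> Od"
  shows "app w (xm 0 v) = 0"
  unfolding app_def
proof (rule sum.neutral, rule ballI)
  fix i show "w i \<odot> pd i (xm 0 v) = 0" using w v by (cases "i \<in> Ev") (auto simp: pd_even_mono)
qed

lemma br_so_const:
  assumes w: "w \<in> WE" "\<And>j. homo 0 (w j)" and s: "s \<subseteq> Od" "even (card s)"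
  shows "br (Hf (xm 0 s)) w = 0"
proof
  fix i
  have "pb (xm 0 s) (w i) = 0"
    using homo_0_const[OF WE_OA[OF w(1)] w(2)[of i]] by (metis pb_def app_scale pb_const VO.scale_zero_right)
  moreover have "app w (pd (cj i) (xm 0 s)) = 0"
  proof -
    have w0: "w j = 0" if "j \<notin> Ev" for j using WE_homo_0_odd[OF w(1) w(2) that] .
    have "s - {cj i} \<subseteq> Od" using s by auto
    then show ?thesis using app_odd_mono[of w, OF w0] s
      by (cases "cj i \<in> Ev") (auto simp: pd_even_mono pd_odd_mono app_scale)
  qed
  ultimately show "br (Hf (xm 0 s)) w i = 0 i"
    using w s by (simp add: br_Hf_left hasp_xm zero_fun_apply)
qed

lemma odd_pair_Hev: "\<alpha> \<in> MI \<Longrightarrow> s \<subseteq> Od \<Longrightarrow> card s = 2 \<Longrightarrow> xm \<alpha> s \<in> Hev"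
  using n_gt_3 by (intro Hev_xm) auto

text \<open>The monomial is a bracket of x_k x_j with another monomial having two odd indices. The
  values are combinations of even \<partial>_i with constant coefficients, which commute with the
  so-elements. For \<alpha> = 0 both factors are so-elements; otherwise the so-factor is assumed to
  be killed.\<close>

lemma Dr_so:
  assumes d: "\<delta> \<in> Dr" and \<alpha>: "\<alpha> \<in> MI" and u: "u \<subseteq> Od" "card u = 2"
    and w: "\<And>v j. v \<subseteq> Od \<Longrightarrow> card v = 2 \<Longrightarrow> homo 0 (\<delta> (Hf (xm \<alpha> v)) j)"
    and s: "\<And>v. v \<subseteq> Od \<Longrightarrow> card v = 2 \<Longrightarrow> \<delta> (Hf (xm 0 v)) = 0 \<or> (\<alpha> = 0)"
  shows "\<delta> (Hf (xm \<alpha> u)) = 0"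
proof -
  have fu: "finite u" using u finite_sub_Od by auto
  obtain k where k: "k \<in> u" using u by fastforce
  have "u \<noteq> Od" using u n_gt_3 by auto
  then obtain j where j: "j \<in> Od" "j \<notin> u" using u by auto
  let ?v = "insert j (u - {k})"
  have "k \<noteq> j" using k j by auto
  then have v: "?v \<subseteq> Od" "card ?v = 2" "{k, j} \<subseteq> Od" "card {k, j} = 2" "k \<noteq> j"
    using u k j fu card_Suc_Diff1[OF fu k] by auto
  have H: "xm 0 {k, j} \<in> Hev" "xm \<alpha> ?v \<in> Hev" "xm \<alpha> u \<in> Hev"
    using v u \<alpha> by (auto intro: odd_pair_Hev)
  obtain c where c: "c \<noteq> 0" "pb (xm 0 {k, j}) (xm \<alpha> ?v) = scaleO c (xm \<alpha> u)"
    using pb_so[OF \<alpha> u(1) k j] by blast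
  have "br (Hf (xm 0 {k, j})) (\<delta> (Hf (xm \<alpha> ?v))) = 0"
    by (rule br_so_const) (use w v H Dr_WE[OF d] in auto)
  moreover have "br (Hf (xm \<alpha> ?v)) (\<delta> (Hf (xm 0 {k, j}))) = 0"
  proof (cases "\<alpha> = 0")
    case True
    show ?thesis unfolding True by (rule br_so_const) (use w v H Dr_WE[OF d] True in auto)
  next
    case False
    then show ?thesis using s[OF v(3,4)] H by (simp add: br_0_right Hf_WE Hev_hasp)
  qed
  ultimately have "scaleW c (\<delta> (Hf (xm \<alpha> u))) = 0"
    using Dr_pb[OF d H(1,2)] Dr_scale[OF d H(3), of c] c by simp
  then show ?thesis using c by simp
qed

lemma card_even_le_3: "even (card u) \<Longrightarrow> card u \<le> 3 \<Longrightarrow> u \<subseteq> Od \<Longrightarrow> u = {} \<or> card u = 2"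
proof -
  assume a: "even (card u)" "card u \<le> 3" "u \<subseteq> Od"
  then have "card u = 0 \<or> card u = 2" by presburger
  then show ?thesis using finite_sub_Od[OF a(3)] by auto
qed

lemma dg_0: "\<alpha> \<in> MI \<Longrightarrow> dg \<alpha> = 0 \<Longrightarrow> \<alpha> = 0"
  using MI_out by (auto simp: fun_eq_iff)

lemma dg_hh: "homo 2 hh"
  unfolding hh_def
proof (rule homo_sum)
  fix i assume "i \<in> {1..m}"
  then have i: "i \<in> Ev" by (rule half_Ev)
  show "homo 2 (hi i)" unfolding hi_mono[OF i]
    using quad_dg[of i "cj i"] i by (intro homo_xm) (simp add: mono_degree_dg del: fun_upd_apply)
qed

text \<open>For k <= -2 all values in question have negative degree. For k = -1 the values on
  quadratic monomials are constant fields: correct by ad E so that \<open>hh\<close> is killed, then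
  eliminate the even quadratic monomials by weights and the odd ones by
  \<open>Dr_so\<close>.\<close>

lemma stage_2:
  assumes d: "\<delta> \<in> Dd k" "k \<le> - 1"
  shows "\<exists>E\<in>W_even_deg p m n t (- 1). rs (br E) \<in> Dd k \<and> kills 2 (\<delta> - rs (br E))"
proof (cases "k = - 1")
  case False
  have "br 0 x = 0" if "x \<in> NA" for x
    using that by (intro ext) (simp add: br_app N_WE zero_fun_apply)
  then have "rs (br 0) = 0" by (auto simp: restr_def fun_eq_iff[of "\<lambda>x. if _ then _ else _"] zero_fun_apply)
  moreover have "kills 2 \<delta>" using False d by (intro kills_neg[of \<delta> k]) auto
  moreover have "homo 0 ((0 :: 'a super_vf) i)" for i by (simp add: zero_fun_apply)
  then have "(0 :: 'a super_vf) \<in> W_even_deg p m n t (- 1)" by (simp add: WED_iff)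
  ultimately show ?thesis using VL.subspace_0[OF Dd_subspace[of k]]
    by (intro bexI[of _ 0]) simp_all
next
  case True
  let ?w = "\<delta> (Hf hh)"
  have Dr: "\<delta> \<in> Dr" using d Dd_Dr by blast
  have W: "?w \<in> WE" by (rule Dr_WE[OF Dr hh_Hev])
  have w0: "homo 0 (?w j)" for j using Dd_homo[OF d(1) hh_Hev dg_hh, of j] True by simp
  have wo: "?w j = 0" if "j \<notin> Ev" for j by (rule WE_homo_0_odd[OF W w0 that])
  \<comment> \<open>On the even \<partial>_j the element \<open>Hf hh\<close> acts with eigenvalue
    \<open>ta j\<close>, whose square is 1. This choice thus gives [E, D_H(hh)] =
    \<delta>(D_H(hh)).\<close>
  define E where "E = (\<lambda>j. scaleO (- ta j) (?w j))"
  have EW: "E \<in> WE"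
    by (rule WE_I) (simp_all add: E_def WE_OA[OF W] WE_out[OF W] hasp_scale WE_hasp[OF W] del: VO.scale_minus_left)
  have E0: "homo 0 (E j)" for j unfolding E_def by (intro homo_scale w0)
  have Ed: "E \<in> W_even_deg p m n t (- 1)" using EW E0 by (simp add: WED_iff)
  have Ef: "flat (E j)" for j using EW E0 by (intro homo_0_flat) (auto simp: WE_OA)
  let ?\<rho> = "rs (br E)"
  have \<rho>: "?\<rho> \<in> Dd k" using ad_Dd[OF Ed] True by simp
  let ?\<delta> = "\<delta> - ?\<rho>"
  have \<delta>: "?\<delta> \<in> Dd k" by (rule VL.subspace_diff[OF Dd_subspace d(1) \<rho>])
  then have \<delta>r: "?\<delta> \<in> Dr" by (rule Dd_Dr)
  have hW: "Hf hh \<in> WE" by (simp add: Hf_WE Hev_hasp hh_Hev)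
  have h0: "?\<delta> (Hf hh) = 0"
  proof
    fix j
    have "br E (Hf hh) j = - br (Hf hh) E j" by (simp add: br_app[OF EW hW] br_app[OF hW EW])
    also have "br (Hf hh) E j = - ?w j"
      unfolding br_hh[OF EW Ef] using wo by (simp add: E_def)
    finally show "?\<delta> (Hf hh) j = 0 j"
      by (simp add: minus_apply[of \<delta>] minus_apply[of "\<delta> _"] N_Hf hh_Hev zero_fun_apply)
  qed
  have k1: "kills 1 ?\<delta>" using True by (intro kills_neg[OF \<delta>]) simp
  have "kills (Suc 1) ?\<delta>"
  proof (rule kills_SucI[OF k1])
    fix \<alpha> u assume a: "\<alpha> \<in> MI" "u \<subseteq> Od" "even (card u)" "(\<alpha>, u) \<noteq> (pimax, {})" "(\<alpha>, u) \<noteq> (pimax, Od)"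
      "dg \<alpha> + card u = Suc 1"
    then have f: "xm \<alpha> u \<in> Hev" by (intro Hev_xm)
    have fl: "homo 0 (?\<delta> (Hf (xm \<alpha> u)) j)" if "xm \<alpha> u \<in> Hev" "dg \<alpha> + card u = 2" for \<alpha> u j
      using Dd_homo[OF \<delta> that(1) homo_mono, of j] that(2) True by simp
    have "u = {} \<or> card u = 2" using a by (intro card_even_le_3) auto
    then show "?\<delta> (Hf (xm \<alpha> u)) = 0"
    proof
      assume u: "u = {}"
      have dg: "dg \<alpha> = 2" using a u by simp
      show ?thesis
      proof
        fix j
        have hj: "homo 0 (?\<delta> (Hf (xm \<alpha> u)) j)" for j using fl[OF f] a by simp
        have "?\<delta> (Hf (xm \<alpha> u)) j = 0"
        proof (cases "j \<in> Ev")
          case True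
          show ?thesis
          proof (rule hweight[OF \<delta>r h0 f a(1,2)])
            show "flat (?\<delta> (Hf (xm \<alpha> u)) j)" for j using Dr_WE[OF \<delta>r f] hj by (intro homo_0_flat) (auto simp: WE_OA)
            show "(if j \<in> Ev then ta j else 0) + (\<Sum>i\<in>Ev. ta i * of_nat (\<alpha> i)) \<noteq> 0"
              using weight_even_nz[OF dg, of j] True by simp
          qed
        next
          case False
          show ?thesis by (rule WE_homo_0_odd[OF Dr_WE[OF \<delta>r f] hj False])
        qed
        then show "?\<delta> (Hf (xm \<alpha> u)) j = 0 j" by (simp add: zero_fun_apply)
      qed
    next
      assume u: "card u = 2"
      then have "\<alpha> = 0" using a by (intro dg_0) auto
      with u a show ?thesis by (intro Dr_so[OF \<delta>r]) (auto intro!: fl odd_pair_Hev)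
    qed
  qed
  then show ?thesis using Ed \<rho> by (intro bexI[of _ E]) (auto simp: numeral_2_eq_2)
qed

lemma dg_single_eq:
  assumes "\<alpha> \<in> MI" "i \<in> Ev" "dg \<alpha> \<le> \<alpha> i" shows "\<alpha> = 0(i := \<alpha> i)"
proof
  fix l
  have "\<alpha> l = 0" if "l \<noteq> i"
    using dg_ge2[of i l \<alpha>] assms that MI_out[OF assms(1), of l] by (cases "l \<in> Ev") auto
  then show "\<alpha> l = (0(i := \<alpha> i)) l" by simp
qed

lemma dg_other:
  assumes "\<alpha> i < dg \<alpha>" shows "\<exists>l\<in>Ev. l \<noteq> i \<and> 0 < \<alpha> l"
proof (rule ccontr)
  assume "\<not> ?thesis"
  then have "\<forall>l\<in>Ev - {i}. \<alpha> l = 0" by auto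
  then have "dg \<alpha> \<le> \<alpha> i"
    by (cases "i \<in> Ev") (auto simp: sum.remove[of Ev i] intro!: sum.neutral)
  then show False using assms by simp
qed

end

section \<open>Cubic monomials as brackets with quadratic ones\<close>

context pb_subalgebra
begin

text \<open>From the pure power x_i^(a+1) one factor x_i is turned into x_l by a quadratic bracket:
  with x_l^(2) if i = l', and with x_l x_i' otherwise.\<close>

lemma Z_raise:
  assumes quad: "\<And>j l. j \<in> Ev \<Longrightarrow> l \<in> Ev \<Longrightarrow> j \<noteq> l \<Longrightarrow> xi j \<odot> xi l \<in> Z"
    and sq: "\<And>l. l \<in> Ev \<Longrightarrow> xm (0(l := 2)) {} \<in> Z"
    and i: "i \<in> Ev" "2 \<le> \<alpha> i" "\<alpha> i < pimax i" and \<alpha>: "\<alpha> \<in> MI" "dg \<alpha> = Suc (\<alpha> i)"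
    and Z: "xm (0(i := Suc (\<alpha> i))) {} \<in> Z"
  shows "xm \<alpha> {} \<in> Z"
proof -
  obtain l where l: "l \<in> Ev" "l \<noteq> i" "0 < \<alpha> l" using dg_other[of \<alpha> i] \<alpha> by auto
  have al: "\<alpha> l = 1" using dg_ge2[of i l \<alpha>] l i \<alpha> by auto
  let ?\<gamma> = "\<alpha>(l := \<alpha> l - 1, i := Suc (\<alpha> i))"
  have \<gamma>: "?\<gamma> \<in> MI" using i by (intro upd_in_MI upd_MI \<alpha>) auto
  have d\<gamma>: "dg ?\<gamma> = Suc (\<alpha> i)"
    using dg_upd[OF l(1), of \<alpha> "\<alpha> l - 1"] dg_upd[OF i(1), of "\<alpha>(l := \<alpha> l - 1)" "Suc (\<alpha> i)"] l al \<alpha> by simp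
  have "dg ?\<gamma> \<le> ?\<gamma> i" unfolding d\<gamma> by simp
  from dg_single_eq[OF \<gamma> i(1) this] have "?\<gamma> = 0(i := Suc (\<alpha> i))" by (simp only: fun_upd_same)
  then have \<gamma>Z: "xm ?\<gamma> {} \<in> Z" using Z by (simp only:)
  show ?thesis
  proof (cases "i = cj l")
    case True
    show ?thesis
    proof (rule Z_shift[OF l(1) \<alpha>(1), of 1])
      show "xm (0(l := Suc 1)) {} \<in> Z" using sq[OF l(1)] by (simp add: numeral_2_eq_2)
      show "xm (\<alpha>(l := \<alpha> l - 1, cj l := Suc (\<alpha> (cj l)))) {} \<in> Z" using \<gamma>Z unfolding True by simp
    qed (use al i True pimax_ge_3[OF l(1)] in auto)
  next
    case False
    have cl: "cj l \<in> Ev" "cj l \<noteq> l" "cj l \<noteq> i" using l False by auto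
    have "(\<Sum>x\<in>{l, cj l, i}. \<alpha> x) \<le> dg \<alpha>" using cl l i by (intro sum_mono2) auto
    then have "\<alpha> (cj l) = 0" using cl l al \<alpha> by auto
    then show ?thesis
      using False al i \<gamma>Z l cl by (intro Z_swap[OF l(1) i(1) _ _ \<alpha>(1)]) (auto intro!: quad simp: cj_eq)
  qed
qed

text \<open>Quadratic brackets lead from the cubes x_i^(3) to exponents 2+1 by
  \<open>Z_raise\<close>, and from those to multilinear monomials by moving a single factor.\<close>

lemma cubic:
  assumes low2: "\<And>\<alpha>. \<alpha> \<in> MI \<Longrightarrow> dg \<alpha> \<le> 2 \<Longrightarrow> xm \<alpha> {} \<in> Z"
    and cube: "\<And>i. i \<in> Ev \<Longrightarrow> xm (0(i := 3)) {} \<in> Z"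
    and \<alpha>: "\<alpha> \<in> MI" "dg \<alpha> = 3"
  shows "xm \<alpha> {} \<in> Z"
proof -
  have quad: "xi j \<odot> xi l \<in> Z" if "j \<in> Ev" "l \<in> Ev" "j \<noteq> l" for j l
    unfolding xi_xi[OF that] using quad_dg[OF that] that by (intro low2 quad_MI) auto
  have three: "xm \<alpha> {} \<in> Z" if "\<alpha> \<in> MI" "dg \<alpha> = 3" "i \<in> Ev" "\<alpha> i = 3" for \<alpha> i
    using dg_single_eq[of \<alpha> i] cube[of i] that by simp
  have sq: "xm (0(l := 2)) {} \<in> Z" if "l \<in> Ev" for l
    using that pimax_ge_3[OF that] by (intro low2 single_MI) (auto simp: dg_single simp del: fun_upd_apply)
  have two: "xm \<alpha> {} \<in> Z" if a: "\<alpha> \<in> MI" "dg \<alpha> = 3" "i \<in> Ev" "\<alpha> i = 2" for \<alpha> i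
  proof (rule Z_raise[OF quad sq a(3) _ _ a(1)])
    have "Suc (\<alpha> i) = 3" using a by simp
    then show "dg \<alpha> = Suc (\<alpha> i)" "xm (0(i := Suc (\<alpha> i))) {} \<in> Z" using a(2) cube[OF a(3)] by (simp_all only:)
    show "2 \<le> \<alpha> i" "\<alpha> i < pimax i" using a pimax_ge_3[OF a(3)] by simp_all
  qed
  show ?thesis
  proof (cases "\<exists>i\<in>Ev. 2 \<le> \<alpha> i")
    case True
    then obtain i where i: "i \<in> Ev" "2 \<le> \<alpha> i" by blast
    then have "\<alpha> i = 2 \<or> \<alpha> i = 3" using dg_ge[OF i(1), of \<alpha>] \<alpha> by auto
    then show ?thesis using two three \<alpha> i by blast
  next
    case False
    then have le1: "\<alpha> i \<le> 1" if "i \<in> Ev" for i using that by fastforce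
    \<comment> \<open>Degree 3 is odd, so a multilinear monomial cannot be a union of conjugate
      pairs. Choosing c without its partner makes the correction term of \<open>Z_swap\<close>
      disappear.\<close>
    have "\<exists>c\<in>Ev. \<alpha> c = 1 \<and> \<alpha> (cj c) = 0"
    proof (rule ccontr)
      assume no: "\<not> ?thesis"
      have pair: "\<alpha> (cj c) = 1" if "c \<in> Ev" "\<alpha> c = 1" for c
        using no that le1[of "cj c"] by (metis cj_Ev le_antisym less_one not_le)
      obtain a where a: "a \<in> Ev" "0 < \<alpha> a" using dg_other[of \<alpha> 0] \<alpha> MI_out[OF \<alpha>(1), of 0] by (auto simp: Y0_def)
      then have a1: "\<alpha> a = 1" using le1[of a] by simp
      have "\<not> (\<forall>l\<in>Ev - {a, cj a}. \<alpha> l = 0)"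
      proof
        assume "\<forall>l\<in>Ev - {a, cj a}. \<alpha> l = 0"
        then have "dg \<alpha> = (\<Sum>x\<in>{a, cj a}. \<alpha> x)" using a by (intro sum.mono_neutral_right) auto
        then show False using \<alpha> a a1 pair[OF a(1) a1] by simp
      qed
      then obtain b where b: "b \<in> Ev" "b \<noteq> a" "b \<noteq> cj a" "0 < \<alpha> b" by auto
      then have b1: "\<alpha> b = 1" using le1[of b] by simp
      have "cj b \<noteq> a" "cj b \<noteq> cj a" "cj b \<noteq> b" "cj a \<noteq> a" using b a by (auto simp: cj_eq)
      then have "(\<Sum>x\<in>{a, cj a, b, cj b}. \<alpha> x) = 4" using a1 b1 pair[OF a(1) a1] pair[OF b(1) b1] b by auto
      moreover have "(\<Sum>x\<in>{a, cj a, b, cj b}. \<alpha> x) \<le> dg \<alpha>" using a b by (intro sum_mono2) auto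
      ultimately show False using \<alpha> by simp
    qed
    then obtain c where c: "c \<in> Ev" "\<alpha> c = 1" "\<alpha> (cj c) = 0" by blast
    obtain b where b: "b \<in> Ev" "b \<noteq> c" "0 < \<alpha> b" using dg_other[of \<alpha> c] c \<alpha> by auto
    then have b1: "\<alpha> b = 1" and bc: "b \<noteq> cj c" using le1[of b] c by auto
    have bp: "\<alpha> b < pimax b" using b1 pimax_ge_3[OF b(1)] by simp
    let ?\<gamma> = "\<alpha>(c := \<alpha> c - 1, b := Suc (\<alpha> b))"
    have \<gamma>: "?\<gamma> \<in> MI" using bp by (intro upd_in_MI upd_MI \<alpha>) auto
    have d\<gamma>: "dg ?\<gamma> = 3"
      using dg_upd[OF c(1), of \<alpha> "\<alpha> c - 1"] dg_upd[OF b(1), of "\<alpha>(c := \<alpha> c - 1)" "Suc (\<alpha> b)"] b b1 c \<alpha> by simp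
    have "?\<gamma> b = 2" using b1 by simp
    then have "xm ?\<gamma> {} \<in> Z" by (rule two[OF \<gamma> d\<gamma> b(1)])
    then show ?thesis
      using c b bc bp by (intro Z_swap[OF c(1) b(1) _ bc \<alpha>(1) bp]) (auto intro!: quad simp: cj_eq)
  qed
qed

end

context ham
begin

lemma kills_hh: "\<delta> \<in> Dr \<Longrightarrow> kills 2 \<delta> \<Longrightarrow> \<delta> (Hf hh) = 0"
proof -
  assume d: "\<delta> \<in> Dr" "kills 2 \<delta>"
  interpret pb_subalgebra p m n t ty "kern \<delta>" by (rule kern_subalgebra[OF d(1)])
  have z: "0 \<in> kern \<delta>" using Z_scale[of "hi 1" 0] kills_hi[OF d(2), of 1] hi_Hev[of 1] m_gt_1
    by (auto simp: kern_def Y0_def)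
  have hk: "hi i \<in> kern \<delta>" if "i \<in> Ev" for i using that by (simp add: kern_def hi_Hev kills_hi[OF d(2)])
  have "(\<Sum>i\<in>A. hi i) \<in> kern \<delta>" if "A \<subseteq> Ev" for A using that
    by (induction A rule: infinite_finite_induct) (simp_all only: sum.infinite sum.empty sum.insert z Z_add hk insert_subset simp_thms)
  then show ?thesis unfolding hh_def using half_Ev by (auto simp: kern_def subset_iff)
qed

text \<open>For k <= -3 the degree is negative. For k = -1 the values are flat of degree 1, hence
  odd: parity kills the even components and the \<open>hh\<close>-weight the odd ones. For k = -2
  the values are constant fields: weights treat the cubes, \<open>cubic\<close> the other even
  monomials, and \<open>Dr_so\<close> those with odd indices.\<close>

lemma stage_3:
  assumes d: "\<delta> \<in> Dd k" "k \<le> - 1" and k2: "kills 2 \<delta>"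
  shows "kills 3 \<delta>"
proof -
  have Dr: "\<delta> \<in> Dr" using d Dd_Dr by blast
  have h0: "\<delta> (Hf hh) = 0" by (rule kills_hh[OF Dr k2])
  have homo: "homo (3 + k - 1) (\<delta> (Hf (xm \<alpha> u)) j)" if "xm \<alpha> u \<in> Hev" "dg \<alpha> + card u = 3" for \<alpha> u j
    using Dd_homo[OF d(1) that(1) homo_mono, of j] that(2) by simp
  have flat: "flat (\<delta> (Hf (xm \<alpha> u)) j)"
    if "\<alpha> \<in> MI" "u \<subseteq> Od" "even (card u)" "(\<alpha>, u) \<noteq> (pimax, {})" "(\<alpha>, u) \<noteq> (pimax, Od)" "dg \<alpha> + card u = 3" for \<alpha> u j
    using that by (intro Dr_flat[OF Dr k2]) auto
  consider "k \<le> - 3" | "k = - 1" | "k = - 2" using d by linarith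
  then have "kills (Suc 2) \<delta>"
  proof cases
    case 1
    then show ?thesis by (intro kills_neg[OF d(1)]) simp
  next
    case 2
    show ?thesis
    proof (rule kills_SucI[OF k2])
      fix \<alpha> u assume a: "\<alpha> \<in> MI" "u \<subseteq> Od" "even (card u)" "(\<alpha>, u) \<noteq> (pimax, {})" "(\<alpha>, u) \<noteq> (pimax, Od)"
        "dg \<alpha> + card u = Suc 2"
      then have a3: "dg \<alpha> + card u = 3" by simp
      have f: "xm \<alpha> u \<in> Hev" using a by (intro Hev_xm)
      have odd: "dg \<alpha> = 1 \<or> dg \<alpha> = 3" using a by presburger
      show "\<delta> (Hf (xm \<alpha> u)) = 0"
      proof
        fix j
        have "\<delta> (Hf (xm \<alpha> u)) j = 0"
        proof (cases "j \<in> Ev")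
          case True
          show ?thesis
          proof
            fix z :: "(nat \<Rightarrow> nat) \<times> nat set"
            obtain \<beta> v where z: "z = (\<beta>, v)" by (cases z)
            show "\<delta> (Hf (xm \<alpha> u)) j z = 0 z"
            proof (rule ccontr)
              assume "\<delta> (Hf (xm \<alpha> u)) j z \<noteq> 0 z"
              then have nz: "\<delta> (Hf (xm \<alpha> u)) j (\<beta>, v) \<noteq> 0" by (simp add: z zero_fun_apply)
              then have "\<beta> = 0" using flat[OF a(1-5) a3, of j] unfolding flat_def by blast
              moreover have "int (dg \<beta> + card v) = 1"
                using homo[OF f a3, of j] nz 2 unfolding homo_def mono_degree_dg by fastforce
              moreover have "even (card v)"
                using WE_hasp[OF Dr_WE[OF Dr f], of j] nz True unfolding hasp_def by fastforce
              ultimately show False by simp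
            qed
          qed
        next
          case False
          show ?thesis
            by (rule hweight[OF Dr h0 f a(1,2) flat[OF a(1-5) a3]]) (use False weight_odd_nz[OF odd] in simp)
        qed
        then show "\<delta> (Hf (xm \<alpha> u)) j = 0 j" by (simp add: zero_fun_apply)
      qed
    qed
  next
    case 3
    have homo0: "homo 0 (\<delta> (Hf (xm \<alpha> u)) j)" if "xm \<alpha> u \<in> Hev" "dg \<alpha> + card u = 3" for \<alpha> u j
      using homo[OF that, of j] 3 by simp
    interpret pb_subalgebra p m n t ty "kern \<delta>" by (rule kern_subalgebra[OF Dr])
    have ne: "\<alpha> \<noteq> pimax" if "dg \<alpha> \<le> 3" for \<alpha>
    proof
      assume e: "\<alpha> = pimax"
      obtain i j where ij: "i \<in> Ev" "j \<in> Ev" "i \<noteq> j" using other_Ev by metis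
      show False using dg_ge2[OF ij, of \<alpha>] that pimax_ge_3[OF ij(1)] pimax_ge_3[OF ij(2)] unfolding e by simp
    qed
    show ?thesis
    proof (rule kills_SucI[OF k2])
      fix \<alpha> u assume a: "\<alpha> \<in> MI" "u \<subseteq> Od" "even (card u)" "(\<alpha>, u) \<noteq> (pimax, {})" "(\<alpha>, u) \<noteq> (pimax, Od)"
        "dg \<alpha> + card u = Suc 2"
      then have a3: "dg \<alpha> + card u = 3" by simp
      have "u = {} \<or> card u = 2" using a by (intro card_even_le_3) auto
      then show "\<delta> (Hf (xm \<alpha> u)) = 0"
      proof
        assume u: "u = {}"
        have "xm \<alpha> {} \<in> kern \<delta>"
        proof (rule cubic)
          show "xm \<alpha> {} \<in> kern \<delta>" if "\<alpha> \<in> MI" "dg \<alpha> \<le> 2" for \<alpha>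
            using that ne[of \<alpha>] by (auto simp: kern_def intro!: Hev_ev kills_ev[OF k2])
          fix i assume i: "i \<in> Ev"
          let ?c = "0(i := 3)"
          have cM: "?c \<in> MI" using i pimax_ge_3 by (intro single_MI)
          have dc: "dg ?c = 3" using i by (rule dg_single)
          have cH: "xm ?c {} \<in> Hev" using cM single_ne_pimax by (intro Hev_ev)
          have hom: "homo 0 (\<delta> (Hf (xm ?c {})) j)" for j using cH dc by (intro homo0) simp_all
          have "\<delta> (Hf (xm ?c {})) j = 0" for j
          proof (cases "j \<in> Ev")
            case True
            have s: "(\<Sum>l\<in>Ev. ta l * of_nat (?c l)) = ta i * 3"
            proof -
              have "(\<Sum>l\<in>Ev. ta l * of_nat (?c l)) = (\<Sum>l\<in>Ev. if l = i then ta i * 3 else 0)"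
                by (rule sum.cong) auto
              then show ?thesis using i by simp
            qed
            \<comment> \<open>The possible weights +-1 +- 3 are +-2 and +-4, all nonzero mod
              p.\<close>
            have "ta j + ta i * 3 = of_int (4 - 2 * int (ng j) - 6 * int (ng i))"
              by (simp add: ta_ng algebra_simps)
            moreover have "(of_int (4 - 2 * int (ng j) - 6 * int (ng i)) :: 'a) \<noteq> 0"
              using p_ge_5 by (intro of_int_nz) (auto simp: ng_def)
            ultimately have nz: "ta j + ta i * 3 \<noteq> 0" by simp
            show ?thesis
            proof (rule hweight[OF Dr h0 cH cM])
              show "flat (\<delta> (Hf (xm ?c {})) j)" for j
                using Dr_WE[OF Dr cH] hom by (intro homo_0_flat) (auto simp: WE_OA)
              show "(if j \<in> Ev then ta j else 0) + (\<Sum>l\<in>Ev. ta l * of_nat (?c l)) \<noteq> 0"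
                unfolding s using nz True by simp
            qed simp
          next
            case False
            show ?thesis by (rule WE_homo_0_odd[OF Dr_WE[OF Dr cH] hom False])
          qed
          then have "\<delta> (Hf (xm ?c {})) = 0" by (intro ext) (simp add: zero_fun_apply)
          then show "xm ?c {} \<in> kern \<delta>" using cH by (simp add: kern_def)
        qed (use a u in auto)
        then show ?thesis by (simp add: kern_def u)
      next
        assume u: "card u = 2"
        then show ?thesis
        proof (intro Dr_so[OF Dr a(1,2)])
          fix v assume v: "v \<subseteq> Od" "card v = 2"
          show "homo 0 (\<delta> (Hf (xm \<alpha> v)) j)" for j
            using v u a3 a by (intro homo0 odd_pair_Hev) auto
          have "\<delta> (Hf (xm 0 v)) = 0"
            using v n_gt_3 single_ne_pimax[of 0 0] by (intro killsD[OF k2]) auto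
          then show "\<delta> (Hf (xm 0 v)) = 0 \<or> \<alpha> = 0" by simp
        qed
      qed
    qed
  qed
  then show ?thesis by (simp add: numeral_3_eq_3 numeral_2_eq_2)
qed

section \<open>Invariants of the orthogonal algebra in the odd variables\<close>

lemma mul_eval: "(f \<odot> g) y = (\<Sum>z\<in>Bas. g z * (f \<odot> xm (fst z) (snd z)) y)"
proof -
  have "trunc g = (\<Sum>z\<in>Bas. scaleO (trunc g z) (xm (fst z) (snd z)))"
    by (rule OA_expand) simp
  also have "\<dots> = (\<Sum>z\<in>Bas. scaleO (g z) (xm (fst z) (snd z)))"
    by (rule sum.cong) (auto simp: trunc_def)
  finally have "f \<odot> trunc g = f \<odot> (\<Sum>z\<in>Bas. scaleO (g z) (xm (fst z) (snd z)))"
    by (simp only:)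
  then show ?thesis
    by (simp add: mul_sum_right mul_scale_right sum_fun_app[where x = y] scaleO_app)
qed

lemma xo_mul_in:
  assumes k: "k \<in> Od" and v: "v \<subseteq> Od" "k \<notin> v"
  shows "(xo k \<odot> g) (0, insert k v) = oc {k} v * g (0, v)"
proof -
  have "(xo k \<odot> xm (fst z) (snd z)) (0, insert k v) = (if z = (0, v) then oc {k} v else 0)" if z: "z \<in> Bas" for z
  proof -
    obtain \<beta> w where zw: "z = (\<beta>, w)" "\<beta> \<in> MI" "w \<subseteq> Od" using z by (cases z) auto
    have e: "xo k \<odot> xm \<beta> w = scaleO (oc {k} w) (xm \<beta> (insert k w))"
      using zw k by (simp add: mul_odd_mono(2))
    have "w = v" if "insert k v = insert k w" "k \<notin> w"
      using that v by (simp add: insert_ident)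
    moreover have "oc {k} w = 0" if "k \<in> w" using that by (simp add: oc_def)
    ultimately show ?thesis using v unfolding zw(1) fst_conv snd_conv e by (auto simp: scaleO_app xmono_def)
  qed
  then have "(xo k \<odot> g) (0, insert k v) = (\<Sum>z\<in>Bas. if z = (0, v) then g z * oc {k} v else 0)"
    unfolding mul_eval[of "xo k" g] by (intro sum.cong) auto
  then show ?thesis using v by simp
qed

lemma xo_mul_out:
  assumes k: "k \<in> Od" "k \<notin> v"
  shows "(xo k \<odot> g) (\<beta>, v) = 0"
  unfolding mul_eval[of "xo k" g]
proof (rule sum.neutral, rule ballI)
  fix z assume "z \<in> Bas"
  then obtain \<gamma> w where zw: "z = (\<gamma>, w)" "\<gamma> \<in> MI" "w \<subseteq> Od" by (cases z) auto
  have e: "xo k \<odot> xm \<gamma> w = scaleO (oc {k} w) (xm \<gamma> (insert k w))"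
    using zw k by (simp add: mul_odd_mono(2))
  show "g z * (xo k \<odot> xm (fst z) (snd z)) (\<beta>, v) = 0"
    unfolding zw(1) fst_conv snd_conv e using k by (auto simp: scaleO_app xmono_def)
qed

lemma pd_odd_coeff:
  assumes k: "k \<in> Od" and v: "v \<subseteq> Od" "k \<notin> v"
  shows "pd k g (0, v) = (- 1) ^ card {j \<in> insert k v. j < k} * g (0, insert k v)"
proof -
  let ?c = "(- 1) ^ card {j \<in> insert k v. j < k} :: 'a"
  have "mono_partial m k z (0, v) = (if z = (0, insert k v) then ?c else 0)" for z
  proof -
    obtain \<alpha> u where z: "z = (\<alpha>, u)" by (cases z)
    have "u = insert k v" if "k \<in> u" "v = u - {k}" using that by auto
    then show ?thesis using k v by (auto simp: z mono_partial_def xmono_def zero_fun_apply scaleO_app)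
  qed
  then have "pd k g (0, v) = (\<Sum>z\<in>Bas. if z = (0, insert k v) then ?c * g z else 0)"
    unfolding partial_def sum_fun_app by (intro sum.cong refl) (simp add: scaleO_app mult.commute)
  then show ?thesis using v k by simp
qed

text \<open>Compare coordinates at v with k replaced by l: on the left this is g at v up to sign, on
  the right it is zero because k is missing. Invariance thus forbids sets that separate k from
  l.\<close>

lemma so_relation:
  assumes kl: "k \<in> Od" "l \<in> Od" "k \<noteq> l" and r: "xo l \<odot> pd k g = xo k \<odot> pd l g"
    and v: "v \<subseteq> Od" "k \<in> v" "l \<notin> v"
  shows "g (0, v) = 0"
proof -
  let ?v = "v - {k}"
  have v': "?v \<subseteq> Od" "k \<notin> ?v" "l \<notin> ?v" "insert k ?v = v" "k \<notin> insert l ?v" using v kl by auto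
  have "(xo l \<odot> pd k g) (0, insert l ?v) = oc {l} ?v * pd k g (0, ?v)"
    by (rule xo_mul_in[OF kl(2) v'(1,3)])
  moreover have "(xo k \<odot> pd l g) (0, insert l ?v) = 0"
    by (rule xo_mul_out[OF kl(1) v'(5)])
  moreover have "oc {l} ?v \<noteq> 0" using v' by (intro oc_sign) auto
  ultimately have "pd k g (0, ?v) = 0" unfolding r by simp
  then show ?thesis using pd_odd_coeff[OF kl(1) v'(1,2), of g] v'(4) by simp
qed

abbreviation so :: "nat \<Rightarrow> nat \<Rightarrow> 'a super_poly" where "so k l \<equiv> xo k \<odot> xo l"

lemma so_mono:
  "k \<in> Od \<Longrightarrow> l \<in> Od \<Longrightarrow> so k l = scaleO (oc {k} {l}) (xm 0 {k, l})"
  using mul_odd_mono(1)[of 0 "{k}" "{l}"] by (simp add: insert_commute)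

lemma so_Hev: "k \<in> Od \<Longrightarrow> l \<in> Od \<Longrightarrow> k \<noteq> l \<Longrightarrow> so k l \<in> Hev"
  unfolding so_mono by (intro Hev_scale odd_pair_Hev) auto

lemma hasp_xo: "hasp 1 (xo k)"
  by (rule hasp_xm) simp

lemma xo_OA: "k \<in> Od \<Longrightarrow> xo k \<in> OA"
  by simp

lemma pd_so:
  assumes "k \<in> Od" "l \<in> Od" "k \<noteq> l"
  shows "pd j (so k l) = (if j = k then xo l else if j = l then - xo k else 0)"
  using pd_mul[OF hasp_xo, of j k "xo l"] assms
  by (cases "j \<in> Ev") (auto simp: pd_xo mul_one mul_one_right xo_OA)

lemma cj_eq_Od: "k \<in> Od \<Longrightarrow> cj i = k \<longleftrightarrow> i = k"
  by (auto simp: cj_eq)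

lemma pb_so_eq:
  assumes "k \<in> Od" "l \<in> Od" "k \<noteq> l"
  shows "pb (so k l) g = xo l \<odot> pd k g - xo k \<odot> pd l g"
proof -
  have "pb (so k l) g = (\<Sum>i\<in>Y m n. scaleO (ta (cj i)) (pd (cj i) (so k l) \<odot> pd i g))"
    by (rule pb_eq[OF Hev_hasp[OF so_Hev[OF assms]]])
  also have "\<dots> = (\<Sum>i\<in>{k, l}. scaleO (ta (cj i)) (pd (cj i) (so k l) \<odot> pd i g))"
  proof (rule sum.mono_neutral_right)
    show "\<forall>i\<in>Y m n - {k, l}. scaleO (ta (cj i)) (pd (cj i) (so k l) \<odot> pd i g) = 0"
    proof
      fix i assume "i \<in> Y m n - {k, l}"
      then have "cj i \<noteq> k" "cj i \<noteq> l" using cj_eq_Od assms by auto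
      then show "scaleO (ta (cj i)) (pd (cj i) (so k l) \<odot> pd i g) = 0" by (simp add: pd_so[OF assms])
    qed
  qed (use assms in \<open>auto simp: Y_iff\<close>)
  finally show ?thesis using assms by (simp add: pd_so mul_minus_left)
qed

lemma kills_so:
  assumes "\<delta> \<in> Dr" "kills 2 \<delta>" "k \<in> Od" "l \<in> Od" "k \<noteq> l"
  shows "\<delta> (Hf (so k l)) = 0"
proof -
  have "xm 0 {k, l} \<in> Hev" using assms by (intro odd_pair_Hev) auto
  moreover have "\<delta> (Hf (xm 0 {k, l})) = 0"
    using assms n_gt_3 single_ne_pimax[of 0 0] by (intro killsD[OF assms(2)]) auto
  ultimately show ?thesis using assms by (simp add: so_mono Dr_scale)
qed

text \<open>A monomial without odd factors commutes with x_k x_l, which the derivation kills, so the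
  value is invariant under it. The two parts are components of this invariance: for j outside {k, l}
  the coefficient is itself invariant, while component k is rotated into component l.\<close>

lemma so_invariant:
  assumes d: "\<delta> \<in> Dr" "kills 2 \<delta>" and \<alpha>: "\<alpha> \<in> MI" "\<alpha> \<noteq> pimax" and kl: "k \<in> Od" "l \<in> Od" "k \<noteq> l"
  shows "j \<noteq> k \<Longrightarrow> j \<noteq> l \<Longrightarrow> xo l \<odot> pd k (\<delta> (Hf (xm \<alpha> {})) j) = xo k \<odot> pd l (\<delta> (Hf (xm \<alpha> {})) j)"
    and "xo l \<odot> pd k (\<delta> (Hf (xm \<alpha> {})) k) - xo k \<odot> pd l (\<delta> (Hf (xm \<alpha> {})) k) = \<delta> (Hf (xm \<alpha> {})) l"
proof -
  let ?f = "xm \<alpha> {}" let ?w = "\<delta> (Hf ?f)"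
  have f: "?f \<in> Hev" using \<alpha> by (rule Hev_ev)
  have W: "?w \<in> WE" by (rule Dr_WE[OF d(1) f])
  have sH: "so k l \<in> Hev" by (rule so_Hev[OF kl])
  have "pb (so k l) ?f = 0" using kl \<alpha> by (simp add: pb_so_eq pd_odd_mono)
  then have "br (Hf (so k l)) ?w = \<delta> (Hf 0)"
    using Dr_pb[OF d(1) sH f] kills_so[OF d kl] f by (simp add: br_0_right Hf_WE Hev_hasp)
  also have "\<dots> = 0" using Dr_scale[OF d(1) f, of 0] by simp
  finally have br0: "br (Hf (so k l)) ?w = 0" .
  have "pb (so k l) (?w j) = scaleO (ta (cj j)) (app ?w (pd (cj j) (so k l)))" for j
    using fun_cong[OF br0, of j] br_Hf_left[OF Hev_hasp[OF sH] W] by (simp add: zero_fun_apply)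
  moreover have "cj j = k \<longleftrightarrow> j = k" "cj j = l \<longleftrightarrow> j = l" for j using kl by (auto simp: cj_eq)
  ultimately have e: "xo l \<odot> pd k (?w j) - xo k \<odot> pd l (?w j) =
      scaleO (ta (cj j)) (app ?w (if j = k then xo l else if j = l then - xo k else 0))" for j
    by (simp add: pb_so_eq[OF kl] pd_so[OF kl])
  show "xo l \<odot> pd k (?w j) = xo k \<odot> pd l (?w j)" if "j \<noteq> k" "j \<noteq> l" using e[of j] that by simp
  show "xo l \<odot> pd k (?w k) - xo k \<odot> pd l (?w k) = ?w l"
    using e[of k] kl W by (simp add: app_xo WE_OA)
qed

lemma flat_two:
  assumes "flat g" "v1 \<subseteq> Od" "v2 \<subseteq> Od" "v1 \<noteq> v2"
    and "\<And>v. v \<subseteq> Od \<Longrightarrow> g (0, v) \<noteq> 0 \<Longrightarrow> v = v1 \<or> v = v2"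
  shows "g = scaleO (g (0, v1)) (xm 0 v1) + scaleO (g (0, v2)) (xm 0 v2)"
proof -
  have "(\<Sum>v\<in>Pow Od. scaleO (g (0, v)) (xm 0 v)) = (\<Sum>v\<in>{v1, v2}. scaleO (g (0, v)) (xm 0 v))"
    by (rule sum.mono_neutral_right) (use assms in auto)
  then show ?thesis using flat_expand[OF assms(1)] assms(4) by simp
qed

lemma xo_pd:
  assumes "v \<subseteq> Od" "k \<in> v"
  shows "xo k \<odot> pd k (xm 0 v) = xm 0 v"
proof -
  have k: "k \<in> Od" "k \<notin> Ev" "v - {k} \<subseteq> Od" "{k} \<inter> (v - {k}) = {}" using assms by auto
  have s: "{j \<in> v - {k}. j < k} = {j \<in> v. j < k}" by auto
  have "xo k \<odot> xm 0 (v - {k}) = scaleO (oc {k} (v - {k})) (xm 0 v)"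
    using k assms by (simp add: mul_odd_mono(2) insert_absorb)
  moreover have "oc {k} (v - {k}) = (- 1) ^ card {j \<in> v. j < k}"
    using k(4) unfolding oc_def wedge_sign_inv inv_num_single_left s by simp
  moreover have "pd k (xm 0 v) = scaleO ((- 1) ^ card {j \<in> v. j < k}) (xm 0 (v - {k}))"
    using k assms by (simp add: pd_odd_mono)
  ultimately show ?thesis by (simp add: mul_scale_right)
qed

lemma xo_mul_0:
  assumes "k \<in> v" "v \<subseteq> Od" shows "xo k \<odot> xm 0 v = 0" "xm 0 v \<odot> xo k = 0"
proof -
  have "{k} \<subseteq> Od" using assms by auto
  then show "xo k \<odot> xm 0 v = 0" "xm 0 v \<odot> xo k = 0" using assms by (simp_all add: mul_odd_mono(1) oc_def)
qed

end

text \<open>This monomial has degree D+2, one beyond the general reach. It is obtained because its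
  even exponent is -1 mod p and the exchange step leads back to a monomial of degree D+1 with odd
  factors, where \<open>gen_odd\<close> has no exceptions of p-power type.\<close>

lemma (in pb_generated) gen_boundary:
  assumes SD: "Suc D = p ^ s" "s \<ge> 1" and r: "r \<in> Ev" "p ^ s \<le> pimax r" and kl: "k \<in> Od" "l \<in> Od" "k \<noteq> l"
  shows "xm (0(r := p ^ s - 1)) {k, l} \<in> Z"
proof -
  let ?\<alpha> = "0(r := p ^ s - 1)" and ?u = "{k, l}"
  have \<alpha>: "?\<alpha> \<in> MI" using r by (intro single_MI) auto
  have "card ?u = 2" using kl by simp
  then have "?u \<noteq> Od" using n_gt_3 card_Od by auto
  then obtain j where j: "j \<in> Od" "j \<notin> ?u" using kl by auto
  have nz: "of_nat (?\<alpha> r) \<noteq> (0 :: 'a)"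
  proof -
    have "(of_nat (p ^ s) :: 'a) = 0" unfolding of_nat_0_iff using SD by simp
    then have "(of_nat (p ^ s - 1) :: 'a) = - 1" using SD(1)[symmetric] by (simp add: eq_neg_iff_add_eq_0 add.commute)
    then show ?thesis by simp
  qed
  have q: "p ^ s \<ge> 4" using SD(1) D by simp
  have v: "insert j (?u - {k}) = {j, l}" using kl by auto
  have "xm (?\<alpha>(r := ?\<alpha> r - 1)) (insert j (?u - {k})) \<in> Z"
  proof (rule gen_odd)
    have "?\<alpha>(r := ?\<alpha> r - 1) = 0(r := p ^ s - 2)" by (simp add: numeral_2_eq_2)
    moreover have "dg (0(r := p ^ s - 2)) = p ^ s - 2" by (rule dg_single[OF r(1)])
    moreover have "card {j, l} = 2" using j by auto
    ultimately show "dg (?\<alpha>(r := ?\<alpha> r - 1)) + card (insert j (?u - {k})) = Suc D"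
      using q \<open>Suc D = p ^ s\<close> unfolding v by (simp only:)
    show "(?\<alpha>(r := ?\<alpha> r - 1), insert j (?u - {k})) \<noteq> (pimax, Od)"
      using single_ne_pimax[of r] by auto
    show "even (card (insert j (?u - {k})))" unfolding v using j by auto
    show "?\<alpha>(r := ?\<alpha> r - 1) \<in> MI" by (rule upd_MI[OF \<alpha>])
  qed (use j kl in auto)
  moreover have "xi r \<odot> xm 0 {k, j} \<in> Z" using r kl j by (intro xi_s_Z) auto
  moreover obtain c where "c \<noteq> 0" "pb (xi r \<odot> xm 0 {k, j}) (xm (?\<alpha>(r := ?\<alpha> r - 1)) (insert j (?u - {k}))) = scaleO c (xm ?\<alpha> ?u)"
  proof -
    have "\<exists>c. c \<noteq> 0 \<and> pb (xi r \<odot> xm 0 {k, j}) (xm (?\<alpha>(r := ?\<alpha> r - 1)) (insert j (?u - {k}))) = scaleO c (xm ?\<alpha> ?u)"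
      by (rule pb_exchange_odd[OF \<alpha> _ _ j r(1) nz]) (use kl in auto)
    then show ?thesis using that by blast
  qed
  ultimately show ?thesis using Z_pb Z_cancel by metis
qed

context ham
begin

subsection \<open>The exceptional monomials\<close>

lemma p_power_facts: "s \<ge> 1 \<Longrightarrow> p ^ s \<ge> 5" "s \<ge> 1 \<Longrightarrow> (of_nat (p ^ s) :: 'a) = 0"
  using self_le_power[of p s] p_ge_5 by (auto simp: of_nat_0_iff)

text \<open>The value on \<open>x\<^sub>r\<^sup>(\<^sup>q\<^sup>)\<close>, \<open>q = p ^ s\<close>, is an invariant of the degree-0 part, and is further restricted
  by the brackets with \<open>x\<^sub>r' x\<^sub>k x\<^sub>l\<close>; the latter exclude the Euler field of the odd variables.\<close>

lemma value_p_power: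
  assumes d: "\<delta> \<in> Dr" "kills D \<delta>" and SD: "Suc D = p ^ s" "s \<ge> 1" and r: "r \<in> Ev" "p ^ s \<le> pimax r"
  shows "\<exists>c. \<delta> (Hf (xm (0(r := p ^ s)) {})) = scaleW c (Hf \<omega>) \<and> (odd n \<longrightarrow> c = 0)"
proof -
  let ?q = "p ^ s"
  let ?\<alpha> = "0(r := ?q)"
  let ?f = "xm ?\<alpha> {}"
  define w where "w = \<delta> (Hf ?f)"
  have q: "?q \<ge> 5" "(of_nat ?q :: 'a) = 0" using SD p_power_facts by auto
  have D3: "D \<ge> 3" using q SD by simp
  have k2: "kills 2 \<delta>" using D3 by (intro kills_mono[OF d(2)]) simp
  interpret pb_generated p m n t ty "kern \<delta>" D by (rule kills_generated[OF d D3])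
  have \<alpha>: "?\<alpha> \<in> MI" "?\<alpha> \<noteq> pimax" using r by (auto intro: single_MI simp: single_ne_pimax simp del: fun_upd_apply)
  have f: "?f \<in> Hev" using \<alpha> by (rule Hev_ev)
  have W: "w \<in> WE" unfolding w_def by (rule Dr_WE[OF d(1) f])
  have fl: "flat (w j)" for j
    unfolding w_def using SD \<alpha> D3 dg_single[OF r(1), of ?q] by (intro Dr_flat[OF d]) (auto simp del: fun_upd_apply)
  \<comment> \<open>All Cartan weights of x_r^(q) vanish mod p, but each even \<partial>_j has
    nonzero weight under x_j x_j'.\<close>
  have w0: "w j = 0" if "j \<in> Ev" for j
    unfolding w_def
  proof (rule weight[OF d(1) k2 that f \<alpha>(1) _ _ fl[unfolded w_def]])
    have e: "(of_nat (?\<alpha> i) :: 'a) = 0" for i using q(2) by (cases "i = r") (simp_all del: of_nat_power)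
    show "of_nat (?\<alpha> (cj j)) - of_nat (?\<alpha> j) - (if j = j then 1 else 0) + (if j = cj j then 1 else 0) \<noteq> (0 :: 'a)"
      unfolding e using that by simp
  qed auto
  \<comment> \<open>The coefficient at an odd index must have odd parity, and of the two sets
    \<open>Od\<close> and \<open>Od - {j}\<close> exactly one has odd size.\<close>
  define V where "V j = (if odd n then Od else Od - {j})" for j
  have w1: "\<exists>a b. w j = scaleO a (xo j) + scaleO b (xm 0 (V j))" if j: "j \<in> Od" for j
  proof -
    have "v = {j} \<or> v = V j" if v: "v \<subseteq> Od" and nz: "w j (0, v) \<noteq> 0" for v
    proof -
      \<comment> \<open>Rotations among the indices other than j leave the coefficient at j
        invariant, so its monomials contain all or none of these indices.\<close>
      have iff: "k \<in> v \<longleftrightarrow> l \<in> v" if "k \<in> Od - {j}" "l \<in> Od - {j}" for k l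
      proof (rule ccontr)
        assume ne: "(k \<in> v) \<noteq> (l \<in> v)"
        then have kl: "k \<noteq> l" by auto
        have "g (0, v) = 0" if "xo l \<odot> pd k g = xo k \<odot> pd l g" for g
          using ne so_relation[of k l g v] so_relation[of l k g v] that kl v
            \<open>k \<in> Od - {j}\<close> \<open>l \<in> Od - {j}\<close> by fastforce
        moreover have "xo l \<odot> pd k (w j) = xo k \<odot> pd l (w j)"
          unfolding w_def using that kl by (intro so_invariant(1)[OF d(1) k2 \<alpha>]) auto
        ultimately show False using nz by blast
      qed
      have "odd (card v)" using WE_hasp[OF W, of j] nz j unfolding hasp_def by fastforce
      moreover have "v = {} \<or> v = {j} \<or> v = Od - {j} \<or> v = Od"
      proof (cases "v \<inter> (Od - {j}) = {}")
        case True then show ?thesis using v by auto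
      next
        case False
        then have "Od - {j} \<subseteq> v" using iff by blast
        then show ?thesis using v by auto
      qed
      moreover have "card (Od - {j}) = n - 1" using j by simp
      ultimately show ?thesis unfolding V_def using n_gt_3 by auto
    qed
    moreover have "{j} \<noteq> V j"
      using j n_gt_3 card_Od unfolding V_def by (metis DiffD2 card_1_singleton_iff insertI1 less_numeral_extra(4) numeral_eq_one_iff One_nat_def not_less_iff_gr_or_eq numeral_3_eq_3 Suc_less_eq zero_less_Suc)
    ultimately have "w j = scaleO (w j (0, {j})) (xo j) + scaleO (w j (0, V j)) (xm 0 (V j))"
      using j by (intro flat_two[OF fl]) (auto simp: V_def)
    then show ?thesis by blast
  qed
  then obtain a b where ab: "\<And>j. j \<in> Od \<Longrightarrow> w j = scaleO (a j) (xo j) + scaleO (b j) (xm 0 (V j))"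
    by metis
  have VO: "V j \<subseteq> Od" "k \<in> Od \<Longrightarrow> k \<noteq> j \<Longrightarrow> k \<in> V j" for j k by (auto simp: V_def)
  \<comment> \<open>The bracket of x_r' x_k x_l with x_r^(q) is a multiple of the monomial of
    \<open>gen_boundary\<close>, hence killed. Component r of the resulting identity says that the
    value annihilates x_k x_l, where it acts by \<open>a k + a l\<close>.\<close>
  have aa: "a k + a l = 0" if kl: "k \<in> Od" "l \<in> Od" "k \<noteq> l" for k l
  proof -
    let ?G = "xi (cj r) \<odot> so k l"
    have r': "cj r \<in> Ev" using r by simp
    have sH: "so k l \<in> Hev" by (rule so_Hev[OF kl])
    have G: "?G \<in> kern \<delta>"
      unfolding so_mono[OF kl(1,2)] mul_scale_right by (rule Z_scale, rule xi_s_Z) (use kl r in auto)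
    then have GH: "?G \<in> Hev" "\<delta> (Hf ?G) = 0" by (auto simp: kern_def)
    have "pb ?G ?f = pb (xi (cj r)) ?f \<odot> so k l + xi (cj r) \<odot> pb (so k l) ?f"
      by (rule pb_mul_left) (auto intro: hasp_xm Hev_hasp[OF sH])
    moreover have "pb (so k l) ?f = 0" using kl \<alpha> by (simp add: pb_so_eq pd_odd_mono del: fun_upd_apply)
    moreover have "pd r ?f = xm (0(r := ?q - 1)) {}" using r p_gt_3 \<alpha>(1) by (simp add: pd_even_mono)
    moreover have "xm (0(r := ?q - 1)) {} \<odot> so k l = scaleO (oc {k} {l}) (xm (0(r := ?q - 1)) {k, l})"
      using kl r unfolding so_mono[OF kl(1,2)] mul_scale_right
      by (subst mul_odd_mono(1)) (auto intro!: single_MI)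
    ultimately have "pb ?G ?f = scaleO (ta (cj r) * oc {k} {l}) (xm (0(r := ?q - 1)) {k, l})"
      using r by (simp add: pb_xi[OF r'] mul_scale_left del: fun_upd_apply)
    then have "pb ?G ?f \<in> kern \<delta>" using gen_boundary[OF SD r kl] Z_scale by simp
    then have "br (Hf ?G) w = 0"
      using Dr_pb[OF d(1) GH(1) f] GH(2) f by (simp add: kern_def w_def br_0_right Hf_WE Hev_hasp)
    from fun_cong[OF this, of r] have "app w (pd (cj r) ?G) = 0"
      using br_Hf_left[OF Hev_hasp[OF GH(1)] W] w0[OF r(1)] by (simp add: zero_fun_apply pb_def)
    moreover have "pd (cj r) ?G = so k l"
    proof -
      have "cj r \<noteq> k" "cj r \<noteq> l" using r' kl by auto
      then have "pd (cj r) (so k l) = 0" by (simp add: pd_so[OF kl])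
      then show ?thesis using Hev_OA[OF sH] by (simp add: pd_mul_even[OF r', of "xi (cj r)"] pd_xi[OF r'] mul_one)
    qed
    ultimately have "app w (so k l) = 0" by simp
    moreover have "app w (so k l) = (\<Sum>i\<in>{k, l}. w i \<odot> pd i (so k l))"
      unfolding app_def by (rule sum.mono_neutral_right) (use kl in \<open>auto simp: pd_so Y_iff\<close>)
    ultimately have "w k \<odot> xo l - w l \<odot> xo k = 0" using kl by (simp add: pd_so mul_minus_right)
    moreover have "w k \<odot> xo l = scaleO (a k) (so k l)" "w l \<odot> xo k = scaleO (a l) (so l k)"
      using ab kl VO by (auto simp: mul_add_left mul_scale_left xo_mul_0)
    moreover have "so l k = - so k l" using mul_commute[OF hasp_xo hasp_xo, of l k] by simp
    ultimately have "scaleO (a k + a l) (so k l) = 0" by (simp add: VO.scale_left_distrib)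
    moreover have "so k l \<noteq> 0" using pd_so[OF kl, of k] kl pd_xo[OF kl(2), of l]
      by (metis pd_0 flat_const VO.scale_zero_left mul_one xo_OA xo_mul_in zero_fun_apply xmono_def zero_neq_one)
    ultimately show ?thesis by simp
  qed
  \<comment> \<open>With three distinct odd indices, vanishing of all pairwise sums gives 2 a =
    0.\<close>
  have a0: "a k = 0" if k: "k \<in> Od" for k
  proof -
    have c: "card (Od - {k}) \<ge> 2" using k n_gt_3 by simp
    then obtain l where l: "l \<in> Od" "l \<noteq> k" by (metis Diff_iff card.empty ex_in_conv not_numeral_le_zero singletonI)
    have "card (Od - {k} - {l}) \<ge> 1" using k l n_gt_3 by simp
    then obtain j where j: "j \<in> Od" "j \<noteq> k" "j \<noteq> l" by (metis Diff_iff card.empty ex_in_conv not_one_le_zero singletonI)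
    have "a k + a l = 0" "a k + a j = 0" "a l + a j = 0" using aa k l j by auto
    then have "2 * a k = 0" by (simp add: eq_neg_iff_add_eq_0[symmetric])
    then show ?thesis using two_nz by simp
  qed
  have wb: "w j = scaleO (b j) (xm 0 (V j))" if "j \<in> Od" for j using ab[OF that] a0[OF that] by simp
  obtain k0 where k0: "k0 \<in> Od" using Od_ne by blast
  have rel: "w l = xo l \<odot> pd k0 (w k0) - xo k0 \<odot> pd l (w k0)" if "l \<in> Od" "l \<noteq> k0" for l
    unfolding w_def using that k0 by (intro so_invariant(2)[OF d(1) k2 \<alpha>, symmetric]) auto
  have wOut: "w j = 0" if "j \<notin> Od" for j using that w0[of j] WE_out[OF W, of j] by (auto simp: Y_iff)
  show ?thesis
  proof (cases "odd n")
    case True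
    have VOd: "V j = Od" for j using True by (simp add: V_def)
    \<comment> \<open>Rotating component k into component l gives zero, because component k is a
      multiple of x^\<omega> and each product repeats an odd index.\<close>
    have wz: "w l = 0" if l: "l \<in> Od" "l \<noteq> k" "k \<in> Od" for k l
    proof -
      have "w l = xo l \<odot> pd k (w k) - xo k \<odot> pd l (w k)"
        unfolding w_def using l by (intro so_invariant(2)[OF d(1) k2 \<alpha>, symmetric]) auto
      also have "\<dots> = 0"
        using l wb[OF l(3)] by (auto simp: VOd pd_scale mul_scale_right pd_odd_mono xo_mul_0)
      finally show ?thesis .
    qed
    have "w j = 0" for j
    proof (cases "j \<in> Od")
      case True
      have "card (Od - {j}) \<ge> 1" using True n_gt_3 by simp
      then obtain k where "k \<in> Od" "k \<noteq> j" by (metis Diff_iff card.empty ex_in_conv not_one_le_zero singletonI)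
      then show ?thesis using wz[of j k] True by auto
    qed (rule wOut)
    then have "w = scaleW 0 (Hf \<omega>)" by (intro ext) (simp add: zero_fun_apply)
    then show ?thesis unfolding w_def by blast
  next
    case False
    obtain e where e: "e \<noteq> 0" "pd k0 \<omega> = scaleO e (xm 0 (Od - {k0}))"
      using pd_odd_in[of 0 Od k0] k0 by auto
    \<comment> \<open>The scalar is normalised at the single index \<open>k0\<close>; the rotation
      identity \<open>rel\<close> carries it to all other components.\<close>
    define c where "c = b k0 / e"
    have wk: "w k0 = scaleO c (pd k0 \<omega>)"
      using wb[OF k0] e False by (simp add: c_def V_def)
    have wl: "w l = scaleO c (pd l \<omega>)" if l: "l \<in> Od" for l
    proof (cases "l = k0")
      case False
      have "pd k0 (pd k0 \<omega>) = 0" using e k0 by (simp add: pd_scale pd_odd_mono)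
      moreover have "pd l (pd k0 \<omega>) = - pd k0 (pd l \<omega>)"
        using pd_commute[of l k0 \<omega>] l k0 by simp
      moreover have "xo k0 \<odot> pd k0 (pd l \<omega>) = pd l \<omega>"
      proof -
        obtain e' where "pd l \<omega> = scaleO e' (xm 0 (Od - {l}))" using pd_odd_in[of 0 Od l] l by auto
        then show ?thesis using xo_pd[of "Od - {l}" k0] k0 False by (simp add: pd_scale mul_scale_right)
      qed
      ultimately show ?thesis
        using rel[OF l False] by (simp add: wk pd_scale mul_scale_right mul_minus_right)
    qed (use wk in simp)
    have ev: "even n" using False by simp
    have "w = scaleW c (Hf \<omega>)"
    proof
      fix j
      show "w j = scaleW c (Hf \<omega>) j"
        using wl[of j] wOut[of j] hasp_omega[OF ev]
        by (cases "j \<in> Ev"; cases "j \<in> Od") (auto simp: scaleW_app Hf_app pd_even_mono Y_iff)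
    qed
    then show ?thesis using False unfolding w_def by blast
  qed
qed

text \<open>Mod p the Cartan weight of x_r^(q+1) under x_r x_r' is that of x_r, which among the
  components only \<partial>_r' matches. Its coefficient is invariant under all rotations of the odd
  variables, so it is a combination of 1 and x^\<omega>; the latter has the right parity only for
  even n.\<close>

lemma value_p_power_Suc:
  assumes d: "\<delta> \<in> Dr" "kills D \<delta>" and SD: "D = p ^ s" "s \<ge> 1" and r: "r \<in> Ev" "Suc (p ^ s) \<le> pimax r"
  shows "\<exists>a b. \<delta> (Hf (xm (0(r := Suc (p ^ s))) {})) = vf (scaleO a (xm 0 {}) + scaleO b \<omega>) (cj r) \<and> (odd n \<longrightarrow> b = 0)"
proof -
  let ?q = "p ^ s"
  let ?\<alpha> = "0(r := Suc ?q)"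
  let ?f = "xm ?\<alpha> {}"
  define w where "w = \<delta> (Hf ?f)"
  have q: "?q \<ge> 5" "(of_nat ?q :: 'a) = 0" using SD p_power_facts by auto
  have k2: "kills 2 \<delta>" using q SD by (intro kills_mono[OF d(2)]) simp
  have \<alpha>: "?\<alpha> \<in> MI" "?\<alpha> \<noteq> pimax" using r by (auto intro: single_MI simp: single_ne_pimax simp del: fun_upd_apply)
  have f: "?f \<in> Hev" using \<alpha> by (rule Hev_ev)
  have W: "w \<in> WE" unfolding w_def by (rule Dr_WE[OF d(1) f])
  have fl: "flat (w j)" for j
    unfolding w_def using SD q \<alpha> dg_single[OF r(1), of "Suc ?q"] by (intro Dr_flat[OF d]) (auto simp del: fun_upd_apply)
  have r': "cj r \<in> Ev" "cj r \<noteq> r" using r by auto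
  have w0: "w j = 0" if "j \<noteq> cj r" for j
    unfolding w_def
  proof (rule weight[OF d(1) k2 r(1) f \<alpha>(1) _ _ fl[unfolded w_def]])
    \<comment> \<open>The weight difference is -1, corrected to -2 at r and to 0 at r'; only the
      last allows a nonzero component.\<close>
    have e: "(of_nat (?\<alpha> (cj r)) :: 'a) = 0" "(of_nat (?\<alpha> r) :: 'a) = 1" using r' q by auto
    have "- 1 - (1 :: 'a) \<noteq> 0" using two_nz by (metis diff_minus_eq_add minus_diff_eq neg_equal_0_iff_equal one_add_one)
    then show "of_nat (?\<alpha> (cj r)) - of_nat (?\<alpha> r) - (if j = r then 1 else 0) + (if j = cj r then 1 else 0) \<noteq> (0 :: 'a)"
      unfolding e using that by auto
  qed auto
  let ?g = "w (cj r)"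
  have supp: "v = {} \<or> v = Od" if v: "v \<subseteq> Od" and nz: "?g (0, v) \<noteq> 0" for v
  proof -
    have iff: "k \<in> v \<longrightarrow> l \<in> v" if "k \<in> Od" "l \<in> Od" for k l
    proof (rule ccontr)
      assume ne: "\<not> (k \<in> v \<longrightarrow> l \<in> v)"
      then have kl: "k \<noteq> l" by auto
      have "xo l \<odot> pd k ?g = xo k \<odot> pd l ?g"
        unfolding w_def using that kl r' by (intro so_invariant(1)[OF d(1) k2 \<alpha>]) auto
      then show False using so_relation[OF that kl _ v] ne nz by blast
    qed
    then show ?thesis using v by blast
  qed
  have g: "?g = scaleO (?g (0, {})) (xm 0 {}) + scaleO (?g (0, Od)) \<omega>"
    by (rule flat_two[OF fl]) (use supp in auto)
  have b: "?g (0, Od) = 0" if "odd n"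
    using WE_hasp[OF W, of "cj r"] r that unfolding hasp_def by fastforce
  have "w = vf (scaleO (?g (0, {})) (xm 0 {}) + scaleO (?g (0, Od)) \<omega>) (cj r)"
    using w0 g by (auto simp: vf_def fun_eq_iff[of w])
  then show ?thesis using b unfolding w_def by blast
qed

lemma pdk_mono:
  assumes r: "r \<in> Ev" and \<alpha>: "\<alpha> \<in> MI" "u \<subseteq> Od"
  shows "pdk r b (xm \<alpha> u) = (if b \<le> \<alpha> r then xm (\<alpha>(r := \<alpha> r - b)) u else 0)"
proof (induction b)
  case (Suc b)
  have "\<alpha>(r := \<alpha> r - b) \<in> MI" by (rule MI_mono[OF \<alpha>(1)]) auto
  then have "pd r (xm (\<alpha>(r := \<alpha> r - b)) u) = (if \<alpha> r - b = 0 then 0 else xm (\<alpha>(r := \<alpha> r - Suc b)) u)"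
    using pd_even_mono[OF _ \<alpha>(2) r, of "\<alpha>(r := \<alpha> r - b)"] by simp
  then show ?case using Suc by (auto simp del: fun_upd_apply)
qed simp

lemma Hf_const: "Hf (xm 0 {}) = 0"
  by (rule ext) (simp add: Hf_app hasp_xm zero_fun_apply)

lemma Hf_xi: "a \<in> Ev \<Longrightarrow> Hf (xi a) = vf (scaleO (ta a) (xm 0 {})) (cj a)"
  by (rule ext) (auto simp: Hf_app pd_xi vf_def cj_eq)

lemma act_0: "act 0 F = 0" "act f 0 = 0"
  by (rule ext, simp add: act_app zero_fun_apply)+

lemma Theta_Hf:
  assumes "f \<in> Hev" "r \<in> Ev"
  shows "Theta p m n t r s (Hf f) = act \<omega> (Hf (pdk r (p ^ s) f))"
  using assms by (simp add: Theta_def N_Hf ad_ddx_power N_WE Hf_pdk Hev_hasp)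

text \<open>Matches the range of exponents in the theorem with the existence of the exceptional
  monomials: x_r^(q) lies in the algebra only if s <= t_r - 1, and then x_r^(q+1) lies in it
  too.\<close>

lemma p_power_le_pimax:
  assumes "r \<in> Ev" "s \<ge> 1"
  shows "p ^ s \<le> pimax r \<Longrightarrow> s \<le> t r - 1" and "s \<le> t r - 1 \<Longrightarrow> Suc (p ^ s) \<le> pimax r"
proof -
  assume "p ^ s \<le> pimax r"
  then have "p ^ s < p ^ t r" using pimax_Suc[OF assms(1)] by linarith
  then show "s \<le> t r - 1" using power_less_imp_less_exp[of p s "t r"] p_gt_3 by simp
next
  assume "s \<le> t r - 1"
  then have "Suc s \<le> t r" using t_pos[OF assms(1)] by simp
  then have "p ^ Suc s \<le> p ^ t r" using p_gt_3 by (intro power_increasing) auto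
  moreover have "5 * p ^ s \<le> p ^ Suc s" using p_ge_5 by simp
  ultimately show "Suc (p ^ s) \<le> pimax r"
    using pimax_Suc[OF assms(1)] p_power_facts(1)[OF assms(2)] by linarith
qed

lemma p_power_Suc_ne: "s \<ge> 1 \<Longrightarrow> s' \<ge> 1 \<Longrightarrow> p ^ s \<noteq> Suc (p ^ s')"
proof
  assume s: "s \<ge> 1" "s' \<ge> 1" and e: "p ^ s = Suc (p ^ s')"
  from p_power_facts(2)[OF s(1)] p_power_facts(2)[OF s(2)] show False
    unfolding e by (simp del: of_nat_power)
qed

section \<open>Correcting a derivation one degree at a time\<close>

lemma minus_sum_app: "(\<delta> - (\<Sum>r\<in>R. F r)) x = \<delta> x - (\<Sum>r\<in>R. F r x)" for \<delta> :: "'a vf_map"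
  by (simp add: minus_apply sum_fun_app[where x = x])

text \<open>In degree q only the pure powers x_r^(q) escape generation, and their values are those
  of multiples of \<open>Phi\<close>. Since \<partial>_r^q vanishes below degree q, subtracting
  these multiples spoils nothing achieved before.\<close>

lemma stage_p_power:
  assumes S: "VL.subspace S"
    and Phi: "\<And>r s. even n \<Longrightarrow> r \<in> Ev \<Longrightarrow> 1 \<le> s \<Longrightarrow> s \<le> t r - 1 \<Longrightarrow> n < p ^ s \<Longrightarrow> Phi p m n t r s \<in> S"
    and d: "\<delta> \<in> Dd k" "k \<le> - 1" "kills D \<delta>" and SD: "Suc D = p ^ s" "s \<ge> 1"
  shows "\<exists>\<rho>\<in>S. \<rho> \<in> Dd k \<and> kills (Suc D) (\<delta> - \<rho>)"
proof -
  let ?q = "p ^ s" let ?e = "\<lambda>r. 0(r := ?q)"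
  define R where "R = {r \<in> Ev. s \<le> t r - 1}"
  have Dr: "\<delta> \<in> Dr" using d Dd_Dr by blast
  have R: "r \<in> Ev" "?q \<le> pimax r" if "r \<in> R" for r
    using that p_power_le_pimax(2)[OF _ SD(2), of r] by (auto simp: R_def)
  have e: "?e r \<in> MI" "xm (?e r) {} \<in> Hev" "dg (?e r) = ?q" if "r \<in> R" for r
    using R[OF that] single_MI[of r ?q] Hev_ev single_ne_pimax dg_single by auto
  obtain c where c: "\<And>r. r \<in> R \<Longrightarrow> \<delta> (Hf (xm (?e r) {})) = scaleW (c r) (Hf \<omega>)"
    and c0: "\<And>r. r \<in> R \<Longrightarrow> odd n \<Longrightarrow> c r = 0"
    using value_p_power[OF Dr d(3) SD] R by metis
  define \<rho> where "\<rho> = (\<Sum>r\<in>R. scaleL (c r) (Phi p m n t r s))"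
  have tm: "scaleL (c r) (Phi p m n t r s) \<in> S \<and> scaleL (c r) (Phi p m n t r s) \<in> Dd k" if r: "r \<in> R" for r
  proof (cases "c r = 0")
    case True
    then show ?thesis using VL.subspace_0[OF S] VL.subspace_0[OF Dd_subspace] by simp
  next
    case False
    then have n: "even n" using c0[OF r] by blast
    obtain j where j: "j \<in> Od" using Od_ne by blast
    \<comment> \<open>If the scalar is nonzero, a component of degree n-1 is present. Comparing
      degrees gives k = n - q, so negative k yields n < q: this is the origin of the restriction on
      s in the theorem.\<close>
    have "homo (int ?q + k - 1) (scaleO (c r) (pd j \<omega>))"
      using Dd_homo[OF d(1) e(2)[OF r] homo_mono, of j] j n unfolding e(3)[OF r] c[OF r]
      by (simp add: scaleW_app Hf_app hasp_omega)
    moreover have "scaleO (c r) (pd j \<omega>) (0, Od - {j}) \<noteq> 0"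
      using False j by (simp add: pd_odd_mono scaleO_app) (simp add: xmono_def)
    ultimately have "int (mono_degree m 0 (Od - {j})) = int ?q + k - 1" unfolding homo_def by blast
    then have k: "k = int n - int ?q" using j n_gt_3 by (simp add: mono_degree_def of_nat_diff)
    then have "n < ?q" using d(2) by linarith
    then show ?thesis
      using Phi[OF n R(1)[OF r] SD(2)] r Phi_Dd[OF n R(1)[OF r], of s] k
      by (simp add: R_def VL.subspace_scale[OF S] VL.subspace_scale[OF Dd_subspace])
  qed
  have \<rho>: "\<rho> \<in> S" "\<rho> \<in> Dd k"
    unfolding \<rho>_def using tm by (auto intro: VL.subspace_sum[OF S] VL.subspace_sum[OF Dd_subspace])
  let ?\<delta> = "\<delta> - \<rho>"
  have \<delta>: "?\<delta> \<in> Dr" using VL.subspace_diff[OF Dd_subspace d(1) \<rho>(2)] Dd_Dr by blast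
  have ev: "?\<delta> (Hf f) = \<delta> (Hf f) - (\<Sum>r\<in>R. scaleW (c r) (act (pdk r ?q f) (Hf \<omega>)))" if "f \<in> Hev" for f
    unfolding \<rho>_def minus_sum_app using that R by (intro arg_cong2[where f = minus] sum.cong refl) (simp add: scaleL_app Phi_Hf)
  have kl: "kills D ?\<delta>"
  proof (rule killsI)
    fix \<alpha> u assume a: "\<alpha> \<in> MI" "u \<subseteq> Od" "even (card u)" "(\<alpha>, u) \<noteq> (pimax, {})" "(\<alpha>, u) \<noteq> (pimax, Od)" "dg \<alpha> + card u \<le> D"
    have "pdk r ?q (xm \<alpha> u) = 0" if "r \<in> R" for r
      using dg_ge[OF R(1)[OF that], of \<alpha>] a SD R(1)[OF that] by (simp add: pdk_mono)
    then show "?\<delta> (Hf (xm \<alpha> u)) = 0"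
      using ev[OF Hev_xm[OF a(1-5)]] killsD[OF d(3) a] by (simp add: act_0)
  qed
  have top: "?\<delta> (Hf (xm (?e a) {})) = 0" if a: "a \<in> R" for a
  proof -
    have "pdk r ?q (xm (?e a) {}) = (if r = a then xm 0 {} else 0)" if "r \<in> R" for r
      using pdk_mono[OF R(1)[OF that] e(1)[OF a], of "{}" ?q] p_gt_3 by auto
    then have "(\<Sum>r\<in>R. scaleW (c r) (act (pdk r ?q (xm (?e a) {})) (Hf \<omega>))) =
        (\<Sum>r\<in>R. if r = a then scaleW (c a) (act (xm 0 {}) (Hf \<omega>)) else 0)"
      by (intro sum.cong refl) (auto simp: act_0)
    also have "\<dots> = scaleW (c a) (act (xm 0 {}) (Hf \<omega>))" using a by (simp add: R_def)
    finally have s: "(\<Sum>r\<in>R. scaleW (c r) (act (pdk r ?q (xm (?e a) {})) (Hf \<omega>))) = scaleW (c a) (act (xm 0 {}) (Hf \<omega>))" .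
    have one: "scaleW (c a) (act (xm 0 {}) (Hf \<omega>)) = scaleW (c a) (Hf \<omega>)"
    proof (cases "c a = 0")
      case False
      then have "Hf \<omega> \<in> WE" using c0[OF a] by (intro Hf_WE hasp_omega) blast
      then have "act (xm 0 {}) (Hf \<omega>) = Hf \<omega>" by (intro ext) (simp add: act_app mul_one WE_OA)
      then show ?thesis by (rule arg_cong)
    qed simp
    show ?thesis unfolding ev[OF e(2)[OF a]] s c[OF a] one by simp
  qed
  have D3: "D \<ge> 3" using p_power_facts(1)[OF SD(2)] SD(1) by simp
  interpret pb_generated p m n t ty "kern ?\<delta>" D by (rule kills_generated[OF \<delta> kl D3])
  have "kills (Suc D) ?\<delta>"
  proof (rule kills_SucI[OF kl])
    fix \<alpha> u assume a: "\<alpha> \<in> MI" "u \<subseteq> Od" "even (card u)" "(\<alpha>, u) \<noteq> (pimax, {})" "(\<alpha>, u) \<noteq> (pimax, Od)" "dg \<alpha> + card u = Suc D"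
    have "xm \<alpha> u \<in> kern ?\<delta>"
    proof (cases "u = {}")
      case False
      then show ?thesis using a by (intro gen_odd) auto
    next
      case True
      have dg: "dg \<alpha> = ?q" using a True SD by simp
      show ?thesis
      proof (cases "\<exists>j\<in>Ev. \<alpha> j = ?q")
        case True
        then obtain j where j: "j \<in> Ev" "\<alpha> j = ?q" by blast
        then have "\<alpha> = ?e j" using dg_single_eq[OF a(1) j(1)] dg by simp
        moreover have "j \<in> R" using j p_power_le_pimax(1)[OF j(1) SD(2)] MI_le[OF a(1), of j] by (simp add: R_def)
        ultimately show ?thesis using top[of j] e[of j] \<open>u = {}\<close> by (simp add: kern_def)
      next
        case False
        have "xm \<alpha> {} \<in> kern ?\<delta>"
        proof (rule gen_even[OF a(1)])
          fix j s' assume j: "j \<in> Ev" "s' \<ge> (1 :: nat)"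
          show False if "\<alpha> j = p ^ s'" "dg \<alpha> \<le> Suc (\<alpha> j)"
            using that False j dg dg_ge[OF j(1), of \<alpha>] p_power_Suc_ne[OF SD(2) j(2)] by (auto simp: le_Suc_eq)
          show False if "\<alpha> j = Suc (p ^ s')" "dg \<alpha> = \<alpha> j"
            using that dg p_power_Suc_ne[OF SD(2) j(2)] by simp
        qed (use a dg SD True in auto)
        then show ?thesis using True by simp
      qed
    qed
    then show "?\<delta> (Hf (xm \<alpha> u)) = 0" by (simp add: kern_def)
  qed
  with \<rho> show ?thesis by blast
qed

text \<open>In degree q+1 the pure powers x_r^(q+1) are corrected by multiples of (ad
  \<partial>_r)^q and \<open>Theta\<close>; the other exceptional monomials x_r^(q) x_l then follow
  from them by a quadratic bracket.\<close>

lemma stage_p_power_Suc: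
  assumes S: "VL.subspace S"
    and Th: "\<And>r s. even n \<Longrightarrow> r \<in> Ev \<Longrightarrow> 1 \<le> s \<Longrightarrow> s \<le> t r - 1 \<Longrightarrow> n < p ^ s \<Longrightarrow> Theta p m n t r s \<in> S"
    and Ad: "\<And>r s. r \<in> Ev \<Longrightarrow> 1 \<le> s \<Longrightarrow> s \<le> t r - 1 \<Longrightarrow> rs (Dl r (p ^ s)) \<in> S"
    and d: "\<delta> \<in> Dd k" "k \<le> - 1" "kills D \<delta>" and SD: "D = p ^ s" "s \<ge> 1"
  shows "\<exists>\<rho>\<in>S. \<rho> \<in> Dd k \<and> kills (Suc D) (\<delta> - \<rho>)"
proof -
  let ?q = "p ^ s" let ?e = "\<lambda>r. 0(r := Suc ?q)"
  define R where "R = {r \<in> Ev. s \<le> t r - 1}"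
  have fR: "finite R" by (simp add: R_def)
  have Dr: "\<delta> \<in> Dr" using d Dd_Dr by blast
  have R: "r \<in> Ev" "Suc ?q \<le> pimax r" if "r \<in> R" for r
    using that p_power_le_pimax(2)[OF _ SD(2), of r] by (auto simp: R_def)
  have e: "?e r \<in> MI" "xm (?e r) {} \<in> Hev" "dg (?e r) = Suc ?q" if "r \<in> R" for r
    using R[OF that] single_MI[of r "Suc ?q"] Hev_ev single_ne_pimax dg_single by auto
  obtain a b where ab: "\<And>r. r \<in> R \<Longrightarrow> \<delta> (Hf (xm (?e r) {})) = vf (scaleO (a r) (xm 0 {}) + scaleO (b r) \<omega>) (cj r)"
    and b0: "\<And>r. r \<in> R \<Longrightarrow> odd n \<Longrightarrow> b r = 0"
    using value_p_power_Suc[OF Dr d(3) SD] R by metis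
  \<comment> \<open>On x_r^(q+1) the q-th derivative leaves x_r, and D_H(x_r) is \<open>ta r\<close>
    times \<partial>_r'. The extra factor \<open>ta r\<close> compensates this sign.\<close>
  let ?A = "\<lambda>r. scaleL (ta r * a r) (rs (Dl r ?q))" and ?B = "\<lambda>r. scaleL (ta r * b r) (Theta p m n t r s)"
  define \<rho> where "\<rho> = (\<Sum>r\<in>R. ?A r + ?B r)"
  have hom: "homo (int ?q + k) (scaleO (a r) (xm 0 {}) + scaleO (b r) \<omega>)" if r: "r \<in> R" for r
    using Dd_homo[OF d(1) e(2)[OF r] homo_mono, of "cj r"] unfolding e(3)[OF r] ab[OF r]
    by (simp add: vf_def)
  have tA: "?A r \<in> S \<and> ?A r \<in> Dd k" if r: "r \<in> R" for r
  proof (cases "a r = 0")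
    case True
    then show ?thesis using VL.subspace_0[OF S] VL.subspace_0[OF Dd_subspace] by simp
  next
    case False
    \<comment> \<open>The degree of the derivation is read off from the terms present: a constant
      term forces k = -q, and in the next block an x^\<omega> term forces k = n - q.\<close>
    have "(scaleO (a r) (xm 0 {}) + scaleO (b r) \<omega>) (0, {}) = a r"
      by (simp add: plus_fun_apply scaleO_app) (simp add: xmono_def)
    then have "int (mono_degree m 0 {}) = int ?q + k" using hom[OF r] False unfolding homo_def by metis
    then have k: "k = - int ?q" by (simp add: mono_degree_def)
    then show ?thesis
      using Ad[OF R(1)[OF r] SD(2)] r Dl_Dd[OF R(1)[OF r], of s]
      by (simp add: R_def VL.subspace_scale[OF S] VL.subspace_scale[OF Dd_subspace])
  qed
  have tB: "?B r \<in> S \<and> ?B r \<in> Dd k" if r: "r \<in> R" for r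
  proof (cases "b r = 0")
    case True
    then show ?thesis using VL.subspace_0[OF S] VL.subspace_0[OF Dd_subspace] by simp
  next
    case False
    then have n: "even n" using b0[OF r] by blast
    have "(scaleO (a r) (xm 0 {}) + scaleO (b r) \<omega>) (0, Od) = b r"
      by (simp add: plus_fun_apply scaleO_app) (simp add: xmono_def)
    then have "int (mono_degree m 0 Od) = int ?q + k" using hom[OF r] False unfolding homo_def by metis
    then have k: "k = int n - int ?q" by (simp add: mono_degree_def)
    then have "n < ?q" using d(2) by linarith
    then show ?thesis
      using Th[OF n R(1)[OF r] SD(2)] r Theta_Dd[OF n R(1)[OF r], of s] k
      by (simp add: R_def VL.subspace_scale[OF S] VL.subspace_scale[OF Dd_subspace])
  qed
  have \<rho>: "\<rho> \<in> S" "\<rho> \<in> Dd k"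
    unfolding \<rho>_def using tA tB
    by (auto intro!: VL.subspace_sum[OF S] VL.subspace_sum[OF Dd_subspace] VL.subspace_add[OF S] VL.subspace_add[OF Dd_subspace])
  let ?\<delta> = "\<delta> - \<rho>"
  have \<delta>: "?\<delta> \<in> Dr" using VL.subspace_diff[OF Dd_subspace d(1) \<rho>(2)] Dd_Dr by blast
  let ?T = "\<lambda>r f. scaleW (ta r * a r) (Hf (pdk r ?q f)) + scaleW (ta r * b r) (act \<omega> (Hf (pdk r ?q f)))"
  have ev: "?\<delta> (Hf f) = \<delta> (Hf f) - (\<Sum>r\<in>R. ?T r f)" if f: "f \<in> Hev" for f
    unfolding \<rho>_def minus_sum_app
  proof (intro arg_cong2[where f = minus] sum.cong refl)
    fix r assume r: "r \<in> R"
    show "(?A r + ?B r) (Hf f) = ?T r f"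
      using R(1)[OF r] f by (simp add: plus_fun_apply[of "scaleL _ _"] scaleL_app N_Hf Hf_pdk Hev_hasp Theta_Hf)
  qed
  have kl: "kills D ?\<delta>"
  proof (rule killsI)
    fix \<alpha> u assume h: "\<alpha> \<in> MI" "u \<subseteq> Od" "even (card u)" "(\<alpha>, u) \<noteq> (pimax, {})" "(\<alpha>, u) \<noteq> (pimax, Od)" "dg \<alpha> + card u \<le> D"
    \<comment> \<open>In degree at most q the q-th derivative is zero or, for x_r^(q), the constant
      1, which \<open>Hf\<close> kills. So the correction is invisible in lower degrees.\<close>
    have "Hf (pdk r ?q (xm \<alpha> u)) = 0" if r: "r \<in> R" for r
    proof (cases "?q \<le> \<alpha> r")
      case True
      have g: "\<alpha> r \<le> dg \<alpha>" by (rule dg_ge[OF R(1)[OF r]])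
      then have al: "\<alpha> r = ?q" "dg \<alpha> \<le> \<alpha> r" "card u = 0" using True h SD by linarith+
      then have "\<alpha> = 0(r := ?q)" "u = {}" using dg_single_eq[OF h(1) R(1)[OF r]] h(2) finite_sub_Od by auto
      then have "pdk r ?q (xm \<alpha> u) = xm 0 {}" using pdk_mono[OF R(1)[OF r] h(1,2), of ?q] al by simp
      then show ?thesis by (simp add: Hf_const)
    next
      case False
      then show ?thesis using pdk_mono[OF R(1)[OF r] h(1,2), of ?q] by simp
    qed
    then show "?\<delta> (Hf (xm \<alpha> u)) = 0"
      using ev[OF Hev_xm[OF h(1-5)]] killsD[OF d(3) h] by (simp add: act_0)
  qed
  have top: "?\<delta> (Hf (xm (?e r0) {})) = 0" if r0: "r0 \<in> R" for r0
  proof -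
    let ?v = "vf (scaleO (a r0) (xm 0 {}) + scaleO (b r0) \<omega>) (cj r0)"
    have P: "pdk r ?q (xm (?e r0) {}) = (if r = r0 then xi r0 else 0)" if "r \<in> R" for r
      using pdk_mono[OF R(1)[OF that] e(1)[OF r0], of "{}" ?q] p_gt_3 by (auto simp: Suc_diff_le)
    have V: "scaleW (ta r0 * a r0) (Hf (xi r0)) + scaleW (ta r0 * b r0) (act \<omega> (Hf (xi r0))) = ?v"
    proof
      fix j
      show "(scaleW (ta r0 * a r0) (Hf (xi r0)) + scaleW (ta r0 * b r0) (act \<omega> (Hf (xi r0)))) j = ?v j"
        using ta_sq[of r0] by (simp add: plus_fun_apply scaleW_app act_app Hf_xi[OF R(1)[OF r0]] vf_def mul_scale_right mul_one_right
            mult.assoc mult.left_commute[of "ta r0"] flip: mult.assoc[of "ta r0" "ta r0"])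
    qed
    have "(\<Sum>r\<in>R. ?T r (xm (?e r0) {})) = (\<Sum>r\<in>R. if r = r0 then ?v else 0)"
      by (intro sum.cong refl) (use P V in \<open>auto simp: act_0\<close>)
    also have "\<dots> = ?v" using r0 fR by simp
    finally have s: "(\<Sum>r\<in>R. ?T r (xm (?e r0) {})) = ?v" .
    show ?thesis unfolding ev[OF e(2)[OF r0]] s ab[OF r0] by simp
  qed
  have D3: "D \<ge> 3" using p_power_facts(1)[OF SD(2)] SD(1) by simp
  interpret pb_generated p m n t ty "kern ?\<delta>" D by (rule kills_generated[OF \<delta> kl D3])
  have topZ: "xm (?e r) {} \<in> kern ?\<delta>" if "r \<in> R" for r
    using top[OF that] e(2)[OF that] by (simp add: kern_def)
  have "kills (Suc D) ?\<delta>"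
  proof (rule kills_SucI[OF kl])
    fix \<alpha> u assume h: "\<alpha> \<in> MI" "u \<subseteq> Od" "even (card u)" "(\<alpha>, u) \<noteq> (pimax, {})" "(\<alpha>, u) \<noteq> (pimax, Od)" "dg \<alpha> + card u = Suc D"
    have "xm \<alpha> u \<in> kern ?\<delta>"
    proof (cases "u = {}")
      case False
      then show ?thesis using h by (intro gen_odd) auto
    next
      case u: True
      have dg: "dg \<alpha> = Suc ?q" using h u SD by simp
      have inR: "j \<in> R" if "j \<in> Ev" "?q \<le> \<alpha> j" for j
        using that p_power_le_pimax(1)[OF that(1) SD(2)] MI_le[OF h(1), of j] by (simp add: R_def)
      consider j where "j \<in> Ev" "\<alpha> j = Suc ?q" | j where "j \<in> Ev" "\<alpha> j = ?q"
        | "\<forall>j\<in>Ev. \<alpha> j \<noteq> Suc ?q \<and> \<alpha> j \<noteq> ?q" by blast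
      then show ?thesis
      proof cases
        case 1
        then have "\<alpha> = ?e j" using dg_single_eq[OF h(1) 1(1)] dg by simp
        then show ?thesis using topZ[OF inR[OF 1(1)]] 1 u by simp
      next
        \<comment> \<open>An exceptional monomial x_j^(q) x_l: raise it to the pure power x_j^(q+1),
          already in the kernel after the correction.\<close>
        case 2
        have jR: "j \<in> R" using inR 2 by simp
        have "xm \<alpha> {} \<in> kern ?\<delta>"
        proof (rule Z_raise[OF xi_xi_Z])
          show "xm (0(l := 2)) {} \<in> kern ?\<delta>" if "l \<in> Ev" for l
            using that D3 pimax_ge_3[OF that] dg_single[OF that, of 2] by (intro low_ev single_MI single_ne_pimax) auto
          show "\<alpha> j < pimax j" "2 \<le> \<alpha> j" using R(2)[OF jR] 2 p_power_facts(1)[OF SD(2)] by auto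
          show "xm (0(j := Suc (\<alpha> j))) {} \<in> kern ?\<delta>" unfolding 2(2) by (rule topZ[OF jR])
        qed (use 2 dg h in auto)
        then show ?thesis using u by simp
      next
        case 3
        have "xm \<alpha> {} \<in> kern ?\<delta>"
        proof (rule gen_even[OF h(1)])
          fix j s' assume j: "j \<in> Ev" "s' \<ge> (1 :: nat)"
          show False if "\<alpha> j = p ^ s'" "dg \<alpha> \<le> Suc (\<alpha> j)"
          proof -
            have "\<alpha> j = Suc ?q \<or> \<alpha> j = ?q" using that(2) dg dg_ge[OF j(1), of \<alpha>] by linarith
            then show False using 3 j(1) by blast
          qed
          show False if "dg \<alpha> = \<alpha> j"
            using that 3 j(1) unfolding dg by metis
        qed (use h dg SD u in auto)
        then show ?thesis using u by simp
      qed
    qed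
    then show "?\<delta> (Hf (xm \<alpha> u)) = 0" by (simp add: kern_def)
  qed
  with \<rho> show ?thesis by blast
qed

text \<open>Targets have degree D+1. A pure power x_j^(q) can occur only if D+1 = q, and x_j^(q+1)
  or x_j^(q) x_l only if D = q; otherwise generation has no exceptions.\<close>

lemma stage_generic:
  assumes d: "\<delta> \<in> Dr" "kills D \<delta>" "D \<ge> 3"
    and no: "\<And>s. s \<ge> 1 \<Longrightarrow> Suc D \<noteq> p ^ s" "\<And>s. s \<ge> 1 \<Longrightarrow> D \<noteq> p ^ s"
  shows "kills (Suc D) \<delta>"
proof -
  interpret pb_generated p m n t ty "kern \<delta>" D by (rule kills_generated[OF d])
  show ?thesis
  proof (rule kills_SucI[OF d(2)])
    fix \<alpha> u assume h: "\<alpha> \<in> MI" "u \<subseteq> Od" "even (card u)" "(\<alpha>, u) \<noteq> (pimax, {})" "(\<alpha>, u) \<noteq> (pimax, Od)" "dg \<alpha> + card u = Suc D"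
    have "xm \<alpha> u \<in> kern \<delta>"
    proof (cases "u = {}")
      case False
      then show ?thesis using h by (intro gen_odd) auto
    next
      case u: True
      have "xm \<alpha> {} \<in> kern \<delta>"
      proof (rule gen_even[OF h(1)])
        show dg: "dg \<alpha> = Suc D" using h u by simp
        fix j s assume j: "j \<in> Ev" "s \<ge> (1 :: nat)"
        show False if "\<alpha> j = p ^ s" "dg \<alpha> \<le> Suc (\<alpha> j)"
          using that dg dg_ge[OF j(1), of \<alpha>] no[OF j(2)] by (auto simp: le_Suc_eq)
        show False if "\<alpha> j = Suc (p ^ s)" "dg \<alpha> = \<alpha> j"
          using that dg no[OF j(2)] by auto
      qed (use h u in auto)
      then show ?thesis using u by simp
    qed
    then show "\<delta> (Hf (xm \<alpha> u)) = 0" by (simp add: kern_def)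
  qed
qed

text \<open>\<open>S\<close> is an arbitrary subspace containing the required maps, so one argument
  serves both parities of n. The stages are iterated from degree 3, and every correction stays in
  \<open>Dd k\<close>, so that the next stage applies again.\<close>

lemma Dd_subset:
  assumes S: "VL.subspace S"
    and E: "\<And>E. E \<in> W_even_deg p m n t (- 1) \<Longrightarrow> rs (br E) \<in> S"
    and Phi: "\<And>r s. even n \<Longrightarrow> r \<in> Ev \<Longrightarrow> 1 \<le> s \<Longrightarrow> s \<le> t r - 1 \<Longrightarrow> n < p ^ s \<Longrightarrow> Phi p m n t r s \<in> S"
    and Th: "\<And>r s. even n \<Longrightarrow> r \<in> Ev \<Longrightarrow> 1 \<le> s \<Longrightarrow> s \<le> t r - 1 \<Longrightarrow> n < p ^ s \<Longrightarrow> Theta p m n t r s \<in> S"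
    and Ad: "\<And>r s. r \<in> Ev \<Longrightarrow> 1 \<le> s \<Longrightarrow> s \<le> t r - 1 \<Longrightarrow> rs (Dl r (p ^ s)) \<in> S"
    and d: "\<delta> \<in> Dd k" "k \<le> - 1"
  shows "\<delta> \<in> S"
proof -
  have stages: "\<exists>\<rho>\<in>S. \<rho> \<in> Dd k \<and> kills (3 + D) (\<delta> - \<rho>)" for D
  proof (induction D)
    case 0
    obtain E' where E': "E' \<in> W_even_deg p m n t (- 1)" "rs (br E') \<in> Dd k" "kills 2 (\<delta> - rs (br E'))"
      using stage_2[OF d] by blast
    have "\<delta> - rs (br E') \<in> Dd k" using VL.subspace_diff[OF Dd_subspace d(1) E'(2)] .
    from stage_3[OF this d(2) E'(3)] show ?case using E' E by auto
  next
    case (Suc D)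
    then obtain \<rho> where \<rho>: "\<rho> \<in> S" "\<rho> \<in> Dd k" "kills (3 + D) (\<delta> - \<rho>)" by blast
    have \<delta>: "\<delta> - \<rho> \<in> Dd k" by (rule VL.subspace_diff[OF Dd_subspace d(1) \<rho>(2)])
    have "\<exists>\<rho>'\<in>S. \<rho>' \<in> Dd k \<and> kills (Suc (3 + D)) (\<delta> - \<rho> - \<rho>')"
    proof (cases "\<exists>s\<ge>1. Suc (3 + D) = p ^ s")
      case True
      then obtain s where "Suc (3 + D) = p ^ s" "s \<ge> 1" by blast
      from stage_p_power[OF S Phi \<delta> d(2) \<rho>(3) this] show ?thesis .
    next
      case no1: False
      show ?thesis
      proof (cases "\<exists>s\<ge>1. 3 + D = p ^ s")
        case True
        then obtain s where "3 + D = p ^ s" "s \<ge> 1" by blast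
        from stage_p_power_Suc[OF S Th Ad \<delta> d(2) \<rho>(3) this] show ?thesis .
      next
        case False
        have "kills (Suc (3 + D)) (\<delta> - \<rho>)"
          using no1 False by (intro stage_generic[OF Dd_Dr[OF \<delta>] \<rho>(3)]) auto
        then show ?thesis using VL.subspace_0[OF S] VL.subspace_0[OF Dd_subspace] by (intro bexI[of _ 0]) auto
      qed
    qed
    then obtain \<rho>' where \<rho>': "\<rho>' \<in> S" "\<rho>' \<in> Dd k" "kills (Suc (3 + D)) (\<delta> - (\<rho> + \<rho>'))"
      by (auto simp: diff_diff_eq)
    then show ?case using VL.subspace_add[OF S \<rho>(1) \<rho>'(1)] VL.subspace_add[OF Dd_subspace \<rho>(2) \<rho>'(2)]
      by (intro bexI[of _ "\<rho> + \<rho>'"]) auto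
  qed
  \<comment> \<open>No monomial has degree above \<open>dg pimax + n\<close>, so the corrected
    derivation is zero.\<close>
  obtain \<rho> where \<rho>: "\<rho> \<in> S" "\<rho> \<in> Dd k" "kills (3 + (dg pimax + n)) (\<delta> - \<rho>)" using stages by blast
  have \<delta>: "\<delta> - \<rho> \<in> Dr" using VL.subspace_diff[OF Dd_subspace d(1) \<rho>(2)] Dd_Dr by blast
  interpret pb_subalgebra p m n t ty "kern (\<delta> - \<rho>)" by (rule kern_subalgebra[OF \<delta>])
  have "f \<in> kern (\<delta> - \<rho>)" if "f \<in> Hev" for f
    using that
  proof (induction f rule: Hev_induct)
    case zero
    show ?case using Dr_scale[OF \<delta> Hev_0, of 0] by (simp add: kern_def)
  next
    case (mono \<alpha> u)
    have "dg \<alpha> \<le> dg pimax" using MI_le[OF mono(1)] by (rule sum_mono)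
    moreover have "card u \<le> n" using card_mono[OF finite_Od mono(2)] by simp
    ultimately have "(\<delta> - \<rho>) (Hf (xm \<alpha> u)) = 0" using mono by (intro killsD[OF \<rho>(3)]) auto
    then show ?case using Hev_xm[OF mono] by (simp add: kern_def)
  qed (auto intro: Z_add Z_scale)
  then have z: "(\<delta> - \<rho>) x = 0" for x
    using Dr_out[OF \<delta>, of x] by (cases "x \<in> NA") (auto simp: N_eq kern_def)
  have "\<delta> = \<rho>"
  proof
    fix x show "\<delta> x = \<rho> x" using z[of x] by (simp add: minus_apply[of \<delta>])
  qed
  then show ?thesis using \<rho>(1) by simp
qed

section \<open>Both sides of the decomposition as subspaces\<close>

lemma subspace_ad: "VL.subspace ((\<lambda>E. rs (br E)) ` W_even_deg p m n t (- 1))"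
proof (rule VL.subspaceI)
  let ?W = "W_even_deg p m n t (- 1) :: 'a super_vf set"
  have z: "(0 :: 'a super_vf) \<in> ?W" unfolding WED_iff by (simp add: zero_fun_apply)
  have W: "E \<in> WE" if "E \<in> ?W" for E using that by (simp add: WED_iff)
  have a: "rs (br (E + F)) = rs (br E) + rs (br F)" if "E \<in> ?W" "F \<in> ?W" for E F
    using W[OF that(1)] W[OF that(2)]
    by (intro ext) (auto simp: restr_def plus_fun_apply br_app N_WE WE_add app_add app_add_left zero_fun_apply minus_apply)
  have s: "rs (br (scaleW c E)) = scaleL c (rs (br E))" if "E \<in> ?W" for E c
    using W[OF that] by (intro ext) (auto simp: restr_def scaleL_app scaleW_app br_app N_WE WE_scale app_scale app_scale_left VO.scale_right_diff_distrib zero_fun_apply)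
  show "0 \<in> (\<lambda>E. rs (br E)) ` ?W"
    using s[OF z, of 0] z by (intro image_eqI[of _ _ 0]) auto
  fix x y c assume x: "x \<in> (\<lambda>E. rs (br E)) ` ?W"
  then obtain E where E: "x = rs (br E)" "E \<in> ?W" by blast
  then have "scaleW c E \<in> ?W" by (simp add: WED_iff WE_scale scaleW_app homo_scale)
  then show "scaleL c x \<in> (\<lambda>E. rs (br E)) ` ?W" using s[OF E(2), of c] E by (intro image_eqI) auto
  assume "y \<in> (\<lambda>E. rs (br E)) ` ?W"
  then obtain F where F: "y = rs (br F)" "F \<in> ?W" by blast
  have "E + F \<in> ?W" using E F by (simp add: WED_iff WE_add plus_fun_apply homo_add)
  then show "x + y \<in> (\<lambda>E. rs (br E)) ` ?W" using a[OF E(2) F(2)] E F by (intro image_eqI) auto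
qed

lemma Der_neg_subspace: "VL.subspace (Der_neg p m n t)"
  unfolding Der_neg_def by (rule VL.subspace_span)

lemma Der_neg_subset:
  assumes "VL.subspace S" "\<And>\<delta> k. \<delta> \<in> Dd k \<Longrightarrow> k \<le> - 1 \<Longrightarrow> \<delta> \<in> S"
  shows "Der_neg p m n t \<subseteq> S"
  unfolding Der_neg_def by (rule VL.span_minimal) (use assms in auto)

abbreviation adW :: "'a vf_map set" where "adW \<equiv> (\<lambda>E. rs (br E)) ` W_even_deg p m n t (- 1)"
abbreviation powers :: "'a vf_map set" where
  "powers \<equiv> \<Sum>r\<in>Ev. \<Sum>s\<in>{1..t r - 1}. line (rs (br (ddx r) ^^ (p ^ s)))"
abbreviation outer :: "'a vf_map set" where
  "outer \<equiv> \<Sum>r\<in>{1..2*m}. \<Sum>s\<in>{s. 1 \<le> s \<and> s \<le> t r - 1 \<and> int n - int p ^ s < 0}.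
     line (Phi p m n t r s) + line (Theta p m n t r s)"

lemma powers_subspace: "VL.subspace powers"
  by (intro subspaceL_sum subspaceL_line)

lemma outer_subspace: "VL.subspace outer"
  by (intro subspaceL_sum subspaceL_plus subspaceL_line)

lemma adW_subset: "adW \<subseteq> Der_neg p m n t"
  using ad_Dd Dd_subset_neg by blast

lemma powers_subset: "powers \<subseteq> Der_neg p m n t"
proof (intro set_sum_subset line_subset Der_neg_subspace)
  fix r s assume r: "r \<in> Ev"
  have "- int (p ^ s) \<le> - 1" using p_gt_3 by (simp add: Suc_le_eq)
  then show "rs (br (ddx r) ^^ (p ^ s)) \<in> Der_neg p m n t"
    unfolding rs_ad_ddx[OF r] using Dl_Dd[OF r] by (rule Dd_subset_neg)
qed

lemma outer_subset:
  assumes "even n" shows "outer \<subseteq> Der_neg p m n t"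
proof (intro set_sum_subset set_plus_subset line_subset Der_neg_subspace)
  fix r s assume rs: "r \<in> {1..2*m}" "s \<in> {s. 1 \<le> s \<and> s \<le> t r - 1 \<and> int n - int p ^ s < 0}"
  then have r: "r \<in> Ev" and "int n - int p ^ s < 0" by (simp_all add: Y0_def)
  then have k: "int n - int (p ^ s) \<le> - 1" unfolding of_nat_power by linarith
  show "(Phi p m n t r s :: 'a vf_map) \<in> Der_neg p m n t" by (rule Dd_subset_neg[OF k Phi_Dd[OF assms r]])
  show "(Theta p m n t r s :: 'a vf_map) \<in> Der_neg p m n t" by (rule Dd_subset_neg[OF k Theta_Dd[OF assms r]])
qed

lemma powers_mem:
  assumes "r \<in> Ev" "1 \<le> s" "s \<le> t r - 1" shows "rs (Dl r (p ^ s)) \<in> powers"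
proof -
  have "rs (br (ddx r) ^^ (p ^ s)) \<in> line (rs (br (ddx r) ^^ (p ^ s)))"
    unfolding line_def by (auto intro!: exI[of _ 1])
  also have "\<dots> \<subseteq> (\<Sum>s\<in>{1..t r - 1}. line (rs (br (ddx r) ^^ (p ^ s))))"
    using assms by (intro subset_set_sum subspaceL_line) auto
  also have "\<dots> \<subseteq> powers"
    using assms(1) by (intro subset_set_sum[of Ev r "\<lambda>r. \<Sum>s\<in>{1..t r - 1}. line (rs (br (ddx r) ^^ (p ^ s)))"]
        subspaceL_sum subspaceL_line) auto
  finally show ?thesis unfolding rs_ad_ddx[OF assms(1)] .
qed

lemma outer_mem:
  assumes "r \<in> Ev" "1 \<le> s" "s \<le> t r - 1" "n < p ^ s"
  shows "Phi p m n t r s \<in> outer" "Theta p m n t r s \<in> outer"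
proof -
  let ?I = "{s. 1 \<le> s \<and> s \<le> t r - 1 \<and> int n - int p ^ s < 0}"
  let ?L = "\<lambda>r s. line (Phi p m n t r s) + line (Theta p m n t r s) :: 'a vf_map set"
  have "int n < int (p ^ s)" using assms by (simp only: of_nat_less_iff)
  then have s: "s \<in> ?I" using assms by simp
  have "finite ?I" by (rule finite_subset[of _ "{..t r - 1}"]) auto
  then have "?L r s \<subseteq> (\<Sum>s\<in>?I. ?L r s)"
    using s by (intro subset_set_sum subspaceL_plus subspaceL_line) auto
  also have "\<dots> \<subseteq> outer"
    using assms(1) by (intro subset_set_sum[of "{1..2*m}" r "\<lambda>r. \<Sum>s\<in>{s. 1 \<le> s \<and> s \<le> t r - 1 \<and> int n - int p ^ s < 0}. ?L r s"]
        subspaceL_sum subspaceL_plus subspaceL_line) (auto simp: Y0_def)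
  finally have L: "?L r s \<subseteq> outer" .
  have l: "\<phi> \<in> line \<phi>" for \<phi> :: "'a vf_map" unfolding line_def by (auto intro!: exI[of _ 1])
  show "Phi p m n t r s \<in> outer" using L l subset_plus_left[OF subspaceL_line] by blast
  show "Theta p m n t r s \<in> outer" using L l subset_plus_right[OF subspaceL_line] by blast
qed

lemma Der_neg_odd:
  assumes "odd n" shows "Der_neg p m n t = adW + powers"
proof
  have S: "VL.subspace (adW + powers)" by (intro subspaceL_plus subspace_ad powers_subspace)
  show "Der_neg p m n t \<subseteq> adW + powers"
  proof (rule Der_neg_subset[OF S])
    fix \<delta> k assume d: "\<delta> \<in> Dd k" "k \<le> - 1"
    show "\<delta> \<in> adW + powers"
    proof (rule Dd_subset[OF S _ _ _ _ d])
      show "rs (br E) \<in> adW + powers" if "E \<in> W_even_deg p m n t (- 1)" for E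
        by (rule subsetD[OF subset_plus_left[OF powers_subspace]], rule imageI) (rule that)
      show "rs (Dl r (p ^ s)) \<in> adW + powers" if "r \<in> Ev" "1 \<le> s" "s \<le> t r - 1" for r s
        by (rule subsetD[OF subset_plus_right[OF subspace_ad] powers_mem[OF that]])
    qed (use assms in blast)+
  qed
  show "adW + powers \<subseteq> Der_neg p m n t"
    by (rule set_plus_subset[OF Der_neg_subspace adW_subset powers_subset])
qed

lemma Der_neg_even:
  assumes "even n" shows "Der_neg p m n t = adW + outer + powers"
proof
  have AO: "VL.subspace (adW + outer)" by (intro subspaceL_plus subspace_ad outer_subspace)
  have S: "VL.subspace (adW + outer + powers)" by (intro subspaceL_plus AO powers_subspace)
  have sub: "adW \<subseteq> adW + outer + powers" "outer \<subseteq> adW + outer + powers" "powers \<subseteq> adW + outer + powers"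
    by (rule order.trans[OF subset_plus_left[OF outer_subspace] subset_plus_left[OF powers_subspace]],
        rule order.trans[OF subset_plus_right[OF subspace_ad] subset_plus_left[OF powers_subspace]],
        rule subset_plus_right[OF AO])
  show "Der_neg p m n t \<subseteq> adW + outer + powers"
  proof (rule Der_neg_subset[OF S])
    fix \<delta> k assume d: "\<delta> \<in> Dd k" "k \<le> - 1"
    show "\<delta> \<in> adW + outer + powers"
    proof (rule Dd_subset[OF S _ _ _ _ d])
      show "rs (br E) \<in> adW + outer + powers" if "E \<in> W_even_deg p m n t (- 1)" for E
        by (rule subsetD[OF sub(1)], rule imageI) (rule that)
      fix r s assume r: "r \<in> Ev" "1 \<le> s" "s \<le> t r - 1"
      show "rs (Dl r (p ^ s)) \<in> adW + outer + powers" by (rule subsetD[OF sub(3) powers_mem[OF r]])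
      assume q: "n < p ^ s"
      show "Phi p m n t r s \<in> adW + outer + powers" by (rule subsetD[OF sub(2) outer_mem(1)[OF r q]])
      show "Theta p m n t r s \<in> adW + outer + powers" by (rule subsetD[OF sub(2) outer_mem(2)[OF r q]])
    qed
  qed
  show "adW + outer + powers \<subseteq> Der_neg p m n t"
    by (intro set_plus_subset Der_neg_subspace adW_subset powers_subset outer_subset assms)
qed

end

theorem theorem4p10:
  fixes p m n :: nat and t :: "nat \<Rightarrow> nat"
  assumes "CHAR('a::field) = p" and "p > 3" and "m > 1" and "n > 3"
    and "\<And>i. i \<in> Y0 m \<Longrightarrow> t i > 0"
  shows "(even n \<longrightarrow>
      (Der_neg p m n t :: 'a vf_map set) =
        (\<lambda>E. restr p m n t (ad p m n t E)) ` W_even_deg p m n t (- 1)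
        + (\<Sum>r\<in>{1..2*m}. \<Sum>s\<in>{s. 1 \<le> s \<and> s \<le> t r - 1 \<and> int n - int p ^ s < 0}.
             line (Phi p m n t r s) + line (Theta p m n t r s))
        + (\<Sum>r\<in>Y0 m. \<Sum>s\<in>{1..t r - 1}.
             line (restr p m n t (ad p m n t (ddx r) ^^ (p ^ s)))))
    \<and> (odd n \<longrightarrow>
      (Der_neg p m n t :: 'a vf_map set) =
        (\<lambda>E. restr p m n t (ad p m n t E)) ` W_even_deg p m n t (- 1)
        + (\<Sum>r\<in>Y0 m. \<Sum>s\<in>{1..t r - 1}.
             line (restr p m n t (ad p m n t (ddx r) ^^ (p ^ s)))))"
proof -
  interpret ham p m n t "TYPE('a)"
    using assms by unfold_locales auto
  show ?thesis using Der_neg_even Der_neg_odd by blast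
qed

end
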